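(* Let $3\le k<n$, and let $F$, $D=P_1+\dots+P_n$, $P_i=(\alpha_i,\beta_i)$, $\omega$ and $\gamma_i=\mathrm{res}_{P_i}(\omega)$ be as in the context. A parity-check matrix of the elliptic curve code $\mathcal{C}_{\mathcal{L}}(D,kO)$ is given as follows. - First type: the matrix $G(D,\omega,(y)+(n-k)O)$ whose rows are $\left(\frac{\gamma_1\alpha_1^{j}}{\beta_1},\dots,\frac{\gamma_n\alpha_n^{j}}{\beta_n}\right)$ for $0\le j\le\lfloor\frac{n-k}{2}\rfloor$, followed by $\left(\gamma_1\alpha_1^{j},\dots,\gamma_n\alpha_n^{j}\right)$ for $0\le j\le\lfloor\frac{n-k-3}{2}\rfloor$. - Second type: the matrix $G(D,\omega,(n-k)O)$ whose rows are $\left(\gamma_1\alpha_1^{j},\dots,\gamma_n\alpha_n^{j}\right)$ for $0\le j\le\lfloor\frac{n-k}{2}\rfloor$, followed by $\left(\gamma_1\alpha_1^{j}\beta_1,\dots,\gamma_n\alpha_n^{j}\beta_n\right)$ for $0\le j\le\lfloor\frac{n-k-3}{2}\rfloor$. - Third type: the matrix $G(D,\omega,(ax+b)+(n-k)O)$ whose rows are $\left(\frac{\gamma_1\alpha_1^{j}}{a\alpha_1+b},\dots,\frac{\gamma_n\alpha_n^{j}}{a\alpha_n+b}\right)$ for $0\le j\le\lfloor\frac{n-k}{2}\rfloor$, followed by $\left(\gamma_1\beta_1\alpha_1^{j},\dots,\gamma_n\beta_n\alpha_n^{j}\right)$ for $0\le j\le\lfloor\frac{n-k-3}{2}\rfl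oor$.
   Context: Elliptic function fields $F=\mathbb{F}_q(x,y)$ of three types: - First type: $q$ odd, $y^2=f(x)$ with $f\in\mathbb{F}_q[x]$ square-free of degree $3$. - Second type: $q$ even, $y^2+y=f(x)$ with $f\in\mathbb{F}_q[x]$, $\deg f=3$. - Third type: $q$ even, $y^2+y=x+\frac{1}{ax+b}$ with $a,b\in\mathbb{F}_q$, $a\ne 0$. $O$ is the unique pole of $x$ in $F$. Evaluation points: let $T\subseteq\mathbb{F}_q$ be a nonempty set such that for each $\alpha\in T$ the place $x=\alpha$ of $\mathbb{F}_q(x)$ splits completely in $F$, i.e. there are exactly two affine $\mathbb{F}_q$-rational points with $x$-coordinate $\alpha$ (in particular $f(\alpha)\ne0$ for the first type and $a\alpha+b\neq0$ for the third type). The points $P_1,\dots,P_n$, $P_i=(\alpha_i,\beta_i)$, are all these rational points, so $n=2\#T$, and $D=P_1+\cdots+P_n$. Put $t=\prod_{\alpha\in T}(x-\alpha)$, $\omega=dx/t$, and $\gamma_i=\mathrm{res}_{P_i}(\omega)$. The code is $\mathcal{C}_{\mathcal{L}}(D,kO)=\{(g(P_1),\dots,g(P_n)): g\in\mathcal{L}(kO)\}\subseteq\mathbb{F}_q^n$, where $\mathcal{L}(kO)$ is the Riemann-Roch space. A parity-check matrix of a $k$-dimensional code $\mathcal{C}$ is an $(n-k)\times n$ matrix whose rows form a basis of the Euclidean dual $\mathcal{C}^\perp$. A family of rows indexed by an empty range is omitted. *)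

theory Defs
  imports
    "HOL-Computational_Algebra.Computational_Algebra"
    "HOL-Library.Poly_Mapping"
    "Jordan_Normal_Form.VS_Connect"
begin

section \<open>Function fields and their places\<close>

text \<open>The function field \<open>F\<close> is the whole type \<open>'f\<close>; its constant field is the type \<open>'k\<close>,
  embedded in \<open>F\<close> by a field homomorphism \<open>\<iota>\<close>.\<close>

definition is_subfield :: "'f::field set \<Rightarrow> bool" where
  "is_subfield L \<longleftrightarrow> 1 \<in> L \<and>
     (\<forall>u\<in>L. \<forall>v\<in>L. u - v \<in> L \<and> u * v \<in> L) \<and> (\<forall>u\<in>L. inverse u \<in> L)"

text \<open>\<open>F = K(x, y)\<close> with \<open>x\<close> transcendental over \<open>K\<close>.\<close>

definition function_field_gen :: "('k::field \<Rightarrow> 'f::field) \<Rightarrow> 'f \<Rightarrow> 'f \<Rightarrow> bool" where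
  "function_field_gen \<iota> x y \<longleftrightarrow> field_hom \<iota> \<and>
     (\<forall>p :: 'k poly. poly (map_poly \<iota> p) x = 0 \<longrightarrow> p = 0) \<and>
     (\<forall>L. is_subfield L \<and> range \<iota> \<subseteq> L \<and> x \<in> L \<and> y \<in> L \<longrightarrow> L = UNIV)"

text \<open>Valuation rings satisfy \<open>K \<subset> R \<subset> F\<close> strictly; a place is the maximal ideal (the set of
  non-units) of a valuation ring, and the valuation ring is recovered from the place.\<close>

definition valuation_ring :: "('k::field \<Rightarrow> 'f::field) \<Rightarrow> 'f set \<Rightarrow> bool" where
  "valuation_ring \<iota> R \<longleftrightarrow> (\<forall>u\<in>R. \<forall>v\<in>R. u - v \<in> R \<and> u * v \<in> R) \<and>
     range \<iota> \<subset> R \<and> R \<noteq> UNIV \<and> (\<forall>z. z \<in> R \<or> inverse z \<in> R)"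

definition is_place :: "('k::field \<Rightarrow> 'f::field) \<Rightarrow> 'f set \<Rightarrow> bool" where
  "is_place \<iota> P \<longleftrightarrow>
     (\<exists>R. valuation_ring \<iota> R \<and> P = {z \<in> R. z = 0 \<or> inverse z \<notin> R})"

definition val_ring_of :: "'f::field set \<Rightarrow> 'f set" where
  "val_ring_of P = {z. z = 0 \<or> inverse z \<notin> P}"

definition prime_element_at :: "'f::field set \<Rightarrow> 'f \<Rightarrow> bool" where
  "prime_element_at P s \<longleftrightarrow> P = (\<lambda>z. s * z) ` val_ring_of P"

text \<open>The normalised discrete valuation at \<open>P\<close>, meaningful for \<open>z \<noteq> 0\<close>; the convention
  \<open>v(0) = \<infinity>\<close> is built into \<open>val_ge\<close>.\<close>

definition valn :: "'f::field set \<Rightarrow> 'f \<Rightarrow> int" where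
  "valn P z = (THE m. \<exists>s u. prime_element_at P s \<and> u \<in> val_ring_of P - P \<and> z = s powi m * u)"

definition val_ge :: "'f::field set \<Rightarrow> 'f \<Rightarrow> int \<Rightarrow> bool" where
  "val_ge P z m \<longleftrightarrow> z = 0 \<or> m \<le> valn P z"

definition poles :: "('k::field \<Rightarrow> 'f::field) \<Rightarrow> 'f \<Rightarrow> 'f set set" where
  "poles \<iota> z = {P. is_place \<iota> P \<and> z \<noteq> 0 \<and> valn P z < 0}"

text \<open>Places of degree one: the residue class field is \<open>K\<close>.\<close>

definition rational_place :: "('k::field \<Rightarrow> 'f::field) \<Rightarrow> 'f set \<Rightarrow> bool" where
  "rational_place \<iota> P \<longleftrightarrow> is_place \<iota> P \<and> (\<forall>z\<in>val_ring_of P. \<exists>c. z - \<iota> c \<in> P)"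

definition value_at :: "('k::field \<Rightarrow> 'f::field) \<Rightarrow> 'f \<Rightarrow> 'f set \<Rightarrow> 'k" where
  "value_at \<iota> z P = (THE c. z - \<iota> c \<in> P)"

text \<open>A divisor is a finitely supported map from places to the integers.\<close>

definition riemann_roch_space ::
    "('k::field \<Rightarrow> 'f::field) \<Rightarrow> ('f set \<Rightarrow>\<^sub>0 int) \<Rightarrow> 'f set" where
  "riemann_roch_space \<iota> G = {z. \<forall>P. is_place \<iota> P \<longrightarrow> val_ge P z (- Poly_Mapping.lookup G P)}"


section \<open>Differentials and residues\<close>

definition is_derivation :: "('k::field \<Rightarrow> 'f::field) \<Rightarrow> ('f \<Rightarrow> 'f) \<Rightarrow> bool" where
  "is_derivation \<iota> \<delta> \<longleftrightarrow> (\<forall>u v. \<delta> (u + v) = \<delta> u + \<delta> v) \<and>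
     (\<forall>u v. \<delta> (u * v) = u * \<delta> v + v * \<delta> u) \<and> (\<forall>c. \<delta> (\<iota> c) = 0)"

text \<open>\<open>d/ds\<close>, for a separating element \<open>s\<close>.\<close>

definition deriv_wrt :: "('k::field \<Rightarrow> 'f::field) \<Rightarrow> 'f \<Rightarrow> 'f \<Rightarrow> 'f" where
  "deriv_wrt \<iota> s = (THE \<delta>. is_derivation \<iota> \<delta> \<and> \<delta> s = 1)"

text \<open>The module of differentials of \<open>F/K\<close> is the \<open>F\<close>-dual of the space of \<open>K\<close>-derivations of
  \<open>F\<close>: the differential \<open>u dz\<close> is the functional \<open>\<delta> \<mapsto> u * \<delta> z\<close>. In particular \<open>\<omega> = h ds\<close> has
  \<open>h = \<omega> (d/ds)\<close>.\<close>

type_synonym 'f differential = "('f \<Rightarrow> 'f) \<Rightarrow> 'f"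

definition differential :: "'f::field \<Rightarrow> 'f \<Rightarrow> 'f differential" where
  "differential u z = (\<lambda>\<delta>. u * \<delta> z)"

text \<open>The \<open>P\<close>-adic expansion of \<open>z\<close> in powers of the prime element \<open>s\<close> at a rational place
  \<open>P\<close>.\<close>

definition laurent_expansion_at ::
    "('k::field \<Rightarrow> 'f::field) \<Rightarrow> 'f set \<Rightarrow> 'f \<Rightarrow> 'f \<Rightarrow> 'k fls" where
  "laurent_expansion_at \<iota> P s z = (THE a. \<forall>m.
     val_ge P (z - (\<Sum>i\<in>{fls_subdegree a..<m}. \<iota> (fls_nth a i) * s powi i)) m)"

text \<open>The residue at a rational place does not depend on the chosen prime element.\<close>

definition residue_at :: "('k::field \<Rightarrow> 'f::field) \<Rightarrow> 'f set \<Rightarrow> 'f differential \<Rightarrow> 'k" where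
  "residue_at \<iota> P \<omega> = (let s = (SOME s. prime_element_at P s) in
     fls_residue (laurent_expansion_at \<iota> P s (\<omega> (deriv_wrt \<iota> s))))"


section \<open>The three types of elliptic function fields\<close>

definition elliptic_type1 :: "('k::finite_field \<Rightarrow> 'f::field) \<Rightarrow> 'f \<Rightarrow> 'f \<Rightarrow> 'k poly \<Rightarrow> bool" where
  "elliptic_type1 \<iota> x y f \<longleftrightarrow> function_field_gen \<iota> x y \<and> odd (card (UNIV :: 'k set)) \<and>
     degree f = 3 \<and> squarefree f \<and> y ^ 2 = poly (map_poly \<iota> f) x"

definition elliptic_type2 :: "('k::finite_field \<Rightarrow> 'f::field) \<Rightarrow> 'f \<Rightarrow> 'f \<Rightarrow> 'k poly \<Rightarrow> bool" where
  "elliptic_type2 \<iota> x y f \<longleftrightarrow> function_field_gen \<iota> x y \<and> even (card (UNIV :: 'k set)) \<and>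
     degree f = 3 \<and> y ^ 2 + y = poly (map_poly \<iota> f) x"

definition elliptic_type3 ::
    "('k::finite_field \<Rightarrow> 'f::field) \<Rightarrow> 'f \<Rightarrow> 'f \<Rightarrow> 'k \<Rightarrow> 'k \<Rightarrow> bool" where
  "elliptic_type3 \<iota> x y a b \<longleftrightarrow> function_field_gen \<iota> x y \<and> even (card (UNIV :: 'k set)) \<and>
     a \<noteq> 0 \<and> y ^ 2 + y = x + 1 / (\<iota> a * x + \<iota> b)"

text \<open>The rational places \<open>P\<close> with \<open>x(P) = \<alpha>\<close>. As \<open>F\<close> has degree two over \<open>K(x)\<close>, the place
  \<open>x = \<alpha>\<close> splits completely iff there are exactly two of them.\<close>

definition rational_places_over :: "('k::field \<Rightarrow> 'f::field) \<Rightarrow> 'f \<Rightarrow> 'k \<Rightarrow> 'f set set" where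
  "rational_places_over \<iota> x \<alpha> = {P. rational_place \<iota> P \<and> x - \<iota> \<alpha> \<in> P}"

definition splits_completely :: "('k::field \<Rightarrow> 'f::field) \<Rightarrow> 'f \<Rightarrow> 'k \<Rightarrow> bool" where
  "splits_completely \<iota> x \<alpha> \<longleftrightarrow> card (rational_places_over \<iota> x \<alpha>) = 2"


section \<open>Codes\<close>

definition ag_code :: "('k::field \<Rightarrow> 'f::field) \<Rightarrow> nat \<Rightarrow> (nat \<Rightarrow> 'f set) \<Rightarrow>
    ('f set \<Rightarrow>\<^sub>0 int) \<Rightarrow> 'k vec set" where
  "ag_code \<iota> n P G = (\<lambda>g. vec n (\<lambda>i. value_at \<iota> g (P i))) ` riemann_roch_space \<iota> G"

definition dual_code :: "nat \<Rightarrow> 'k::field vec set \<Rightarrow> 'k vec set" where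
  "dual_code n C = {w \<in> carrier_vec n. \<forall>c\<in>C. w \<bullet> c = 0}"

definition is_code :: "nat \<Rightarrow> nat \<Rightarrow> 'k::field vec set \<Rightarrow> bool" where
  "is_code n k C \<longleftrightarrow> subspace class_ring C (module_vec TYPE('k) n) \<and>
     vectorspace.dim class_ring (module_vec TYPE('k) n \<lparr>carrier := C\<rparr>) = k"

definition is_parity_check_matrix :: "nat \<Rightarrow> nat \<Rightarrow> 'k::field vec set \<Rightarrow> 'k mat \<Rightarrow> bool" where
  "is_parity_check_matrix n k C H \<longleftrightarrow> is_code n k C \<and> H \<in> carrier_mat (n - k) n \<and>
     distinct (rows H) \<and>
     vectorspace.basis class_ring (module_vec TYPE('k) n \<lparr>carrier := dual_code n C\<rparr>)
       (set (rows H))"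

text \<open>Exponents range over integer intervals \<open>[0..b]\<close>, empty for \<open>b < 0\<close>; \<open>div\<close> on the integers
  rounds down, so \<open>(n - k - 3) div 2\<close> is negative for \<open>n - k < 3\<close>.\<close>

definition parity_matrix1 ::
    "nat \<Rightarrow> nat \<Rightarrow> (nat \<Rightarrow> 'k::field) \<Rightarrow> (nat \<Rightarrow> 'k) \<Rightarrow> (nat \<Rightarrow> 'k) \<Rightarrow> 'k mat" where
  "parity_matrix1 n k \<alpha> \<beta> \<gamma> = mat_of_rows n
     (map (\<lambda>j. vec n (\<lambda>i. \<gamma> i * \<alpha> i ^ nat j / \<beta> i)) [0..(int n - int k) div 2] @
      map (\<lambda>j. vec n (\<lambda>i. \<gamma> i * \<alpha> i ^ nat j)) [0..(int n - int k - 3) div 2])"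

definition parity_matrix2 ::
    "nat \<Rightarrow> nat \<Rightarrow> (nat \<Rightarrow> 'k::field) \<Rightarrow> (nat \<Rightarrow> 'k) \<Rightarrow> (nat \<Rightarrow> 'k) \<Rightarrow> 'k mat" where
  "parity_matrix2 n k \<alpha> \<beta> \<gamma> = mat_of_rows n
     (map (\<lambda>j. vec n (\<lambda>i. \<gamma> i * \<alpha> i ^ nat j)) [0..(int n - int k) div 2] @
      map (\<lambda>j. vec n (\<lambda>i. \<gamma> i * \<alpha> i ^ nat j * \<beta> i)) [0..(int n - int k - 3) div 2])"

definition parity_matrix3 ::
    "'k \<Rightarrow> 'k \<Rightarrow> nat \<Rightarrow> nat \<Rightarrow> (nat \<Rightarrow> 'k::field) \<Rightarrow> (nat \<Rightarrow> 'k) \<Rightarrow> (nat \<Rightarrow> 'k) \<Rightarrow> 'k mat" where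
  "parity_matrix3 a b n k \<alpha> \<beta> \<gamma> = mat_of_rows n
     (map (\<lambda>j. vec n (\<lambda>i. \<gamma> i * \<alpha> i ^ nat j / (a * \<alpha> i + b))) [0..(int n - int k) div 2] @
      map (\<lambda>j. vec n (\<lambda>i. \<gamma> i * \<beta> i * \<alpha> i ^ nat j)) [0..(int n - int k - 3) div 2])"

end

theory Submission
  imports Defs
begin

text \<open>All three types are put in the form \<open>w\<^sup>2 + h(x) w = g(x)\<close> with \<open>deg h \<le> 1\<close> and \<open>deg g = 3\<close>:
  \<open>w = y, h = 0\<close> for the first type, \<open>w = y, h = 1\<close> for the second, and \<open>w = (ax + b) y\<close>,
  \<open>h = ax + b\<close>, \<open>g = h\<^sup>2 x + h\<close> for the third.  As \<open>K[x, w]\<close> is integrally closed and \<open>x\<close>, \<open>w\<close>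
  have pole orders 2 and 3 at \<open>O\<close>, the space \<open>L(kO)\<close> consists of the \<open>A(x) + B(x) w\<close> with
  \<open>2 deg A \<le> k\<close> and \<open>2 deg B + 3 \<le> k\<close>.  At a point over \<open>\<alpha> \<in> T\<close> the element \<open>x - \<alpha>\<close> is a
  local parameter, so \<open>\<omega>\<close> has residue \<open>1 / t'(\<alpha>)\<close>.  Up to a constant, the rows of the matrix are
  in all three cases the vectors of \<open>\<gamma> x\<^sup>j / (2w + h)\<close> and \<open>\<gamma> x\<^sup>j w / (2w + h)\<close>.  As
  \<open>2w + h\<close> is the difference of the two conjugates of \<open>w\<close>, the trace of \<open>(U + V w) / (2w + h)\<close> is
  \<open>V\<close>; so the pairing of \<open>A + B w\<close> with \<open>(A' + B' w) / (2w + h)\<close> is the sum over \<open>\<alpha> \<in> T\<close> of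
  \<open>(A B' + B (A' - h B'))(\<alpha>) / t'(\<alpha>)\<close>, which by Lagrange interpolation is a coefficient of a polynomial.
  Testing against \<open>x\<^sup>i\<close> and \<open>x\<^sup>i w\<close> then turns orthogonality into the degree bounds of the matrix.\<close>

section \<open>Valuation rings\<close>

text \<open>Places are given only as maximal ideals of valuation rings, and order, derivative,
  expansion and residue only through definite descriptions, so each must be shown well defined
  before it can be computed. Discreteness of every place is part of this: the value group of K(x) is
  generated by one polynomial or by 1/x, and since F is quadratic over K(x) the value of every
  square lies in that group, which costs at most a factor 2. The second obstacle is that a function
  without poles away from \<open>O\<close> is regular on those valuation rings that exist; that
  there are enough of them to make it polynomial is a Zorn argument. The hypothesis
  \<open>normal\<close> serves twice: it clears denominators in L(kO), and it makes the rational
  points smooth. Dimensions are read off explicit bases, and every sum over the points is folded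
  into a sum over T, that is, into polynomial interpolation. In the third type y has a pole where ax
  + b vanishes; the factor ax + b in w removes it.\<close>

locale discrete_valuation =
  fixes P :: "'f::field set" and v :: "'f \<Rightarrow> int"
  assumes v_mult: "a \<noteq> 0 \<Longrightarrow> b \<noteq> 0 \<Longrightarrow> v (a * b) = v a + v b"
    and v_add: "a \<noteq> 0 \<Longrightarrow> b \<noteq> 0 \<Longrightarrow> a + b \<noteq> 0 \<Longrightarrow> min (v a) (v b) \<le> v (a + b)"
    and v_surj: "\<exists>s. s \<noteq> 0 \<and> v s = 1"
    and P_eq: "P = {z. z = 0 \<or> 0 < v z}"
begin

lemma v_one [simp]: "v 1 = 0"
  using v_mult[of 1 1] by simp

lemma v_inverse: "a \<noteq> 0 \<Longrightarrow> v (inverse a) = - v a"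
  using v_mult[of a "inverse a"] by simp

lemma v_divide: "a \<noteq> 0 \<Longrightarrow> b \<noteq> 0 \<Longrightarrow> v (a / b) = v a - v b"
  using v_mult[of a "inverse b"] v_inverse[of b] by (simp add: divide_inverse)

lemma v_minus [simp]: "v (- a) = v a"
proof (cases "a = 0")
  case False
  have "v (-1) = 0"
    using v_mult[of "-1" "-1"] by simp
  then show ?thesis
    using v_mult[of "-1" a] False by simp
qed simp

lemma v_power: "a \<noteq> 0 \<Longrightarrow> v (a ^ m) = int m * v a"
  by (induction m) (auto simp: v_mult algebra_simps)

lemma v_powi: "a \<noteq> 0 \<Longrightarrow> v (a powi m) = m * v a"
  by (auto simp: power_int_def v_power v_inverse)

lemma v_diff: "a \<noteq> 0 \<Longrightarrow> b \<noteq> 0 \<Longrightarrow> a - b \<noteq> 0 \<Longrightarrow> min (v a) (v b) \<le> v (a - b)"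
  using v_add[of a "- b"] by simp

lemma v_add_ge:
  assumes "a = 0 \<or> m \<le> v a" "b = 0 \<or> m \<le> v b"
  shows "a + b = 0 \<or> m \<le> v (a + b)"
  using v_add[of a b] assms by (cases "a = 0"; cases "b = 0"; cases "a + b = 0") auto

text \<open>If \<open>v (a + b)\<close> were larger than \<open>v a\<close>, writing a = (a + b) - b
  would give \<open>a\<close> a valuation above its own.\<close>

lemma v_add_eq:
  assumes "a \<noteq> 0" "b = 0 \<or> v a < v b"
  shows "a + b \<noteq> 0" "v (a + b) = v a"
proof -
  show nz: "a + b \<noteq> 0"
    using assms v_minus[of a] by (auto simp: add_eq_0_iff2)
  show "v (a + b) = v a"
  proof (cases "b = 0")
    case False
    have "v a < v b" using False assms by auto
    moreover have "min (v a) (v b) \<le> v (a + b)"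
      using v_add[of a b] False assms nz by auto
    moreover have "min (v (a + b)) (v b) \<le> v a"
      using v_diff[of "a + b" b] False assms nz by auto
    ultimately show ?thesis by auto
  qed simp
qed

lemma val_ring: "val_ring_of P = {z. z = 0 \<or> 0 \<le> v z}"
  unfolding val_ring_of_def P_eq using v_inverse by force

lemma unit_iff: "u \<in> val_ring_of P - P \<longleftrightarrow> u \<noteq> 0 \<and> v u = 0"
  unfolding val_ring by (auto simp: P_eq)

text \<open>An element \<open>q\<close> of valuation 1 lies in \<open>P\<close> and is therefore a
  multiple of \<open>s\<close> by something integral; as \<open>s\<close> has positive valuation
  itself, that valuation is 1.\<close>

lemma prime_element_iff: "prime_element_at P s \<longleftrightarrow> s \<noteq> 0 \<and> v s = 1"
proof
  assume p: "prime_element_at P s"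
  then have eq: "P = (*) s ` {z. z = 0 \<or> 0 \<le> v z}"
    by (simp add: prime_element_at_def val_ring)
  obtain q where q: "q \<noteq> 0" "v q = 1" using v_surj by auto
  then have "q \<in> P" by (simp add: P_eq)
  then obtain z where z: "q = s * z" "z = 0 \<or> 0 \<le> v z" using eq by auto
  then have nz: "s \<noteq> 0" "z \<noteq> 0" using q by auto
  have "s \<in> P" unfolding eq by (rule image_eqI[of _ _ 1]) auto
  then have "v s > 0" using nz by (auto simp: P_eq)
  moreover have "1 = v s + v z" using v_mult[of s z] nz z q by simp
  ultimately show "s \<noteq> 0 \<and> v s = 1" using nz z by auto
next
  assume s: "s \<noteq> 0 \<and> v s = 1"
  show "prime_element_at P s"
    unfolding prime_element_at_def val_ring
  proof (intro equalityI subsetI)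
    fix z assume z: "z \<in> P"
    have "z / s = 0 \<or> 0 \<le> v (z / s)"
      using z s v_divide[of z s] by (cases "z = 0") (auto simp: P_eq)
    then show "z \<in> (*) s ` {z. z = 0 \<or> 0 \<le> v z}"
      using s by (intro image_eqI[of _ _ "z / s"]) auto
  next
    fix z assume "z \<in> (*) s ` {z. z = 0 \<or> 0 \<le> v z}"
    then show "z \<in> P" using s v_mult[of s] unfolding P_eq by force
  qed
qed

lemma prime_element_exists: "\<exists>s. prime_element_at P s"
  using v_surj by (simp add: prime_element_iff)

text \<open>This frees \<open>valn\<close> from its definite description: any \<open>v\<close>
  fitting the locale computes it. The exponent in z = s^m u is read off by applying
  \<open>v\<close>, which is 1 on \<open>s\<close> and 0 on \<open>u\<close>.\<close>

lemma valn_eq: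
  assumes "z \<noteq> 0"
  shows "valn P z = v z"
  unfolding valn_def
proof (rule the_equality)
  obtain s where s: "s \<noteq> 0" "v s = 1" using v_surj by auto
  have nz: "s powi v z \<noteq> 0" using s by simp
  have "v (z / s powi v z) = 0"
    using v_divide[OF assms nz] s v_powi[of s] by simp
  then show "\<exists>s u. prime_element_at P s \<and> u \<in> val_ring_of P - P \<and> z = s powi v z * u"
    using s nz assms unfolding prime_element_iff unit_iff
    by (intro exI[of _ s] exI[of _ "z / s powi v z"]) auto
next
  fix m assume "\<exists>s u. prime_element_at P s \<and> u \<in> val_ring_of P - P \<and> z = s powi m * u"
  then obtain s u where "s \<noteq> 0" "v s = 1" "u \<noteq> 0" "v u = 0" "z = s powi m * u"
    unfolding prime_element_iff unit_iff by auto
  then show "m = v z" by (simp add: v_mult v_powi)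
qed

lemma discrete_valuation_valn: "discrete_valuation P (valn P)"
proof
  show "valn P (a * b) = valn P a + valn P b" if "a \<noteq> 0" "b \<noteq> 0" for a b
    using that v_mult by (simp add: valn_eq)
  show "min (valn P a) (valn P b) \<le> valn P (a + b)" if "a \<noteq> 0" "b \<noteq> 0" "a + b \<noteq> 0" for a b
    using that v_add by (simp add: valn_eq)
  obtain s where s: "s \<noteq> 0" "v s = 1" using v_surj by auto
  then show "\<exists>s. s \<noteq> 0 \<and> valn P s = 1" using valn_eq[of s] by (intro exI[of _ s]) simp
  have "z \<in> P \<longleftrightarrow> z = 0 \<or> 0 < valn P z" for z
    by (cases "z = 0") (simp_all add: valn_eq, simp_all add: P_eq)
  then show "P = {z. z = 0 \<or> 0 < valn P z}" by blast
qed

lemma val_ge_iff: "val_ge P z m \<longleftrightarrow> z = 0 \<or> m \<le> v z"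
  unfolding val_ge_def by (cases "z = 0") (auto simp: valn_eq)

end

section \<open>Valuation rings of F/K and their maximal ideals\<close>

locale valuation_subring =
  fixes \<iota> :: "'k::field \<Rightarrow> 'f::field" and R :: "'f set"
  assumes hom: "field_hom \<iota>" and valuation_ring: "valuation_ring \<iota> R"
begin

interpretation field_hom \<iota> by (rule hom)

lemma const_in: "\<iota> c \<in> R"
  using valuation_ring unfolding valuation_ring_def by blast

lemma diff_in: "u \<in> R \<Longrightarrow> v \<in> R \<Longrightarrow> u - v \<in> R"
  and mult_in: "u \<in> R \<Longrightarrow> v \<in> R \<Longrightarrow> u * v \<in> R"
  and dichotomy: "z \<in> R \<or> inverse z \<in> R"
  using valuation_ring by (simp_all add: valuation_ring_def)

lemma proper: "\<exists>z. z \<notin> R"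
  using valuation_ring unfolding valuation_ring_def by blast

lemma one_in: "1 \<in> R" and zero_in: "0 \<in> R"
  using const_in[of 1] const_in[of 0] by (auto simp: hom_one hom_zero)

lemma minus_in: "u \<in> R \<Longrightarrow> - u \<in> R"
  using diff_in[OF zero_in] by simp

lemma add_in: "u \<in> R \<Longrightarrow> v \<in> R \<Longrightarrow> u + v \<in> R"
  using diff_in[of u "- v"] minus_in[of v] by simp

lemma power_in: "u \<in> R \<Longrightarrow> u ^ n \<in> R"
  by (induction n) (auto simp: one_in mult_in)

abbreviation M :: "'f set" where "M \<equiv> {z \<in> R. z = 0 \<or> inverse z \<notin> R}"

lemma val_ring_of_M: "val_ring_of M = R"
  unfolding val_ring_of_def using dichotomy zero_in by auto

lemma M_mult: assumes "a \<in> M" "r \<in> R" shows "a * r \<in> M"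
proof (cases "a * r = 0")
  case False
  then have "r * inverse (a * r) = inverse a" by simp
  then show ?thesis using assms False mult_in[of r "inverse (a * r)"] mult_in[of a r]
    by (metis (mono_tags, lifting) mem_Collect_eq mult_eq_0_iff)
qed (use zero_in in auto)

lemma M_minus: "a \<in> M \<Longrightarrow> - a \<in> M"
  using M_mult[of a "-1"] minus_in[OF one_in] by simp

lemma M_add_aux: assumes "a \<in> M" "b \<in> M" "b \<noteq> 0" "a * inverse b \<in> R" shows "a + b \<in> M"
proof -
  have "a + b = b * (a * inverse b + 1)" using assms by (simp add: field_simps)
  then show ?thesis using M_mult[of b "a * inverse b + 1"] assms add_in one_in by simp
qed

text \<open>The dichotomy makes a/b or b/a integral, so the sum is one of the summands times an
  element of \<open>R\<close>.\<close>

lemma M_add: assumes "a \<in> M" "b \<in> M" shows "a + b \<in> M"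
proof (cases "a = 0 \<or> b = 0")
  case False
  have "a * inverse b \<in> R \<or> b * inverse a \<in> R"
    using dichotomy[of "a * inverse b"] by (simp add: mult.commute)
  then show ?thesis
    using M_add_aux[of a b] M_add_aux[of b a] False assms by (auto simp: add.commute)
qed (use assms in auto)

lemma one_notin_M: "1 \<notin> M"
  using one_in by auto

lemma const_unit: "c \<noteq> 0 \<Longrightarrow> \<iota> c \<noteq> 0 \<and> inverse (\<iota> c) \<in> R"
  using const_in[of "inverse c"] by (simp add: hom_inverse)

lemma one_plus_unit: assumes "a \<in> M" shows "1 + a \<noteq> 0 \<and> 1 + a \<in> R \<and> inverse (1 + a) \<in> R"
proof -
  have "1 + a \<notin> M"
  proof
    assume "1 + a \<in> M"
    then have "1 + a + (- a) \<in> M" using M_add M_minus assms by blast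
    then show False using one_notin_M by simp
  qed
  moreover have "1 + a \<in> R" using assms add_in one_in by auto
  ultimately show ?thesis by auto
qed

text \<open>If the value group is cyclic after doubling, it is cyclic.\<close>

lemma discrete_valuation_if_squares:
  assumes p: "p \<in> M" "p \<noteq> 0"
    and sq: "\<And>z. z \<noteq> 0 \<Longrightarrow> \<exists>m::int. z ^ 2 * p powi m \<in> R \<and> inverse (z ^ 2 * p powi m) \<in> R"
  shows "\<exists>v. discrete_valuation M v \<and> (\<forall>c. c \<noteq> 0 \<longrightarrow> v (\<iota> c) = 0)
    \<and> (v p = 1 \<or> v p = 2)"
proof -
  define U where "U z \<longleftrightarrow> z \<noteq> 0 \<and> z \<in> R \<and> inverse z \<in> R" for z
  have U_mult: "U (a * b)" if "U a" "U b" for a b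
    using that mult_in unfolding U_def by (auto simp: mult_in)
  have U_inv: "U (inverse a)" if "U a" for a
    using that unfolding U_def by auto
  \<comment> \<open>A power of the non-unit \<open>p\<close> is a unit only for exponent 0; this
    makes the exponent attached to \<open>z\<close> below unique.\<close>
  have p_pow_unit: "m = 0" if "U (p powi m)" for m
  proof (rule ccontr)
    assume "m \<noteq> 0"
    have *: "p ^ n \<in> M" if "n > 0" for n
    proof -
      obtain n' where "n = Suc n'" using \<open>n > 0\<close> by (auto simp: gr0_conv_Suc)
      then show ?thesis using M_mult[of p "p ^ n'"] p power_in[of p n'] by auto
    qed
    have "p ^ nat \<bar>m\<bar> \<in> M" using * \<open>m \<noteq> 0\<close> by simp
    moreover have "inverse (p ^ nat \<bar>m\<bar>) \<in> R"
      using that unfolding U_def power_int_def by (auto simp: power_inverse split: if_splits)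
    ultimately show False using p by auto
  qed
  have "\<exists>m::int. U (z ^ 2 * p powi (- m))" if "z \<noteq> 0" for z
  proof -
    obtain m :: int where "z ^ 2 * p powi m \<in> R \<and> inverse (z ^ 2 * p powi m) \<in> R"
      using sq[OF \<open>z \<noteq> 0\<close>] by auto
    then show ?thesis using that p unfolding U_def by (intro exI[of _ "- m"]) auto
  qed
  \<comment> \<open>\<open>W\<close> compares the square of z with powers of \<open>p\<close>: in
    terms of a normalised valuation v it is 2 v(z) / v(p), so \<open>W p\<close> is 2 whatever v(p)
    is.\<close>
  then obtain W where W: "\<And>z. z \<noteq> 0 \<Longrightarrow> U (z ^ 2 * p powi (- W z))" by metis
  have W_eq: "W z = m" if "z \<noteq> 0" "U (z ^ 2 * p powi (- m))" for z m
  proof -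
    have "(z ^ 2 * p powi (- m)) * inverse (z ^ 2 * p powi (- W z)) = p powi (- m) * inverse (p powi (- W z))"
      using that by simp
    also have "\<dots> = p powi (W z - m)"
      using p by (simp add: power_int_minus power_int_diff divide_inverse)
    finally have "U (p powi (W z - m))"
      using U_mult[OF that(2) U_inv[OF W[OF that(1)]]] by simp
    then show ?thesis using p_pow_unit[of "W z - m"] by simp
  qed
  have W_mult: "W (a * b) = W a + W b" if "a \<noteq> 0" "b \<noteq> 0" for a b
  proof -
    have "(a ^ 2 * p powi (- W a)) * (b ^ 2 * p powi (- W b)) = (a * b) ^ 2 * p powi (- (W a + W b))"
      using p power_int_add[of p "- W a" "- W b"]  by (simp add: power_mult_distrib algebra_simps)
    then show ?thesis
      using W_eq[of "a * b" "W a + W b"] U_mult[OF W[OF that(1)] W[OF that(2)]] that by simp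
  qed
  have W_p: "W p = 2"
  proof (rule W_eq)
    have "p ^ 2 * p powi - 2 = 1"
      using p by (simp add: power_int_minus)
    then show "U (p ^ 2 * p powi - 2)" by (simp add: U_def one_in)
  qed (use p in auto)
  have W_one: "W 1 = 0" using W_mult[of 1 1] by simp
  have W_inv: "W (inverse a) = - W a" if "a \<noteq> 0" for a
    using W_mult[of a "inverse a"] that W_one by simp
  have W_nonneg: "0 \<le> W z" if "z \<noteq> 0" "z \<in> R" for z
  proof (rule ccontr)
    \<comment> \<open>One factor \<open>p\<close> is split off, hence the exponent - W z - 1: a
      negative \<open>W z\<close> would make the unit attached to \<open>z\<close> a multiple of
      \<open>p\<close> in \<open>R\<close>.\<close>
    assume neg: "\<not> 0 \<le> W z"
    have "p powi (- W z) = p ^ nat (- W z - 1) * p"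
      using neg p by (simp add: power_int_def power_Suc2[symmetric] Suc_nat_eq_nat_zadd1 del: power_Suc)
    then have eq: "z ^ 2 * p powi (- W z) = p * (z ^ 2 * p ^ nat (- W z - 1))" by simp
    have "z ^ 2 * p ^ nat (- W z - 1) \<in> R" using p that by (intro mult_in power_in) auto
    then have "z ^ 2 * p powi (- W z) \<in> M" unfolding eq by (rule M_mult[OF p(1)])
    then show False using W[of z] that by (auto simp: U_def)
  qed
  have W_iff: "z \<in> R \<longleftrightarrow> 0 \<le> W z" if "z \<noteq> 0" for z
  proof
    assume W0: "0 \<le> W z"
    show "z \<in> R"
    proof (rule ccontr)
      assume nz: "z \<notin> R"
      then have i: "inverse z \<in> M" using dichotomy by auto
      then have "0 \<le> W (inverse z)" using W_nonneg[of "inverse z"] that by auto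
      then have "W z = 0" using W0 W_inv[OF that] by simp
      then have "U (z ^ 2)" using W[OF that] by simp
      then have "z = inverse z * z ^ 2" "z ^ 2 \<in> R" using that
        by (auto simp: U_def power2_eq_square)
      then show False using nz i mult_in[of "inverse z" "z ^ 2"] by auto
    qed
  qed (use that W_nonneg in auto)
  have W_M: "z \<in> M \<longleftrightarrow> 0 < W z" if "z \<noteq> 0" for z
    using W_iff[of z] W_iff[of "inverse z"] W_inv[of z] that by simp linarith
  have W_add: "min (W a) (W b) \<le> W (a + b)" if "a \<noteq> 0" "b \<noteq> 0" "a + b \<noteq> 0" for a b
  proof -
    have *: "W b \<le> W (a + b)" if "a * inverse b \<in> R" "a \<noteq> 0" "b \<noteq> 0" "a + b \<noteq> 0" for a b
    proof -
      have eq: "a + b = b * (a * inverse b + 1)" using that by (simp add: field_simps)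
      have nz: "a * inverse b + 1 \<noteq> 0" using eq that by auto
      have "0 \<le> W (a * inverse b + 1)" using W_nonneg[OF nz] that add_in one_in by auto
      then show ?thesis using eq W_mult[of b "a * inverse b + 1"] that nz by auto
    qed
    have "a * inverse b \<in> R \<or> b * inverse a \<in> R"
      using dichotomy[of "a * inverse b"] by (simp add: mult.commute)
    then show ?thesis
    proof
      assume "a * inverse b \<in> R"
      then show ?thesis using *[of a b] that by linarith
    next
      assume "b * inverse a \<in> R"
      then have "W a \<le> W (b + a)" using *[of b a] that by (simp add: add.commute)
      then show ?thesis by (simp add: add.commute)
    qed
  qed
  have W_const: "W (\<iota> c) = 0" if "c \<noteq> 0" for c
    using const_unit[OF that] W_iff[of "\<iota> c"] W_iff[of "inverse (\<iota> c)"] W_inv[of "\<iota> c"] const_in[of c]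
    by simp
  have M_eq: "M = {z. z = 0 \<or> 0 < W z}"
  proof (rule Collect_cong)
    show "(z \<in> R \<and> (z = 0 \<or> inverse z \<notin> R)) = (z = 0 \<or> 0 < W z)" for z
      using W_M[of z] zero_in by (cases "z = 0") simp_all
  qed
  \<comment> \<open>An odd value of \<open>W\<close> yields, after multiplication by a power of
    \<open>p\<close>, an element with \<open>W\<close> equal to 1; then \<open>W\<close> is
    normalised and v(p) = 2. If all values are even, half of \<open>W\<close> is normalised and v(p)
    = 1.\<close>
  show ?thesis
  proof (cases "\<exists>z. z \<noteq> 0 \<and> odd (W z)")
    case True
    then obtain z where z: "z \<noteq> 0" "odd (W z)" by auto
    obtain j where j: "W z = 2 * j + 1" using z by (auto elim: oddE)
    have Wpow: "W (p powi m) = 2 * m" for m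
    proof -
      have *: "W (p ^ n) = 2 * int n" for n
        by (induction n) (use W_one W_mult p W_p in auto)
      show ?thesis unfolding power_int_def using * W_inv p by (auto simp: power_inverse)
    qed
    have "W (z * p powi (- j)) = 1" using W_mult[of z "p powi (- j)"] z p Wpow j by simp
    then have "discrete_valuation M W"
      using z p by (intro discrete_valuation.intro W_mult W_add M_eq exI[of _ "z * p powi (- j)"]) auto
    then show ?thesis using W_const W_p by blast
  next
    case False
    define v where "v z = W z div 2" for z
    have Wv: "W z = 2 * v z" if "z \<noteq> 0" for z using False that by (auto simp: v_def)
    have "discrete_valuation M v"
    proof
      show "v (a * b) = v a + v b" if "a \<noteq> 0" "b \<noteq> 0" for a b
        using Wv[of a] Wv[of b] Wv[of "a * b"] W_mult that by auto
      show "min (v a) (v b) \<le> v (a + b)" if "a \<noteq> 0" "b \<noteq> 0" "a + b \<noteq> 0" for a b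
        using Wv[of a] Wv[of b] Wv[of "a + b"] W_add[of a b] that by auto
      show "\<exists>s. s \<noteq> 0 \<and> v s = 1" using p W_p by (auto simp: v_def)
      have "0 < W z \<longleftrightarrow> 0 < v z" if "z \<noteq> 0" for z using Wv[OF that] by simp
      then show "M = {z. z = 0 \<or> 0 < v z}" unfolding M_eq by (intro Collect_cong) blast
    qed
    moreover have "\<forall>c. c \<noteq> 0 \<longrightarrow> v (\<iota> c) = 0" using W_const by (simp add: v_def)
    moreover have "v p = 1" using W_p by (simp add: v_def)
    ultimately show ?thesis by blast
  qed
qed

end

lemma is_place_iff:
  assumes "field_hom \<iota>"
  shows "is_place \<iota> P \<longleftrightarrow> (\<exists>R. valuation_subring \<iota> R \<and> P = {z \<in> R. z = 0 \<or> inverse z \<notin> R})"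
  using assms by (auto simp: is_place_def valuation_subring_def)

section \<open>Cubic function fields in Weierstrass form\<close>

locale weierstrass =
  fixes \<iota> :: "'k::field \<Rightarrow> 'f::field" and x w :: 'f and h g :: "'k poly"
  assumes hom: "field_hom \<iota>"
    and transcendental: "poly (map_poly \<iota> p) x = 0 \<Longrightarrow> p = 0"
    and generates: "is_subfield L \<Longrightarrow> range \<iota> \<subseteq> L \<Longrightarrow> x \<in> L \<Longrightarrow> w \<in> L \<Longrightarrow> L = UNIV"
    and curve: "w ^ 2 + poly (map_poly \<iota> h) x * w = poly (map_poly \<iota> g) x"
    and deg_h: "degree h \<le> 1" and deg_g: "degree g = 3"
    and separable: "(2 :: 'k) \<noteq> 0 \<or> h \<noteq> 0"
    \<comment> \<open>\<open>K[x, w]\<close> is integrally closed: \<open>(A + B w) / C\<close> lies in it if its trace and norm are in \<open>K[x]\<close>\<close>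
    and normal: "C \<noteq> 0 \<Longrightarrow> C dvd 2 * A - h * B \<Longrightarrow> C ^ 2 dvd A ^ 2 - h * A * B - g * B ^ 2
      \<Longrightarrow> C dvd A \<and> C dvd B"
begin

sublocale iota: field_hom \<iota> by (rule hom)

section \<open>The subring K[x] of F\<close>

definition X :: "'k poly \<Rightarrow> 'f" where
  "X p = poly (map_poly \<iota> p) x"

lemma X_0 [simp]: "X 0 = 0"
  by (simp add: X_def)

lemma X_pCons: "X (pCons c p) = \<iota> c + x * X p"
  by (simp add: X_def map_poly_pCons iota.hom_zero)

lemma X_add [simp]: "X (p + q) = X p + X q"
  by (induction p q rule: poly_induct2) (simp_all add: X_pCons iota.hom_add algebra_simps)

lemma X_minus [simp]: "X (- p) = - X p"
  using X_add[of p "- p"] by (simp add: add_eq_0_iff)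

lemma X_diff [simp]: "X (p - q) = X p - X q"
  using X_add[of p "- q"] by simp

lemma X_smult [simp]: "X (Polynomial.smult c p) = \<iota> c * X p"
  by (induction p) (simp_all add: X_pCons iota.hom_mult algebra_simps)

lemma X_mult [simp]: "X (p * q) = X p * X q"
  by (induction p) (simp_all add: X_pCons iota.hom_zero algebra_simps)

lemma X_1 [simp]: "X 1 = 1"
  by (simp add: one_pCons X_pCons iota.hom_one)

lemma X_power [simp]: "X (p ^ m) = X p ^ m"
  by (induction m) simp_all

lemma X_of_nat [simp]: "X (of_nat m) = of_nat m"
  by (induction m) simp_all

lemma X_numeral [simp]: "X (numeral m) = numeral m"
  using X_of_nat[of "numeral m"] by simp

lemma X_const [simp]: "X [:c:] = \<iota> c"
  by (simp add: X_pCons)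

lemma X_var [simp]: "X [:0, 1:] = x"
  by (simp add: X_pCons iota.hom_one)

lemma X_eq_0_iff [simp]: "X p = 0 \<longleftrightarrow> p = 0"
  using transcendental[of p] by (auto simp: X_def)

lemma X_eq_iff [simp]: "X p = X q \<longleftrightarrow> p = q"
  using X_eq_0_iff[of "p - q"] by simp

lemma curve_X: "w ^ 2 = X g - X h * w"
  using curve by (simp add: X_def algebra_simps)

section \<open>The norm form and coordinates with respect to 1 and w\<close>

definition norm_poly :: "'k poly \<Rightarrow> 'k poly \<Rightarrow> 'k poly" where
  "norm_poly A B = A ^ 2 - h * A * B - g * B ^ 2"

text \<open>\<open>A\<^sup>2\<close> and \<open>g B\<^sup>2\<close> have degrees of different parity, and
  \<open>h A B\<close> has smaller degree than the larger of the two.\<close>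

lemma norm_poly_eq_0:
  assumes "norm_poly A B = 0"
  shows "A = 0 \<and> B = 0"
proof -
  have g0: "g \<noteq> 0" using deg_g by auto
  have eq: "A ^ 2 = h * A * B + g * B ^ 2"
    using assms by (simp add: norm_poly_def algebra_simps)
  show ?thesis
  proof (cases "A = 0 \<or> B = 0")
    case True
    then show ?thesis using eq g0 by auto
  next
    case False
    then have dA: "degree (A ^ 2) = 2 * degree A" and dB: "degree (g * B ^ 2) = 3 + 2 * degree B"
      using deg_g g0 by (auto simp: degree_power_eq degree_mult_eq)
    have dh: "degree (h * A * B) \<le> 1 + degree A + degree B"
      using deg_h degree_mult_le[of "h * A" B] degree_mult_le[of h A] by linarith
    show ?thesis
    proof (cases "degree A > degree B + 1")
      case True
      then have "degree (h * A * B + g * B ^ 2) < 2 * degree A"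
        using dh dB by (intro degree_add_less) auto
      then show ?thesis using eq dA by simp
    next
      case less: False
      then have "degree (h * A * B + g * B ^ 2) = 3 + 2 * degree B"
        using dh dB by (subst degree_add_eq_right) auto
      then show ?thesis using eq dA by presburger
    qed
  qed
qed

text \<open>The other root of the equation of \<open>w\<close> is -h - w, so the second factor is
  the conjugate of the first over K(x).\<close>

lemma conj_mult: "(X A + X B * w) * (X A - X h * X B - X B * w) = X (norm_poly A B)"
proof -
  have "(X A + X B * w) * (X A - X h * X B - X B * w)
      = X A ^ 2 - X h * X A * X B - X B ^ 2 * (w ^ 2 + X h * w)"
    by (simp add: algebra_simps power2_eq_square)
  then show ?thesis by (simp add: norm_poly_def curve_X algebra_simps)
qed

text \<open>A vanishing element has vanishing norm, and the norm form is anisotropic by the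
  comparison of degrees.\<close>

lemma lin_eq_0_iff: "X A + X B * w = 0 \<longleftrightarrow> A = 0 \<and> B = 0"
proof
  assume "X A + X B * w = 0"
  then have "X (norm_poly A B) = 0" using conj_mult[of A B] by simp
  then have "norm_poly A B = 0" by simp
  then show "A = 0 \<and> B = 0" by (rule norm_poly_eq_0)
qed simp

lemma lin_eq_iff: "X A + X B * w = X A' + X B' * w \<longleftrightarrow> A = A' \<and> B = B'"
  using lin_eq_0_iff[of "A - A'" "B - B'"] by (auto simp: algebra_simps)

lemma lin_mult: "(X A + X B * w) * (X A' + X B' * w)
    = X (A * A' + g * B * B') + X (A * B' + B * A' - h * B * B') * w"
proof -
  have "(X A + X B * w) * (X A' + X B' * w)
      = X A * X A' + (X A * X B' + X B * X A') * w + X B * X B' * w ^ 2"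
    by (simp add: algebra_simps power2_eq_square)
  then show ?thesis unfolding curve_X by (simp add: algebra_simps)
qed

text \<open>The fractions form a subfield containing K, x and w, hence all of F; inverses exist
  because multiplying by the conjugate turns the denominator into a norm in K[x].\<close>

lemma representation: obtains A B C where "C \<noteq> 0" "z = (X A + X B * w) / X C"
proof -
  define L where "L = {(X A + X B * w) / X C | A B C. C \<noteq> 0}"
  have LI: "(X A + X B * w) / X C \<in> L" if "C \<noteq> 0" for A B C
    using that unfolding L_def by auto
  have "is_subfield L"
    unfolding is_subfield_def
  proof (intro conjI ballI)
    show "1 \<in> L" using LI[of 1 1 0] by simp
  next
    fix u v assume "u \<in> L" "v \<in> L"
    then obtain A B C A' B' C' where nz: "C \<noteq> 0" "C' \<noteq> 0"
      and u: "u = (X A + X B * w) / X C" and v: "v = (X A' + X B' * w) / X C'"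
      unfolding L_def by auto
    have "u - v = (X (A * C' - A' * C) + X (B * C' - B' * C) * w) / X (C * C')"
      using nz unfolding u v by (simp add: field_simps)
    moreover have "C * C' \<noteq> 0" using nz by simp
    ultimately show "u - v \<in> L" using LI by metis
    have "u * v = (X (A * A' + g * B * B') + X (A * B' + B * A' - h * B * B') * w) / X (C * C')"
      unfolding u v lin_mult[symmetric] by simp
    moreover have "C * C' \<noteq> 0" using nz by simp
    ultimately show "u * v \<in> L" using LI by metis
  next
    fix u assume "u \<in> L"
    then obtain A B C where nz: "C \<noteq> 0" and u: "u = (X A + X B * w) / X C"
      unfolding L_def by auto
    show "inverse u \<in> L"
    proof (cases "u = 0")
      case True
      then show ?thesis using LI[of 1 0 0] by simp
    next
      case False
      then have n: "norm_poly A B \<noteq> 0" using norm_poly_eq_0[of A B] u by auto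
      define V where "V = X A - X h * X B - X B * w"
      have "(X A + X B * w) * V = X (norm_poly A B)" unfolding V_def by (rule conj_mult)
      then have "inverse u = X C * V / X (norm_poly A B)"
        using n unfolding u by (auto simp: divide_simps mult_ac)
      also have "\<dots> = (X (C * (A - h * B)) + X (- (C * B)) * w) / X (norm_poly A B)"
        by (simp add: V_def algebra_simps)
      finally show ?thesis using LI[OF n] by metis
    qed
  qed
  moreover have "range \<iota> \<subseteq> L" using LI[of 1 "[:c:]" 0 for c] by auto
  moreover have "x \<in> L" using LI[of 1 "[:0,1:]" 0] by simp
  moreover have "w \<in> L" using LI[of 1 0 1] by simp
  ultimately have "L = UNIV" by (rule generates)
  then have "z \<in> L" by simp
  then show thesis using that unfolding L_def by auto
qed

text \<open>The equation with coefficients trace and norm, cleared of denominators. Since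
  \<open>N\<close> is nonzero, the valuations of its terms can be compared.\<close>

lemma quadratic_equation:
  assumes "z \<noteq> 0"
  obtains T N C where "C \<noteq> 0" "N \<noteq> 0" "z ^ 2 * X C ^ 2 = z * X T * X C - X N"
proof -
  obtain A B C where C: "C \<noteq> 0" and z: "z = (X A + X B * w) / X C" by (rule representation)
  have n: "norm_poly A B \<noteq> 0" using norm_poly_eq_0[of A B] z assms by auto
  have zC: "z * X C = X A + X B * w" using C z by simp
  have "z * X C * (X (2 * A - h * B) - z * X C) = X (norm_poly A B)"
    using conj_mult[of A B] unfolding zC by (simp add: algebra_simps)
  then have "z ^ 2 * X C ^ 2 = z * X (2 * A - h * B) * X C - X (norm_poly A B)"
    by (simp add: algebra_simps power2_eq_square)
  then show thesis using that C n by blast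
qed

subsection \<open>Places are discrete\<close>

lemma X_in:
  assumes "valuation_subring \<iota> R" "x \<in> R"
  shows "X p \<in> R"
proof -
  interpret valuation_subring \<iota> R by fact
  show ?thesis
    by (induction p) (use zero_in add_in mult_in const_in assms in \<open>auto simp: X_pCons\<close>)
qed

text \<open>\<open>w\<close> is integral over K[x]: were it outside \<open>R\<close>, then 1/w would
  be in \<open>R\<close>, and with it w = g/w - h.\<close>

lemma w_in:
  assumes "valuation_subring \<iota> R" "x \<in> R"
  shows "w \<in> R"
proof (rule ccontr)
  interpret valuation_subring \<iota> R by fact
  assume n: "w \<notin> R"
  then have "w \<noteq> 0" "inverse w \<in> R" using dichotomy zero_in by auto
  moreover have "w = X g * inverse w - X h"
    using curve_X \<open>w \<noteq> 0\<close> by (simp add: field_simps power2_eq_square)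
  ultimately show False using n X_in[OF assms] mult_in diff_in by metis
qed

text \<open>The polynomials that are non-units of \<open>R\<close> form a prime ideal of K[x]. A
  nonzero member \<open>q\<close> of least degree generates it, and splitting off factors
  \<open>q\<close> writes every nonzero polynomial as a power of \<open>q\<close> times a
  unit.\<close>

lemma uniformizer_finite:
  assumes vs: "valuation_subring \<iota> R" and x: "x \<in> R"
  shows "\<exists>p. p \<noteq> 0 \<and> p \<in> R \<and> inverse p \<notin> R \<and>
    (\<forall>q. q \<noteq> 0 \<longrightarrow> (\<exists>m::int. X q * p powi m \<in> R \<and> inverse (X q * p powi m) \<in> R))"
proof -
  interpret valuation_subring \<iota> R by fact
  \<comment> \<open>If every nonzero polynomial were a unit of \<open>R\<close>, all fractions (A +
    B w)/C would lie in \<open>R\<close>, which is proper.\<close>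
  have ex: "\<exists>q. q \<noteq> 0 \<and> inverse (X q) \<notin> R"
  proof (rule ccontr)
    assume "\<not> ?thesis"
    then have inv: "inverse (X q) \<in> R" if "q \<noteq> 0" for q using that by auto
    have "z \<in> R" for z
    proof -
      obtain A B C where "C \<noteq> 0" "z = (X A + X B * w) / X C" by (rule representation)
      then show ?thesis
        using inv X_in[OF vs x] w_in[OF vs x] by (auto simp: divide_inverse intro!: mult_in add_in)
    qed
    then show False using proper by auto
  qed
  define q where "q = arg_min degree (\<lambda>q. q \<noteq> 0 \<and> inverse (X q) \<notin> R)"
  have q: "q \<noteq> 0" "inverse (X q) \<notin> R"
    and q_min: "\<And>r. r \<noteq> 0 \<Longrightarrow> degree r < degree q \<Longrightarrow> inverse (X r) \<in> R"
    using arg_min_nat_lemma[of "\<lambda>q. q \<noteq> 0 \<and> inverse (X q) \<notin> R" _ degree] ex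
    unfolding q_def by (metis, metis, meson linorder_not_le)
  have qM: "X q \<in> M" using q X_in[OF vs x] by auto
  have deg_q: "degree q > 0"
  proof (rule ccontr)
    assume "\<not> ?thesis"
    then obtain c where c: "q = [:c:]" by (auto elim: degree_eq_zeroE)
    then show False using q const_unit[of c] by auto
  qed
  \<comment> \<open>The remainder modulo \<open>q\<close> has smaller degree, so by minimality it is
    a unit; it differs from \<open>X r\<close> by an element of \<open>M\<close>.\<close>
  have unit: "inverse (X r) \<in> R" if "\<not> q dvd r" for r
  proof -
    have nz: "r mod q \<noteq> 0" using that by (simp add: dvd_eq_mod_eq_0)
    then have "degree (r mod q) < degree q" using degree_mod_less'[OF q(1)] by blast
    then have nM: "X (r mod q) \<notin> M" using q_min[OF nz] nz by auto
    have eq: "X (r mod q) = X r + - (X q * X (r div q))"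
      using arg_cong[OF mult_div_mod_eq[of q r], of X] unfolding X_add X_mult
      by (metis add_diff_cancel_left' uminus_add_conv_diff add.commute)
    have "X r \<notin> M"
      using nM M_add[of "X r" "- (X q * X (r div q))"] M_minus M_mult[OF qM X_in[OF vs x]]
      unfolding eq by blast
    then show ?thesis using X_in[OF vs x, of r] by auto
  qed
  have "\<exists>m::int. X r * X q powi m \<in> R \<and> inverse (X r * X q powi m) \<in> R" if "r \<noteq> 0" for r
    using that
  proof (induction "degree r" arbitrary: r rule: less_induct)
    case less
    show ?case
    proof (cases "q dvd r")
      case True
      then obtain r1 where r1: "r = q * r1" by auto
      then have "degree r1 < degree r" "r1 \<noteq> 0" using less.prems deg_q by (auto simp: degree_mult_eq)
      then obtain m :: int where "X r1 * X q powi m \<in> R \<and> inverse (X r1 * X q powi m) \<in> R"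
        using less.hyps by blast
      moreover have "X r * X q powi (m - 1) = X r1 * X q powi m"
        using q by (simp add: r1 power_int_diff)
      ultimately show ?thesis by metis
    next
      case False
      then show ?thesis using unit X_in[OF vs x, of r] by (intro exI[of _ 0]) auto
    qed
  qed
  then show ?thesis using q X_in[OF vs x] by (intro exI[of _ "X q"]) auto
qed

text \<open>The leading term dominates where x has a pole. In Horner's recursion each further
  coefficient changes the unit by a factor 1 + m with \<open>m\<close> in \<open>M\<close>, because
  1/x is in \<open>M\<close>.\<close>

lemma uniformizer_infinite:
  assumes vs: "valuation_subring \<iota> R" and x: "x \<notin> R"
  shows "q \<noteq> 0 \<Longrightarrow> X q * inverse x ^ degree q \<in> R \<and> inverse (X q * inverse x ^ degree q) \<in> R"
proof (induction q)
  case (pCons a q)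
  interpret valuation_subring \<iota> R by fact
  have x0: "x \<noteq> 0" using x zero_in by auto
  have xM: "inverse x \<in> M" using x x0 dichotomy by auto
  show ?case
  proof (cases "q = 0")
    case True
    then show ?thesis using pCons const_in[of a] const_unit[of a] by auto
  next
    case False
    define u where "u = X q * inverse x ^ degree q"
    have u: "u \<noteq> 0" "u \<in> R" "inverse u \<in> R"
      using pCons.IH[OF False] False x0 by (auto simp: u_def)
    define m where "m = inverse x * (inverse u * (\<iota> a * inverse x ^ degree q))"
    have "inverse u * (\<iota> a * inverse x ^ degree q) \<in> R"
      using u xM by (intro mult_in const_in power_in) auto
    then have mM: "m \<in> M" unfolding m_def by (rule M_mult[OF xM])
    have eq: "X (pCons a q) * inverse x ^ degree (pCons a q) = u * (1 + m)"
      using False x0 u(1) by (simp add: X_pCons u_def m_def field_simps)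
    show ?thesis unfolding eq
      using one_plus_unit[OF mM] u by (auto intro!: mult_in)
  qed
qed simp

text \<open>\<open>G\<close> consists of the powers of \<open>p\<close> times units, where
  \<open>p\<close> generates the value group of K(x). It contains all nonzero polynomials and, by
  the quadratic equation, all nonzero squares, so \<open>discrete_valuation_if_squares\<close>
  applies. At a pole of x one takes p = 1/x, which leaves only -1 and -2 for the valuation of
  x.\<close>

theorem place_discrete:
  assumes "is_place \<iota> P"
  shows "\<exists>R v. valuation_subring \<iota> R \<and> P = {z \<in> R. z = 0 \<or> inverse z \<notin> R} \<and>
    discrete_valuation P v \<and> (\<forall>c. c \<noteq> 0 \<longrightarrow> v (\<iota> c) = 0) \<and> (x \<notin> R \<longrightarrow> v x = -1 \<or> v x = -2)"
proof -
  obtain R where vs: "valuation_subring \<iota> R" and P: "P = {z \<in> R. z = 0 \<or> inverse z \<notin> R}"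
    using assms is_place_iff[OF hom] by auto
  interpret valuation_subring \<iota> R by fact
  have "\<exists>p. p \<noteq> 0 \<and> p \<in> R \<and> inverse p \<notin> R \<and> (x \<notin> R \<longrightarrow> p = inverse x) \<and>
    (\<forall>q. q \<noteq> 0 \<longrightarrow> (\<exists>m::int. X q * p powi m \<in> R \<and> inverse (X q * p powi m) \<in> R))"
  proof (cases "x \<in> R")
    case True
    then show ?thesis using uniformizer_finite[OF vs] by meson
  next
    case False
    then have "x \<noteq> 0" "inverse x \<in> R" using zero_in dichotomy by auto
    moreover have "\<exists>m::int. X q * inverse x powi m \<in> R \<and> inverse (X q * inverse x powi m) \<in> R"
      if "q \<noteq> 0" for q
      using uniformizer_infinite[OF vs False that] by (intro exI[of _ "int (degree q)"]) simp
    ultimately show ?thesis using False by (intro exI[of _ "inverse x"]) auto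
  qed
  then obtain p where p: "p \<noteq> 0" "p \<in> M" "x \<notin> R \<Longrightarrow> p = inverse x"
    and pq: "\<And>q. q \<noteq> 0 \<Longrightarrow> \<exists>m::int. X q * p powi m \<in> R \<and> inverse (X q * p powi m) \<in> R"
    by auto
  define G where "G z \<longleftrightarrow> z \<noteq> 0 \<and> (\<exists>m::int. z * p powi m \<in> R \<and> inverse (z * p powi m) \<in> R)" for z
  have G_X: "G (X q)" if "q \<noteq> 0" for q using pq that unfolding G_def by auto
  have G_unit: "G u" if "u \<noteq> 0" "u \<in> R" "inverse u \<in> R" for u
    using that unfolding G_def by (auto intro!: exI[of _ 0])
  have G_mult: "G (a * b)" if "G a" "G b" for a b
  proof -
    obtain i j :: int where ij: "a * p powi i \<in> R" "inverse (a * p powi i) \<in> R" "b * p powi j \<in> R"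
      "inverse (b * p powi j) \<in> R" using \<open>G a\<close> \<open>G b\<close> unfolding G_def by auto
    have eq: "a * b * p powi (i + j) = (a * p powi i) * (b * p powi j)"
      using p by (simp add: power_int_add)
    have "inverse (a * b * p powi (i + j)) = inverse (a * p powi i) * inverse (b * p powi j)"
      unfolding eq by simp
    then show ?thesis using eq that mult_in ij unfolding G_def by (metis mult_eq_0_iff)
  qed
  have G_inv: "G (inverse a)" if a: "G a" for a
  proof -
    obtain i :: int where i: "a * p powi i \<in> R" "inverse (a * p powi i) \<in> R"
      using a unfolding G_def by auto
    have "inverse a * p powi (- i) = inverse (a * p powi i)" by (simp add: power_int_minus)
    then have "inverse a * p powi (- i) \<in> R \<and> inverse (inverse a * p powi (- i)) \<in> R"
      using i by (metis inverse_inverse_eq)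
    then show ?thesis using a unfolding G_def by auto
  qed
  have G_div: "G (a / b)" if "G a" "G b" for a b
    using G_mult G_inv that by (simp add: divide_inverse)
  have G_sq: "G (z ^ 2)" if z: "z \<noteq> 0" for z
  proof -
    obtain T N C where nz: "C \<noteq> 0" "N \<noteq> 0" and eq: "z ^ 2 * X C ^ 2 = z * X T * X C - X N"
      by (rule quadratic_equation[OF z])
    define a where "a = z ^ 2 * X C ^ 2"
    have a0: "a \<noteq> 0" using nz z by (simp add: a_def)
    have b: "z * X T * X C = a + X N" using eq by (simp add: a_def)
    have from_a: ?thesis if "G a"
    proof -
      have "G (a / (X C * X C))" using that G_X nz by (intro G_div G_mult) auto
      then show ?thesis using nz by (simp add: a_def power2_eq_square)
    qed
    have from_z: ?thesis if "G z" using G_mult[OF that that] by (simp add: power2_eq_square)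
    \<comment> \<open>In z^2 C^2 - z T C + N = 0 two terms of least valuation must balance. If these
      are z^2 C^2 and N, the square of z is in \<open>G\<close>; if one of them is z T C, already z
      is.\<close>
    consider "a / X N \<in> R" "inverse (a / X N) \<in> R" | "a / X N \<in> M" | "X N / a \<in> M"
      using dichotomy[of "a / X N"] a0 nz by auto
    then show ?thesis
    proof cases
      case 1
      then have "G (a / X N)" using G_unit a0 nz by auto
      then have "G (a / X N * X N)" using G_mult G_X nz by blast
      then show ?thesis using from_a nz by simp
    next
      case 2
      define e where "e = 1 + a / X N"
      have e: "e \<noteq> 0" "e \<in> R" "inverse e \<in> R" unfolding e_def using one_plus_unit[OF 2] by auto
      have b': "z * X T * X C = X N * e" unfolding b e_def using nz by (simp add: field_simps)
      then have "T \<noteq> 0" using e nz by auto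
      then have "G (X N * e / (X T * X C))" using G_unit e G_X nz by (intro G_div G_mult) auto
      moreover have "z = X N * e / (X T * X C)" using b' \<open>T \<noteq> 0\<close> nz by (simp add: field_simps)
      ultimately show ?thesis using from_z by simp
    next
      case 3
      define e where "e = 1 + X N / a"
      have e: "e \<noteq> 0" "e \<in> R" "inverse e \<in> R" unfolding e_def using one_plus_unit[OF 3] by auto
      have b': "z * X T * X C = z * (z * X C ^ 2 * e)"
        unfolding b e_def using a0 by (simp add: field_simps a_def power2_eq_square)
      then have b'': "X T = z * X C * e" using z nz by (simp add: power2_eq_square)
      then have "T \<noteq> 0" using e nz z by auto
      then have "G (X T / (X C * e))" using G_unit e G_X nz by (intro G_div G_mult) auto
      moreover have "z = X T / (X C * e)" using b'' nz e by (simp add: field_simps)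
      ultimately show ?thesis using from_z by simp
    qed
  qed
  obtain v where v: "discrete_valuation P v" "\<And>c. c \<noteq> 0 \<Longrightarrow> v (\<iota> c) = 0" "v p = 1 \<or> v p = 2"
    using discrete_valuation_if_squares[OF p(2,1)] G_sq P unfolding G_def by blast
  interpret v: discrete_valuation P v by fact
  have "v x = -1 \<or> v x = -2" if "x \<notin> R"
  proof -
    have "x \<noteq> 0" using that zero_in by auto
    then show ?thesis using v(3) p(3)[OF that] v.v_inverse[of x] by auto
  qed
  then show ?thesis using vs P v by blast
qed

lemma place_valuation:
  assumes "is_place \<iota> P"
  shows "discrete_valuation P (valn P)"
    and "c \<noteq> 0 \<Longrightarrow> valn P (\<iota> c) = 0"
    and "valuation_subring \<iota> (val_ring_of P)"
    and "P = {z \<in> val_ring_of P. z = 0 \<or> inverse z \<notin> val_ring_of P}"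
    and "x \<notin> val_ring_of P \<Longrightarrow> valn P x = -1 \<or> valn P x = -2"
proof -
  obtain R v where Rv: "valuation_subring \<iota> R" "P = {z \<in> R. z = 0 \<or> inverse z \<notin> R}"
    "discrete_valuation P v" "\<And>c. c \<noteq> 0 \<Longrightarrow> v (\<iota> c) = 0" "x \<notin> R \<Longrightarrow> v x = -1 \<or> v x = -2"
    using place_discrete[OF assms] by blast
  interpret v: discrete_valuation P v by fact
  interpret valuation_subring \<iota> R by fact
  have R: "val_ring_of P = R" using val_ring_of_M Rv(2) by simp
  show "valuation_subring \<iota> (val_ring_of P)" "P = {z \<in> val_ring_of P. z = 0 \<or> inverse z \<notin> val_ring_of P}"
    using Rv(1,2) R by simp_all
  show "discrete_valuation P (valn P)"
    by (rule v.discrete_valuation_valn)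
  show "valn P (\<iota> c) = 0" if "c \<noteq> 0" using that Rv(4) v.valn_eq by simp
  show "x \<notin> val_ring_of P \<Longrightarrow> valn P x = -1 \<or> valn P x = -2"
    using Rv(5) R v.valn_eq[of x] zero_in by force
qed

end

subsection \<open>Existence of valuation rings\<close>

definition is_subring :: "'f::field set \<Rightarrow> bool" where
  "is_subring S \<longleftrightarrow> 1 \<in> S \<and> (\<forall>u\<in>S. \<forall>v\<in>S. u - v \<in> S \<and> u * v \<in> S)"

lemma is_subring_simps:
  assumes "is_subring S"
  shows "1 \<in> S" "0 \<in> S" "u \<in> S \<Longrightarrow> v \<in> S \<Longrightarrow> u - v \<in> S" "u \<in> S \<Longrightarrow> v \<in> S \<Longrightarrow> u * v \<in> S"
    "u \<in> S \<Longrightarrow> - u \<in> S" "u \<in> S \<Longrightarrow> v \<in> S \<Longrightarrow> u + v \<in> S"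
proof -
  show *: "1 \<in> S" "u \<in> S \<Longrightarrow> v \<in> S \<Longrightarrow> u - v \<in> S" "u \<in> S \<Longrightarrow> v \<in> S \<Longrightarrow> u * v \<in> S" for u v
    using assms by (auto simp: is_subring_def)
  show 0: "0 \<in> S" using *(2)[OF *(1) *(1)] by simp
  show m: "- u \<in> S" if "u \<in> S" for u using *(2)[OF 0 that] by simp
  show "u + v \<in> S" if "u \<in> S" "v \<in> S" using *(2)[OF that(1) m[OF that(2)]] by simp
qed

lemma is_subring_sum:
  assumes "is_subring S" "\<And>i. i \<in> I \<Longrightarrow> f i \<in> S"
  shows "sum f I \<in> S"
  using assms(2) by (induction I rule: infinite_finite_induct) (auto simp: is_subring_simps[OF assms(1)])

lemma is_subring_adjoin:
  assumes "is_subring S"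
  shows "is_subring {poly q u | q. \<forall>i. coeff q i \<in> S}"
  unfolding is_subring_def
proof (intro conjI ballI)
  show "1 \<in> {poly q u | q. \<forall>i. coeff q i \<in> S}"
    using is_subring_simps(1,2)[OF assms] by (auto intro!: exI[of _ 1] simp: coeff_1)
next
  fix a b assume "a \<in> {poly q u | q. \<forall>i. coeff q i \<in> S}" "b \<in> {poly q u | q. \<forall>i. coeff q i \<in> S}"
  then obtain q r where qr: "a = poly q u" "b = poly r u" "\<And>i. coeff q i \<in> S" "\<And>i. coeff r i \<in> S"
    by auto
  have "\<forall>i. coeff (q - r) i \<in> S" using qr is_subring_simps(3)[OF assms] by simp
  then show "a - b \<in> {poly q u | q. \<forall>i. coeff q i \<in> S}"
    using qr by (intro CollectI exI[of _ "q - r"]) simp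
  have "\<forall>i. coeff (q * r) i \<in> S"
    using qr is_subring_simps(4)[OF assms] by (auto simp: coeff_mult intro!: is_subring_sum[OF assms])
  then show "a * b \<in> {poly q u | q. \<forall>i. coeff q i \<in> S}"
    using qr by (intro CollectI exI[of _ "q * r"]) simp
qed

text \<open>The descent behind the existence of valuation rings: as \<open>1 + p S\<close> consists of units,
  the relation for \<open>1 / u\<close> can be used to lower the degree of the relation for \<open>u\<close>.\<close>

lemma no_opposite_relations:
  assumes S: "is_subring S" and pS: "p \<in> S" and ip: "inverse p \<notin> S"
    and unit: "\<And>a. a \<in> S \<Longrightarrow> inverse (1 - p * a) \<in> S"
    and u: "u \<noteq> 0" and q: "\<And>i. coeff q i \<in> S" "p * poly q u = 1"
    and r: "\<And>i. coeff r i \<in> S" "p * poly r (inverse u) = 1"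
  shows False
proof -
  have descent: "\<exists>q'. (\<forall>i. coeff q' i \<in> S) \<and> p * poly q' u = 1 \<and> degree q' < degree q"
    if u: "u \<noteq> 0" and q: "\<forall>i. coeff q i \<in> S" "p * poly q u = 1"
      and r: "\<forall>i. coeff r i \<in> S" "p * poly r (inverse u) = 1" and le: "degree r \<le> degree q"
    for u :: 'a and q r
  proof -
    define n where "n = degree q"
    define m where "m = degree r"
    have deg: "n > 0"
    proof (rule ccontr)
      assume "\<not> n > 0"
      then obtain c where c: "q = [:c:]" unfolding n_def by (auto elim: degree_eq_zeroE)
      then have "p * c = 1" "c \<in> S" using q(2) q(1)[rule_format, of 0] by auto
      then show False using ip by (metis inverse_unique)
    qed
    define e where "e = inverse (1 - p * coeff r 0)"
    have e: "e \<in> S" unfolding e_def using unit r by auto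
    have "1 - p * coeff r 0 \<noteq> 0"
    proof
      assume "1 - p * coeff r 0 = 0"
      then have "inverse p = coeff r 0" by (simp add: inverse_unique)
      then show False using ip r by auto
    qed
    then have e1: "e * (1 - p * coeff r 0) = 1" by (simp add: e_def)
    have "poly r (inverse u) = (\<Sum>i\<le>m. coeff r i * inverse u ^ i)"
      by (simp add: poly_altdef m_def)
    also have "\<dots> = coeff r 0 + (\<Sum>i=1..m. coeff r i * inverse u ^ i)"
      by (simp add: sum.atMost_shift sum.atLeast1_atMost_eq)
    finally have "1 - p * coeff r 0 = p * (\<Sum>i=1..m. coeff r i * inverse u ^ i)"
      using r(2) by (simp add: algebra_simps)
    then have one: "1 = e * p * (\<Sum>i=1..m. coeff r i * inverse u ^ i)"
      using e1 by (simp only: mult.assoc)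
    define a where "a = coeff q n"
    \<comment> \<open>Multiplying 1 = e p (sum of r_i u^(-i) over i \<ge> 1) by the leading term a
      u^n of \<open>poly q u\<close> expresses that term by lower powers of \<open>u\<close>; the
      exponents n - i make sense because m \<le> n.\<close>
    define s where "s = (\<Sum>i=1..m. monom (a * e * p * coeff r i) (n - i))"
    have s_coeff: "coeff s j \<in> S" for j
      unfolding s_def coeff_sum a_def
      using q r e pS is_subring_simps(2,4)[OF S] by (auto intro!: is_subring_sum[OF S])
    have deg_s: "degree s \<le> n - 1"
      unfolding s_def by (intro degree_sum_le) (auto intro: order.trans[OF degree_monom_le])
    have "poly s u = (\<Sum>i=1..m. a * e * p * coeff r i * u ^ (n - i))"
      by (simp add: s_def poly_sum poly_monom)
    also have "\<dots> = (\<Sum>i=1..m. a * u ^ n * (e * p * (coeff r i * inverse u ^ i)))"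
      using u le by (intro sum.cong) (auto simp: power_diff n_def m_def field_simps)
    also have "\<dots> = a * u ^ n * (e * p * (\<Sum>i=1..m. coeff r i * inverse u ^ i))"
      by (simp only: sum_distrib_left)
    also have "\<dots> = a * u ^ n" using one by simp
    finally have poly_s: "poly s u = a * u ^ n" .
    define q' where "q' = q - monom a n + s"
    have "coeff q' i \<in> S" for i
      unfolding q'_def a_def using q s_coeff is_subring_simps(2,3,6)[OF S] by simp
    moreover have "p * poly q' u = 1"
      using q(2) by (simp add: q'_def poly_s poly_monom)
    moreover have "degree (q - monom a n) < n"
    proof -
      have "degree (q - monom a n) \<le> n"
        by (rule degree_diff_le) (auto simp: n_def degree_monom_le)
      moreover have "coeff (q - monom a n) n = 0" by (simp add: a_def)
      ultimately show ?thesis using deg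
        by (metis degree_0 leading_coeff_0_iff order_le_less)
    qed
    then have "degree q' < n" unfolding q'_def using deg_s deg by (intro degree_add_less) auto
    ultimately show ?thesis unfolding n_def by blast
  qed
  have "False" if "u \<noteq> 0" "\<forall>i. coeff q i \<in> S" "p * poly q u = 1"
      "\<forall>i. coeff r i \<in> S" "p * poly r (inverse u) = 1" "N = degree q + degree r" for u :: 'a and q r N
    using that
  proof (induction N arbitrary: u q r rule: less_induct)
    case (less N)
    show ?case
    proof (cases "degree r \<le> degree q")
      case True
      then obtain q' where "\<forall>i. coeff q' i \<in> S" "p * poly q' u = 1" "degree q' < degree q"
        using descent[of u q r] less.prems by blast
      then show False using less.IH[of "degree q' + degree r" u q' r] less.prems by simp
    next
      \<comment> \<open>The situation is symmetric under exchanging \<open>u\<close> with 1/u and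
        \<open>q\<close> with \<open>r\<close>, so the longer relation can always be
        shortened.\<close>
      case False
      then obtain r' where "\<forall>i. coeff r' i \<in> S" "p * poly r' (inverse u) = 1" "degree r' < degree r"
        using descent[of "inverse u" r q] less.prems by auto
      then show False using less.IH[of "degree q + degree r'" u q r'] less.prems by simp
    qed
  qed
  then show False using u q r by blast
qed

text \<open>Zorn gives a subring \<open>R\<close> maximal among those that contain \<open>A\<close>
  and miss 1/p. Maximality is used twice: the inverses of the 1 - p a are already in
  \<open>R\<close>, and adjoining an element u outside \<open>R\<close> puts 1/p into R[u]. The
  latter cannot happen for u and 1/u at once, by the descent, so one of them is in
  \<open>R\<close>.\<close>

lemma exists_valuation_subring:
  assumes hom: "field_hom \<iota>" and A: "is_subring A" "range \<iota> \<subseteq> A"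
    and p: "p \<in> A" "inverse p \<notin> A"
  shows "\<exists>R. valuation_subring \<iota> R \<and> A \<subseteq> R \<and> inverse p \<notin> R"
proof -
  interpret iota: field_hom \<iota> by fact
  define \<A> where "\<A> = {S. is_subring S \<and> A \<subseteq> S \<and> inverse p \<notin> S}"
  have "\<exists>R\<in>\<A>. \<forall>S\<in>\<A>. R \<subseteq> S \<longrightarrow> S = R"
  proof (rule subset_Zorn_nonempty)
    show "\<A> \<noteq> {}" using A p by (auto simp: \<A>_def)
    fix \<C> assume C: "\<C> \<noteq> {}" "subset.chain \<A> \<C>"
    have sub: "S \<in> \<A>" if "S \<in> \<C>" for S using that C by (auto simp: subset.chain_def)
    have "is_subring (\<Union>\<C>)"
      unfolding is_subring_def
    proof (intro conjI ballI)
      show "1 \<in> \<Union>\<C>" using C(1) sub by (auto simp: \<A>_def is_subring_def)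
      fix u v assume "u \<in> \<Union>\<C>" "v \<in> \<Union>\<C>"
      then obtain S1 S2 where S12: "S1 \<in> \<C>" "u \<in> S1" "S2 \<in> \<C>" "v \<in> S2" by blast
      then have "S1 \<subseteq> S2 \<or> S2 \<subseteq> S1" using C(2) unfolding subset.chain_def by blast
      then obtain S where "S \<in> \<C>" "u \<in> S" "v \<in> S" using S12 by blast
      then show "u - v \<in> \<Union>\<C>" "u * v \<in> \<Union>\<C>"
        using sub[of S] by (auto simp: \<A>_def is_subring_def)
    qed
    then show "\<Union>\<C> \<in> \<A>" using C(1) sub by (auto simp: \<A>_def)
  qed
  then obtain R where R\<A>: "R \<in> \<A>" and R_max: "\<forall>S\<in>\<A>. R \<subseteq> S \<longrightarrow> S = R" ..
  have R: "is_subring R" "A \<subseteq> R" "inverse p \<notin> R" using R\<A> by (simp_all add: \<A>_def)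
  have max: "S = R" if "is_subring S" "R \<subseteq> S" "inverse p \<notin> S" for S
    using R_max that R(2) by (simp add: \<A>_def)
  note R_simps = is_subring_simps[OF R(1)]
  have pR: "p \<in> R" "p \<noteq> 0" using p R R_simps(2) by auto
  have unit: "inverse (1 - p * a) \<in> R" if a: "a \<in> R" for a
  proof -
    define S where "S = {r * inverse (1 - p * s) | r s. r \<in> R \<and> s \<in> R}"
    have nz: "1 - p * s \<noteq> 0" if "s \<in> R" for s
    proof
      assume "1 - p * s = 0"
      then have "inverse p = s" by (simp add: inverse_unique)
      then show False using R that by simp
    qed
    have SI: "r * inverse (1 - p * s) \<in> S" if "r \<in> R" "s \<in> R" for r s
      using that unfolding S_def by blast
    have "is_subring S"
      unfolding is_subring_def
    proof (intro conjI ballI)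
      show "1 \<in> S" using SI[OF R_simps(1,2)] by simp
      fix u v assume "u \<in> S" "v \<in> S"
      then obtain r s r' s' where rs: "r \<in> R" "s \<in> R" "r' \<in> R" "s' \<in> R"
        and u: "u = r * inverse (1 - p * s)" and v: "v = r' * inverse (1 - p * s')"
        unfolding S_def by blast
      \<comment> \<open>The denominators 1 - p s are closed under multiplication; \<open>t\<close>
        is the parameter of the product of two of them.\<close>
      define t where "t = s + s' - p * s * s'"
      have t: "1 - p * t = (1 - p * s) * (1 - p * s')" by (simp add: t_def algebra_simps)
      have tR: "t \<in> R" unfolding t_def using rs pR by (intro R_simps)
      have "r * (1 - p * s') - r' * (1 - p * s) \<in> R" using rs pR by (intro R_simps)
      moreover have "u - v = (r * (1 - p * s') - r' * (1 - p * s)) * inverse (1 - p * t)"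
        unfolding u v t using nz[OF rs(2)] nz[OF rs(4)] by (simp add: field_simps)
      ultimately show "u - v \<in> S" using SI tR by metis
      have "u * v = (r * r') * inverse (1 - p * t)" unfolding u v t by simp
      then show "u * v \<in> S" using SI[OF R_simps(4)[OF rs(1,3)] tR] by simp
    qed
    moreover have "R \<subseteq> S" using SI[OF _ R_simps(2)] by auto
    moreover have "inverse p \<notin> S"
    proof
      assume "inverse p \<in> S"
      then obtain r s where rs: "r \<in> R" "s \<in> R" "inverse p = r * inverse (1 - p * s)"
        unfolding S_def by blast
      \<comment> \<open>Clearing denominators gives 1 - p s = p r; division by \<open>p\<close>
        brings 1/p back into \<open>R\<close>.\<close>
      then have "inverse p = r + s" using nz[OF rs(2)] pR by (simp add: field_simps)
      then show False using R R_simps(6) rs by simp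
    qed
    ultimately have "S = R" by (intro max)
    then show ?thesis using SI[OF R_simps(1) a] by simp
  qed
  have relation: "\<exists>q. (\<forall>i. coeff q i \<in> R) \<and> p * poly q u = 1" if "u \<notin> R" for u
  proof (rule ccontr)
    assume no: "\<nexists>q. (\<forall>i. coeff q i \<in> R) \<and> p * poly q u = 1"
    define S where "S = {poly q u | q. \<forall>i. coeff q i \<in> R}"
    have SI: "poly q u \<in> S" if "\<And>i. coeff q i \<in> R" for q using that unfolding S_def by auto
    have "is_subring S" unfolding S_def by (rule is_subring_adjoin[OF R(1)])
    moreover have "R \<subseteq> S"
    proof
      fix r assume "r \<in> R"
      then have "coeff [:r:] i \<in> R" for i using R_simps(2) by (cases i) auto
      then show "r \<in> S" using SI[of "[:r:]"] by simp
    qed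
    moreover have "inverse p \<notin> S"
    proof
      assume "inverse p \<in> S"
      then obtain q where "\<forall>i. coeff q i \<in> R" "inverse p = poly q u" unfolding S_def by auto
      then show False using no pR by (metis right_inverse)
    qed
    ultimately have "S = R" by (intro max)
    moreover have "coeff [:0, 1:] i \<in> R" for i
      using R_simps(1,2) by (auto simp: coeff_pCons split: nat.splits)
    then have "u \<in> S" using SI[of "[:0, 1:]"] by simp
    ultimately show False using that by simp
  qed
  have "u \<in> R \<or> inverse u \<in> R" for u
  proof (rule ccontr)
    assume n: "\<not> (u \<in> R \<or> inverse u \<in> R)"
    then have "u \<noteq> 0" using R_simps(2) by auto
    obtain q where q: "\<And>i. coeff q i \<in> R" "p * poly q u = 1" using relation[of u] n by auto
    obtain r where r: "\<And>i. coeff r i \<in> R" "p * poly r (inverse u) = 1"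
      using relation[of "inverse u"] n by auto
    show False using no_opposite_relations[OF R(1) pR(1) R(3) unit \<open>u \<noteq> 0\<close> q r] .
  qed
  moreover have "range \<iota> \<subset> R"
  proof -
    \<comment> \<open>This gives the strict inclusion of the constants in \<open>R\<close>: a
      constant would have its inverse in \<open>A\<close>.\<close>
    have "p \<notin> range \<iota>"
    proof
      assume "p \<in> range \<iota>"
      then obtain c where "p = \<iota> c" by auto
      then have "inverse p = \<iota> (inverse c)" by (simp add: iota.hom_inverse)
      then show False using R A by auto
    qed
    then show ?thesis using A R pR by auto
  qed
  ultimately have "valuation_subring \<iota> R"
    using hom R R_simps by unfold_locales (auto simp: valuation_ring_def)
  then show ?thesis using R by auto
qed

text \<open>\<open>d\<close> is a nonzero element of least degree in the ideal generated by
  \<open>U\<close> and \<open>V\<close>; remainders modulo \<open>d\<close> stay in the ideal, so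
  \<open>d\<close> divides both. Cancelling it in d = s U + t V leaves the relation of
  coprimality.\<close>

lemma poly_bezout:
  fixes U V :: "'k::field poly"
  assumes "V \<noteq> 0"
  obtains d U' V' s t where "d \<noteq> 0" "U = d * U'" "V = d * V'" "s * U' + t * V' = 1"
proof -
  define I where "I = {s * U + t * V | s t. True}"
  define d where "d = arg_min degree (\<lambda>d. d \<in> I \<and> d \<noteq> 0)"
  have VI: "V \<in> I" unfolding I_def by (intro CollectI exI[of _ 0] exI[of _ 1]) auto
  have UI: "U \<in> I" unfolding I_def by (intro CollectI exI[of _ 1] exI[of _ 0]) auto
  have "(d \<in> I \<and> d \<noteq> 0) \<and> (\<forall>e. e \<in> I \<and> e \<noteq> 0 \<longrightarrow> degree d \<le> degree e)"
    unfolding d_def by (rule arg_min_nat_lemma[of _ V]) (use VI assms in simp)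
  then have d: "d \<in> I" "d \<noteq> 0" and d_min: "\<And>e. e \<in> I \<Longrightarrow> e \<noteq> 0 \<Longrightarrow> degree d \<le> degree e"
    by simp_all
  obtain s t where st: "d = s * U + t * V" using d by (auto simp: I_def)
  have dvd: "d dvd W" if W: "W \<in> I" for W
  proof -
    obtain s' t' where W: "W = s' * U + t' * V" using W by (auto simp: I_def)
    have "W mod d = W - d * (W div d)" by (simp add: minus_mult_div_eq_mod)
    also have "\<dots> = (s' - s * (W div d)) * U + (t' - t * (W div d)) * V"
      unfolding W st by (simp add: algebra_simps)
    finally have "W mod d \<in> I" unfolding I_def by blast
    then have "W mod d = 0" using d_min degree_mod_less'[OF d(2)] by (meson linorder_not_le)
    then show ?thesis by auto
  qed
  obtain U' where U': "U = d * U'" using dvd[OF UI] ..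
  obtain V' where V': "V = d * V'" using dvd[OF VI] ..
  have "d * (s * U' + t * V') = s * U + t * V" unfolding U' V' by (simp only: algebra_simps)
  then have "d * (s * U' + t * V') = d * 1" using st by simp
  then have "s * U' + t * V' = 1" using d(2) by (metis mult_cancel_left)
  with d(2) U' V' show thesis by (rule that)
qed

context weierstrass
begin

subsection \<open>The ring of functions regular away from infinity\<close>

text \<open>The automorphism of F over K(x) that sends w to -h - w. It is described through all
  fractions representing \<open>z\<close> at once, because none of them is canonical.\<close>

definition galois_conj :: "'f \<Rightarrow> 'f" where
  "galois_conj z = (THE s. \<forall>A B C. C \<noteq> 0 \<longrightarrow> z = (X A + X B * w) / X C \<longrightarrow>
     s = (X A - X h * X B - X B * w) / X C)"

lemma conj_eq:
  assumes C: "C \<noteq> 0"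
  shows "galois_conj ((X A + X B * w) / X C) = (X A - X h * X B - X B * w) / X C"
  unfolding galois_conj_def
proof (rule the_equality)
  show "\<forall>A' B' C'. C' \<noteq> 0 \<longrightarrow> (X A + X B * w) / X C = (X A' + X B' * w) / X C' \<longrightarrow>
     (X A - X h * X B - X B * w) / X C = (X A' - X h * X B' - X B' * w) / X C'"
  proof (intro allI impI)
    fix A' B' C' assume C': "C' \<noteq> 0" and eq: "(X A + X B * w) / X C = (X A' + X B' * w) / X C'"
    then have "X (A * C') + X (B * C') * w = X (A' * C) + X (B' * C) * w"
      using C by (simp add: field_simps)
    then have e: "A * C' = A' * C" "B * C' = B' * C" unfolding lin_eq_iff by auto
    have "X (A * C' - h * (B * C')) - X (B * C') * w = X (A' * C - h * (B' * C)) - X (B' * C) * w"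
      unfolding e ..
    then show "(X A - X h * X B - X B * w) / X C = (X A' - X h * X B' - X B' * w) / X C'"
      using C C' by (simp add: field_simps)
  qed
qed (use C in blast)

lemma conj_X [simp]: "galois_conj (X p) = X p"
  using conj_eq[of 1 p 0] by simp

lemma conj_const [simp]: "galois_conj (\<iota> c) = \<iota> c"
  using conj_X[of "[:c:]"] by simp

lemma conj_diff: "galois_conj (u - v) = galois_conj u - galois_conj v"
proof -
  obtain A B C where C: "C \<noteq> 0" and u: "u = (X A + X B * w) / X C" by (rule representation)
  obtain A' B' C' where C': "C' \<noteq> 0" and v: "v = (X A' + X B' * w) / X C'" by (rule representation)
  have "u - v = (X (A * C' - A' * C) + X (B * C' - B' * C) * w) / X (C * C')"
    using C C' unfolding u v by (simp add: field_simps)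
  then have "galois_conj (u - v) = (X (A * C' - A' * C) - X h * X (B * C' - B' * C) - X (B * C' - B' * C) * w) / X (C * C')"
    using conj_eq[of "C * C'"] C C' by (metis mult_eq_0_iff)
  also have "\<dots> = galois_conj u - galois_conj v"
    using C C' unfolding u v conj_eq[OF C] conj_eq[OF C'] by (simp add: field_simps)
  finally show ?thesis .
qed

lemma conj_mult_distrib: "galois_conj (u * v) = galois_conj u * galois_conj v"
proof -
  obtain A B C where C: "C \<noteq> 0" and u: "u = (X A + X B * w) / X C" by (rule representation)
  obtain A' B' C' where C': "C' \<noteq> 0" and v: "v = (X A' + X B' * w) / X C'" by (rule representation)
  define U where "U = A * A' + g * B * B'"
  define V where "V = A * B' + B * A' - h * B * B'"
  have "u * v = (X U + X V * w) / X (C * C')"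
    unfolding u v U_def V_def lin_mult[symmetric] by simp
  then have "galois_conj (u * v) = (X U - X h * X V - X V * w) / X (C * C')"
    using C C' conj_eq[of "C * C'"] by simp
  also have "X U - X h * X V - X V * w = (X (A - h * B) + X (- B) * w) * (X (A' - h * B') + X (- B') * w)"
    unfolding lin_mult U_def V_def by (simp add: algebra_simps)
  finally show ?thesis
    unfolding u v conj_eq[OF C] conj_eq[OF C'] by simp
qed

lemma conj_inverse: "galois_conj (inverse z) = inverse (galois_conj z)"
proof (cases "z = 0")
  case True
  then show ?thesis using conj_X[of 0] by simp
next
  case False
  then have "galois_conj z * galois_conj (inverse z) = 1"
    using conj_mult_distrib[of z "inverse z"] conj_X[of 1] by simp
  then show ?thesis by (metis inverse_unique)
qed

text \<open>The preimage of a valuation ring under an automorphism that fixes K[x]. With it,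
  regularity of z over K[x] passes to the conjugate of z.\<close>

lemma valuation_subring_conj:
  assumes "valuation_subring \<iota> R" "x \<in> R"
  shows "valuation_subring \<iota> {z. galois_conj z \<in> R}" "x \<in> {z. galois_conj z \<in> R}"
proof -
  interpret valuation_subring \<iota> R by fact
  show xin: "x \<in> {z. galois_conj z \<in> R}" using assms conj_X[of "[:0, 1:]"] by simp
  have "x \<notin> range \<iota>"
  proof
    assume "x \<in> range \<iota>"
    then obtain c where "X [:0, 1:] = X [:c:]" by auto
    then show False unfolding X_eq_iff by simp
  qed
  moreover obtain z where "z \<notin> R" using proper by auto
  \<comment> \<open>An involution is surjective, so some conjugate lies outside \<open>R\<close> and
    the preimage is proper.\<close>
  moreover have "galois_conj (galois_conj z) = z" for z
  proof -
    obtain A B C where C: "C \<noteq> 0" and z: "z = (X A + X B * w) / X C" by (rule representation)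
    have "galois_conj z = (X (A - h * B) + X (- B) * w) / X C" unfolding z conj_eq[OF C] by simp
    then have "galois_conj (galois_conj z) = (X (A - h * B) - X h * X (- B) - X (- B) * w) / X C"
      by (simp only: conj_eq[OF C])
    then show ?thesis by (simp add: z)
  qed
  ultimately have "range \<iota> \<subset> {z. galois_conj z \<in> R}" "{z. galois_conj z \<in> R} \<noteq> UNIV"
    using xin const_in by (auto, metis UNIV_I mem_Collect_eq)
  then show "valuation_subring \<iota> {z. galois_conj z \<in> R}"
    using hom dichotomy
    by unfold_locales (auto simp: valuation_ring_def conj_diff conj_mult_distrib conj_inverse diff_in mult_in)
qed

text \<open>In lowest terms U'/V' with s U' + t V' = 1, a denominator V' that is not a unit of K[x]
  would admit a valuation ring over K[x] without 1/V'. But 1/V' = s (U'/V') + t lies in every ring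
  on which the fraction is regular.\<close>

lemma dvd_if_regular:
  assumes V: "V \<noteq> 0" and reg: "\<And>R. valuation_subring \<iota> R \<Longrightarrow> x \<in> R \<Longrightarrow> X U / X V \<in> R"
  shows "V dvd U"
proof -
  obtain d U' V' s t where d: "d \<noteq> 0" "U = d * U'" "V = d * V'" "s * U' + t * V' = 1"
    by (rule poly_bezout[OF V])
  have V': "V' \<noteq> 0" using V d by auto
  have sub: "is_subring (range X)"
    unfolding is_subring_def
  proof (intro conjI ballI)
    show "1 \<in> range X" by (rule range_eqI[of _ _ 1]) simp
    fix u v assume "u \<in> range X" "v \<in> range X"
    then obtain p q where "u = X p" "v = X q" by auto
    then show "u - v \<in> range X" "u * v \<in> range X"
      by (auto intro: range_eqI[of _ _ "p - q"] range_eqI[of _ _ "p * q"])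
  qed
  have "inverse (X V') \<in> range X"
  proof (rule ccontr)
    assume "inverse (X V') \<notin> range X"
    moreover have "range \<iota> \<subseteq> range X" by (auto intro: range_eqI[of _ X "[:c:]" for c])
    ultimately obtain R where R: "valuation_subring \<iota> R" "range X \<subseteq> R" "inverse (X V') \<notin> R"
      using exists_valuation_subring[OF hom sub, of "X V'"] by blast
    interpret valuation_subring \<iota> R by fact
    have XR: "X p \<in> R" for p using R by auto
    have "X U' * inverse (X V') = X U / X V" using d V' by (simp add: field_simps)
    also have "\<dots> \<in> R" using reg[OF R(1)] XR[of "[:0, 1:]"] by simp
    finally have in_R: "X s * (X U' * inverse (X V')) + X t \<in> R" by (rule add_in[OF mult_in[OF XR] XR])
    have "X s * (X U' * inverse (X V')) + X t = X (s * U' + t * V') * inverse (X V')"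
      using V' by (simp add: field_simps)
    then have "X s * (X U' * inverse (X V')) + X t = inverse (X V')" unfolding d(4) by simp
    then show False using R in_R by simp
  qed
  then obtain p where "inverse (X V') = X p" by auto
  then have "X (V' * p) = X 1" using V' by (metis X_1 X_eq_0_iff X_mult right_inverse)
  then have "V' * p = 1" by (simp only: X_eq_iff)
  then have "U = V * (p * U')" using d by (metis mult.assoc mult.commute mult_1)
  then show ?thesis by simp
qed

text \<open>Trace and norm of z are rational functions of x, regular on every valuation ring over
  K[x] and hence polynomials; \<open>normal\<close> then clears the denominator of z. The converse
  is the integrality of \<open>w\<close>.\<close>

theorem regular_iff:
  "(\<forall>R. valuation_subring \<iota> R \<longrightarrow> x \<in> R \<longrightarrow> z \<in> R) \<longleftrightarrow> (\<exists>A B. z = X A + X B * w)"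
proof
  assume reg: "\<forall>R. valuation_subring \<iota> R \<longrightarrow> x \<in> R \<longrightarrow> z \<in> R"
  obtain A B C where C: "C \<noteq> 0" and z: "z = (X A + X B * w) / X C" by (rule representation)
  have cz: "galois_conj z = (X A - X h * X B - X B * w) / X C" unfolding z by (rule conj_eq[OF C])
  have regc: "galois_conj z \<in> R" if "valuation_subring \<iota> R" "x \<in> R" for R
    using reg valuation_subring_conj[OF that] by auto
  have "C dvd 2 * A - h * B"
  proof (rule dvd_if_regular[OF C])
    fix R assume R: "valuation_subring \<iota> R" "x \<in> R"
    interpret valuation_subring \<iota> R by fact
    have "X (2 * A - h * B) / X C = z + (X A - X h * X B - X B * w) / X C"
      unfolding z using C by (simp add: field_simps)
    then have "X (2 * A - h * B) / X C = z + galois_conj z" unfolding cz .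
    then show "X (2 * A - h * B) / X C \<in> R" using reg regc R add_in by simp
  qed
  moreover have "C ^ 2 dvd A ^ 2 - h * A * B - g * B ^ 2"
  proof (rule dvd_if_regular)
    fix R assume R: "valuation_subring \<iota> R" "x \<in> R"
    interpret valuation_subring \<iota> R by fact
    have "X (norm_poly A B) / X (C ^ 2) = z * ((X A - X h * X B - X B * w) / X C)"
      unfolding conj_mult[symmetric] z by (simp add: power2_eq_square)
    then have "X (norm_poly A B) / X (C ^ 2) = z * galois_conj z" unfolding cz .
    then show "X (A ^ 2 - h * A * B - g * B ^ 2) / X (C ^ 2) \<in> R"
      using reg regc R mult_in by (simp add: norm_poly_def)
  qed (use C in simp)
  ultimately have dvd: "C dvd A" "C dvd B" using normal[OF C] by blast+
  obtain A' where "A = C * A'" using dvd(1) ..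
  moreover obtain B' where "B = C * B'" using dvd(2) ..
  ultimately have "z = X A' + X B' * w" using C by (simp add: z field_simps)
  then show "\<exists>A B. z = X A + X B * w" by blast
next
  assume "\<exists>A B. z = X A + X B * w"
  then obtain A B where z: "z = X A + X B * w" by auto
  show "\<forall>R. valuation_subring \<iota> R \<longrightarrow> x \<in> R \<longrightarrow> z \<in> R"
  proof (intro allI impI)
    fix R assume R: "valuation_subring \<iota> R" "x \<in> R"
    interpret valuation_subring \<iota> R by fact
    show "z \<in> R" unfolding z using X_in[OF R] w_in[OF R] by (intro add_in mult_in)
  qed
qed

subsection \<open>The place at infinity\<close>

context
  fixes P\<^sub>O
  assumes O_pole: "poles \<iota> x = {P\<^sub>O}"
begin

lemma place_O: "is_place \<iota> P\<^sub>O" and x_neg_O: "x \<noteq> 0" "valn P\<^sub>O x < 0"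
  using O_pole unfolding poles_def by auto

text \<open>From w (w + h) = g one gets 2 v(w) = 3 v(x), because \<open>h\<close> has a smaller pole
  at \<open>O\<close> than \<open>w\<close>. So v(x) is even, which selects -2 among the two values
  left open by discreteness.\<close>

lemma valn_X_O: "p \<noteq> 0 \<Longrightarrow> valn P\<^sub>O (X p) = -2 * int (degree p)"
  and valn_w_O: "valn P\<^sub>O w = -3"
  and w_nonzero: "w \<noteq> 0"
proof -
  interpret discrete_valuation "P\<^sub>O" "valn P\<^sub>O" by (rule place_valuation(1)[OF place_O])
  have xR: "x \<notin> val_ring_of P\<^sub>O" using x_neg_O unfolding val_ring by auto
  then have c: "valn P\<^sub>O x = -1 \<or> valn P\<^sub>O x = -2" by (rule place_valuation(5)[OF place_O])
  have vX: "valn P\<^sub>O (X p) = int (degree p) * valn P\<^sub>O x" if p: "p \<noteq> 0" for p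
  proof -
    have nz: "X p * inverse x ^ degree p \<noteq> 0" using p x_neg_O by simp
    have "X p * inverse x ^ degree p \<in> val_ring_of P\<^sub>O" "inverse (X p * inverse x ^ degree p) \<in> val_ring_of P\<^sub>O"
      using uniformizer_infinite[OF place_valuation(3)[OF place_O] xR p] by auto
    then have "valn P\<^sub>O (X p * inverse x ^ degree p) = 0"
      using nz v_inverse[OF nz] unfolding val_ring by force
    then show ?thesis using p x_neg_O by (simp add: v_mult v_power v_inverse)
  qed
  have g0: "g \<noteq> 0" using deg_g by auto
  then have vg: "valn P\<^sub>O (X g) = 3 * valn P\<^sub>O x" using vX deg_g by simp
  have wg: "w * (w + X h) = X g" using curve_X by (simp add: algebra_simps power2_eq_square)
  show w0: "w \<noteq> 0" using wg g0 by auto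
  have wh0: "w + X h \<noteq> 0" using wg g0 by auto
  have sum: "valn P\<^sub>O w + valn P\<^sub>O (w + X h) = 3 * valn P\<^sub>O x"
    using v_mult[OF w0 wh0] wg vg by simp
  have vh: "h = 0 \<or> valn P\<^sub>O x \<le> valn P\<^sub>O (X h)"
  proof (cases "h = 0")
    case False
    then have "valn P\<^sub>O (X h) = int (degree h) * valn P\<^sub>O x" by (rule vX)
    moreover have "degree h = 0 \<or> degree h = 1" using deg_h by auto
    ultimately show ?thesis using x_neg_O by auto
  qed simp
  \<comment> \<open>Otherwise both factors of g have valuation at least v(x), and 3 v(x) \<ge> 2
    v(x) contradicts the pole of x.\<close>
  have less: "valn P\<^sub>O w < valn P\<^sub>O x"
  proof (rule ccontr)
    assume "\<not> ?thesis"
    then have ge: "valn P\<^sub>O x \<le> valn P\<^sub>O w" by simp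
    then have "valn P\<^sub>O x \<le> valn P\<^sub>O (w + X h)" using v_add_ge[of w "valn P\<^sub>O x" "X h"] vh wh0 by auto
    then show False using sum ge x_neg_O by simp
  qed
  then have "valn P\<^sub>O (w + X h) = valn P\<^sub>O w" using v_add_eq[of w "X h"] w0 vh by fastforce
  then have "2 * valn P\<^sub>O w = 3 * valn P\<^sub>O x" using sum by simp
  then have x2: "valn P\<^sub>O x = -2" and "valn P\<^sub>O w = -3" using c by presburger+
  then show "valn P\<^sub>O w = -3" by simp
  show "valn P\<^sub>O (X p) = -2 * int (degree p)" if "p \<noteq> 0" using vX[OF that] x2 by simp
qed

text \<open>The pole orders 2 deg A and 2 deg B + 3 differ in parity, so no cancellation occurs at
  \<open>O\<close> and the larger one is the pole order of the sum.\<close>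

lemma valn_lin_O:
  "val_ge P\<^sub>O (X A + X B * w) (- int k) \<longleftrightarrow>
    (A = 0 \<or> 2 * degree A \<le> k) \<and> (B = 0 \<or> 2 * degree B + 3 \<le> k)"
proof -
  interpret discrete_valuation "P\<^sub>O" "valn P\<^sub>O" by (rule place_valuation(1)[OF place_O])
  have vB: "valn P\<^sub>O (X B * w) = -2 * int (degree B) - 3" if "B \<noteq> 0"
    using that w_nonzero valn_X_O valn_w_O by (simp add: v_mult)
  consider "A = 0" "B = 0" | "A = 0" "B \<noteq> 0" | "A \<noteq> 0" "B = 0" | "A \<noteq> 0" "B \<noteq> 0" by blast
  then show ?thesis
  proof cases
    case 1
    then show ?thesis by (simp add: val_ge_def)
  next
    case 2
    then show ?thesis using vB w_nonzero unfolding val_ge_def by simp linarith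
  next
    case 3
    then show ?thesis using valn_X_O[of A] unfolding val_ge_def by simp linarith
  next
    case 4
    have vA: "valn P\<^sub>O (X A) = -2 * int (degree A)" using valn_X_O 4 by simp
    have nz: "X A \<noteq> 0" "X B * w \<noteq> 0" using 4 w_nonzero by auto
    have "X A + X B * w \<noteq> 0" using 4 lin_eq_0_iff by simp
    moreover have "valn P\<^sub>O (X A + X B * w) = min (valn P\<^sub>O (X A)) (valn P\<^sub>O (X B * w))"
    proof (cases "valn P\<^sub>O (X A) < valn P\<^sub>O (X B * w)")
      case True
      then show ?thesis using v_add_eq(2)[OF nz(1), of "X B * w"] by simp
    next
      case False
      then have "valn P\<^sub>O (X B * w) < valn P\<^sub>O (X A)" using vA vB[OF 4(2)] by presburger
      then show ?thesis using v_add_eq(2)[OF nz(2), of "X A"] by (simp add: add.commute)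
    qed
    ultimately show ?thesis using 4 vA vB unfolding val_ge_def by simp linarith
  qed
qed

text \<open>A valuation ring containing x belongs to a place other than \<open>O\<close>, where
  membership in L(kO) means regularity; conversely x is regular at every place other than
  \<open>O\<close>. This leaves the bound at \<open>O\<close>.\<close>

theorem riemann_roch_space_O:
  "riemann_roch_space \<iota> (Poly_Mapping.single P\<^sub>O (int k)) =
    {X A + X B * w | A B. (A = 0 \<or> 2 * degree A \<le> k) \<and> (B = 0 \<or> 2 * degree B + 3 \<le> k)}"
proof (intro equalityI subsetI)
  fix z assume z: "z \<in> riemann_roch_space \<iota> (Poly_Mapping.single P\<^sub>O (int k))"
  have "z \<in> R" if R: "valuation_subring \<iota> R" "x \<in> R" for R
  proof -
    interpret valuation_subring \<iota> R by fact
    have pl: "is_place \<iota> M" using is_place_iff[OF hom] R by blast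
    interpret discrete_valuation M "valn M" by (rule place_valuation(1)[OF pl])
    have RM: "R = {z. z = 0 \<or> 0 \<le> valn M z}" using val_ring val_ring_of_M by simp
    have "M \<noteq> P\<^sub>O" using x_neg_O R RM by auto
    then have "Poly_Mapping.lookup (Poly_Mapping.single P\<^sub>O (int k)) M = 0"
      by (metis lookup_single_not_eq)
    then have "val_ge M z 0" using z pl unfolding riemann_roch_space_def by force
    then show ?thesis unfolding val_ge_def using RM by blast
  qed
  then obtain A B where zAB: "z = X A + X B * w" using regular_iff[of z] by blast
  have "val_ge P\<^sub>O z (- int k)" using z place_O by (auto simp: riemann_roch_space_def)
  then show "z \<in> {X A + X B * w | A B. (A = 0 \<or> 2 * degree A \<le> k) \<and> (B = 0 \<or> 2 * degree B + 3 \<le> k)}"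
    using zAB valn_lin_O by blast
next
  fix z assume "z \<in> {X A + X B * w | A B. (A = 0 \<or> 2 * degree A \<le> k) \<and> (B = 0 \<or> 2 * degree B + 3 \<le> k)}"
  then obtain A B where z: "z = X A + X B * w" "val_ge P\<^sub>O z (- int k)" using valn_lin_O by blast
  show "z \<in> riemann_roch_space \<iota> (Poly_Mapping.single P\<^sub>O (int k))"
    unfolding riemann_roch_space_def
  proof (intro CollectI allI impI)
    fix P assume pl: "is_place \<iota> P"
    show "val_ge P z (- Poly_Mapping.lookup (Poly_Mapping.single P\<^sub>O (int k)) P)"
    proof (cases "P = P\<^sub>O")
      case True
      then show ?thesis using z by simp
    next
      case False
      interpret discrete_valuation P "valn P" by (rule place_valuation(1)[OF pl])
      have "P \<notin> poles \<iota> x" using False O_pole by simp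
      then have "x \<in> val_ring_of P" using pl unfolding val_ring poles_def by auto
      then have "z \<in> val_ring_of P" using regular_iff[of z] z place_valuation(3)[OF pl] by blast
      then show ?thesis using False by (auto simp: val_ring val_ge_def lookup_single)
    qed
  qed
qed

end

end

section \<open>Laurent expansions\<close>

text \<open>The digits arise by repeatedly subtracting the value at \<open>P\<close> and dividing by
  \<open>s\<close>, starting with the regular function z s; the series is then shifted by one. Its
  coefficient at -1 is thus the value of z s at \<open>P\<close>, which is how residues at simple
  poles are computed.\<close>

lemma laurent_expansion_exists:
  fixes \<iota> :: "'k::field \<Rightarrow> 'f::field"
  assumes dv: "discrete_valuation P v" and hom: "field_hom \<iota>"
    and rational: "\<And>z. z \<in> val_ring_of P \<Longrightarrow> \<exists>c. z - \<iota> c \<in> P"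
    and s: "s \<noteq> 0" "v s = 1" and z: "z * s \<in> val_ring_of P"
  shows "\<exists>a. z * s - \<iota> (fls_residue a) \<in> P \<and> (\<forall>m. val_ge P
    (z - (\<Sum>i\<in>{fls_subdegree a..<m}. \<iota> (fls_nth a i) * s powi i)) m)"
proof -
  interpret discrete_valuation P v by fact
  interpret field_hom \<iota> by fact
  define co where "co y = (SOME c. y - \<iota> c \<in> P)" for y
  have co: "y - \<iota> (co y) \<in> P" if "y \<in> val_ring_of P" for y
    using someI_ex[OF rational[OF that]] unfolding co_def .
  define y where "y = rec_nat (z * s) (\<lambda>_ y. (y - \<iota> (co y)) / s)"
  have y0: "y 0 = z * s" and yS: "y (Suc n) = (y n - \<iota> (co (y n))) / s" for n
    by (simp_all add: y_def)
  have y_in: "y n \<in> val_ring_of P" for n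
  proof (induction n)
    case 0
    then show ?case using z by (simp add: y0)
  next
    case (Suc n)
    then have "y n - \<iota> (co (y n)) \<in> P" by (rule co)
    then have "y n - \<iota> (co (y n)) = 0 \<or> 0 < v (y n - \<iota> (co (y n)))" by (simp only: P_eq mem_Collect_eq)
    then show ?case
      using s unfolding yS val_ring
      by (cases "y n - \<iota> (co (y n)) = 0") (auto simp: v_divide)
  qed
  have expand: "z * s = (\<Sum>i<n. \<iota> (co (y i)) * s ^ i) + s ^ n * y n" for n
  proof (induction n)
    case (Suc n)
    have "s * y (Suc n) = y n - \<iota> (co (y n))" using s by (simp add: yS)
    then have "s ^ Suc n * y (Suc n) = s ^ n * (y n - \<iota> (co (y n)))"
      by (simp only: power_Suc2 mult.assoc)
    then show ?case using Suc by (simp add: algebra_simps)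
  qed (simp add: y0)
  define a where "a = fls_shift 1 (fps_to_fls (Abs_fps (\<lambda>i. co (y i))))"
  have a_nth: "fls_nth a k = (if k < -1 then 0 else co (y (nat (k + 1))))" for k
    by (simp add: a_def)
  have sub: "a = 0 \<or> -1 \<le> fls_subdegree a"
    by (metis a_nth fls_subdegree_geI)
  \<comment> \<open>Below -1 the partial sum is zero and the bound is the simple pole of z. From -1
    on the sum has m + 1 terms, and the remainder s^(m + 1) y / s has order at least
    \<open>m\<close>.\<close>
  have "val_ge P (z - (\<Sum>i\<in>{fls_subdegree a..<m}. \<iota> (fls_nth a i) * s powi i)) m" for m
  proof (cases "m < -1")
    case True
    have "(\<Sum>i\<in>{fls_subdegree a..<m}. \<iota> (fls_nth a i) * s powi i) = 0"
      using True by (intro sum.neutral) (auto simp: a_nth hom_zero)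
    moreover have "z = 0 \<or> -1 \<le> v z"
      using z s v_mult[of z s] by (cases "z = 0") (auto simp: val_ring)
    ultimately show ?thesis using True by (auto simp: val_ge_iff)
  next
    case False
    define n where "n = nat (m + 1)"
    have "(\<Sum>i\<in>{fls_subdegree a..<m}. \<iota> (fls_nth a i) * s powi i)
        = (\<Sum>i\<in>{-1..<m}. \<iota> (fls_nth a i) * s powi i)"
    proof (cases "a = 0")
      case True
      then show ?thesis by (simp add: hom_zero)
    next
      case False
      then have "-1 \<le> fls_subdegree a" using sub by simp
      then show ?thesis by (intro sum.mono_neutral_left) (auto simp: hom_zero)
    qed
    also have "\<dots> = (\<Sum>i<n. \<iota> (co (y i)) * s powi (int i - 1))"
      by (rule sum.reindex_bij_witness[of _ "\<lambda>i. int i - 1" "\<lambda>i. nat (i + 1)"])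
        (use False in \<open>auto simp: n_def a_nth\<close>)
    also have "\<dots> = (\<Sum>i<n. \<iota> (co (y i)) * s ^ i) / s"
      unfolding sum_divide_distrib using s by (intro sum.cong) (auto simp: power_int_diff)
    finally have "z - (\<Sum>i\<in>{fls_subdegree a..<m}. \<iota> (fls_nth a i) * s powi i) = s ^ n * y n / s"
      using expand[of n] s by (simp add: field_simps)
    moreover have "s ^ n * y n / s = 0 \<or> m \<le> v (s ^ n * y n / s)"
    proof (cases "y n = 0")
      case False
      then have "0 \<le> v (y n)" using y_in[of n] by (simp add: val_ring)
      moreover have "int n = m + 1" using \<open>\<not> m < -1\<close> by (simp add: n_def)
      ultimately show ?thesis using False s by (simp add: v_divide v_mult v_power)
    qed simp
    ultimately show ?thesis by (simp add: val_ge_iff)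
  qed
  moreover have "z * s - \<iota> (fls_residue a) \<in> P" using co[OF z] by (simp add: a_nth y0)
  ultimately show ?thesis by blast
qed

text \<open>Both expansions are extended down to a common index \<open>N\<close>. At the first
  nonzero difference \<open>d i\<close> the partial sum through index i has valuation exactly
  \<open>i\<close>, whereas the two approximations force at least i + 1.\<close>

lemma laurent_expansion_unique:
  fixes \<iota> :: "'k::field \<Rightarrow> 'f::field"
  assumes dv: "discrete_valuation P v" and hom: "field_hom \<iota>"
    and const: "\<And>c. c \<noteq> 0 \<Longrightarrow> v (\<iota> c) = 0"
    and s: "s \<noteq> 0" "v s = 1"
    and a: "\<And>m. val_ge P (z - (\<Sum>i\<in>{fls_subdegree a..<m}. \<iota> (fls_nth a i) * s powi i)) m"
    and b: "\<And>m. val_ge P (z - (\<Sum>i\<in>{fls_subdegree b..<m}. \<iota> (fls_nth b i) * s powi i)) m"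
  shows "a = b"
proof (rule fls_eqI)
  interpret discrete_valuation P v by fact
  interpret field_hom \<iota> by fact
  define N where "N = min (fls_subdegree a) (fls_subdegree b)"
  define d where "d i = fls_nth a i - fls_nth b i" for i
  have ext: "(\<Sum>i\<in>{fls_subdegree e..<m}. \<iota> (fls_nth e i) * s powi i)
      = (\<Sum>i\<in>{N..<m}. \<iota> (fls_nth e i) * s powi i)" if "N \<le> fls_subdegree e" for e m
    using that by (intro sum.mono_neutral_left) (auto simp: hom_zero)
  have d_val: "val_ge P (\<Sum>i\<in>{N..<m}. \<iota> (d i) * s powi i) m" for m
  proof -
    define S where "S e = (\<Sum>i\<in>{N..<m}. \<iota> (fls_nth e i) * s powi i)" for e :: "'k fls"
    have "(\<Sum>i\<in>{N..<m}. \<iota> (d i) * s powi i) = (z - S b) + - (z - S a)"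
      by (simp add: S_def d_def hom_minus algebra_simps sum_subtractf)
    moreover have ab: "z - S a = 0 \<or> m \<le> v (z - S a)" "z - S b = 0 \<or> m \<le> v (z - S b)"
      using a[of m] b[of m] ext[of a m] ext[of b m] by (simp_all add: S_def val_ge_iff N_def)
    moreover have "(z - S b) + - (z - S a) = 0 \<or> m \<le> v ((z - S b) + - (z - S a))"
      by (rule v_add_ge[OF ab(2)], unfold v_minus neg_equal_0_iff_equal, rule ab(1))
    ultimately show ?thesis unfolding val_ge_iff by metis
  qed
  have d0: "d i = 0" if "N \<le> i" for i
    using that
  proof (induction "nat (i - N)" arbitrary: i rule: less_induct)
    case less
    have z: "d j = 0" if "j \<in> {N..<i}" for j
      using less.hyps[of j] that less.prems by (simp add: nat_less_eq_zless)
    have "{N..<i + 1} = insert i {N..<i}" using less.prems by auto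
    then have "(\<Sum>j\<in>{N..<i + 1}. \<iota> (d j) * s powi j) = \<iota> (d i) * s powi i"
      using z by (simp add: hom_zero)
    then have *: "val_ge P (\<iota> (d i) * s powi i) (i + 1)" using d_val[of "i + 1"] by simp
    show "d i = 0"
    proof (rule ccontr)
      assume di: "d i \<noteq> 0"
      then have "v (\<iota> (d i) * s powi i) = i"
        using s const[OF di] by (simp add: v_mult v_powi)
      then show False using * di s by (simp add: val_ge_iff)
    qed
  qed
  show "fls_nth a i = fls_nth b i" for i
  proof (cases "N \<le> i")
    case True
    then show ?thesis using d0[of i] by (simp add: d_def)
  next
    case False
    then show ?thesis by (simp add: N_def)
  qed
qed

lemma fls_residue_laurent_expansion:
  fixes \<iota> :: "'k::field \<Rightarrow> 'f::field"
  assumes dv: "discrete_valuation P v" and hom: "field_hom \<iota>"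
    and const: "\<And>c. c \<noteq> 0 \<Longrightarrow> v (\<iota> c) = 0"
    and rational: "\<And>z. z \<in> val_ring_of P \<Longrightarrow> \<exists>c. z - \<iota> c \<in> P"
    and s: "s \<noteq> 0" "v s = 1" and z: "z * s \<in> val_ring_of P"
  shows "z * s - \<iota> (fls_residue (laurent_expansion_at \<iota> P s z)) \<in> P"
proof -
  obtain a where a: "z * s - \<iota> (fls_residue a) \<in> P"
    "\<forall>m. val_ge P (z - (\<Sum>i\<in>{fls_subdegree a..<m}. \<iota> (fls_nth a i) * s powi i)) m"
    using laurent_expansion_exists[OF dv hom rational s z] by auto
  have "laurent_expansion_at \<iota> P s z = a"
    unfolding laurent_expansion_at_def
    by (rule the_equality) (use a laurent_expansion_unique[OF dv hom const s] in blast)+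
  then show ?thesis using a by simp
qed

section \<open>Derivations\<close>

lemma is_derivation_simps:
  assumes "is_derivation \<iota> \<delta>"
  shows "\<delta> (u + v) = \<delta> u + \<delta> v" "\<delta> (u * v) = u * \<delta> v + v * \<delta> u" "\<delta> (\<iota> c) = 0"
    "\<delta> 0 = 0" "\<delta> 1 = 0" "\<delta> (- u) = - \<delta> u" "\<delta> (u - v) = \<delta> u - \<delta> v"
    "u \<noteq> 0 \<Longrightarrow> \<delta> (inverse u) = - \<delta> u / u ^ 2"
proof -
  show *: "\<delta> (u + v) = \<delta> u + \<delta> v" "\<delta> (u * v) = u * \<delta> v + v * \<delta> u" "\<delta> (\<iota> c) = 0" for u v c
    using assms by (simp_all add: is_derivation_def)
  show 0: "\<delta> 0 = 0" using *(1)[of 0 0] by (metis add.right_neutral add_left_cancel)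
  show 1: "\<delta> 1 = 0" using *(2)[of 1 1] by (metis add.right_neutral add_left_cancel mult_1)
  show m: "\<delta> (- u) = - \<delta> u" for u using *(1)[of u "- u"] 0 by (simp add: eq_neg_iff_add_eq_0 add.commute)
  show "\<delta> (u - v) = \<delta> u - \<delta> v" using *(1)[of u "- v"] m by simp
  show "\<delta> (inverse u) = - \<delta> u / u ^ 2" if "u \<noteq> 0"
    using *(2)[of u "inverse u"] 1 that
    by (simp add: field_simps power2_eq_square eq_neg_iff_add_eq_0)
qed

context weierstrass
begin

text \<open>The derivative of A + B w with respect to x; the fraction is dw/dx, obtained by
  differentiating the curve equation.\<close>

definition lin_deriv :: "'k poly \<Rightarrow> 'k poly \<Rightarrow> 'f" where
  "lin_deriv A B = X (pderiv A) + X (pderiv B) * w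
    + X B * ((X (pderiv g) - X (pderiv h) * w) / (2 * w + X h))"

text \<open>The quotient rule multiplied by the denominator, imposed for all fractions representing
  \<open>z\<close> at once.\<close>

definition ddx :: "'f \<Rightarrow> 'f" where
  "ddx z = (THE d. \<forall>A B C. C \<noteq> 0 \<longrightarrow> z * X C = X A + X B * w \<longrightarrow>
     d * X C = lin_deriv A B - z * X (pderiv C))"

lemma different_nonzero: "2 * w + X h \<noteq> 0"
  using lin_eq_0_iff[of h "[:2:]"] separable
  by (auto simp: add.commute pCons_eq_0_iff iota.hom_numeral)

lemma lin_deriv_smult:
  "lin_deriv (A * C) (B * C) = lin_deriv A B * X C + (X A + X B * w) * X (pderiv C)"
  by (simp add: lin_deriv_def pderiv_mult algebra_simps)

lemma ddx_eq:
  assumes C: "C \<noteq> 0" and z: "z * X C = X A + X B * w"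
  shows "ddx z * X C = lin_deriv A B - z * X (pderiv C)"
proof -
  define d where "d = (lin_deriv A B - z * X (pderiv C)) / X C"
  have dC: "d * X C = lin_deriv A B - z * X (pderiv C)" using C by (simp add: d_def)
  have "ddx z = d"
    unfolding ddx_def
  proof (rule the_equality)
    show "\<forall>A' B' C'. C' \<noteq> 0 \<longrightarrow> z * X C' = X A' + X B' * w \<longrightarrow>
        d * X C' = lin_deriv A' B' - z * X (pderiv C')"
    proof (intro allI impI)
      fix A' B' C' assume C': "C' \<noteq> 0" and z': "z * X C' = X A' + X B' * w"
      have "X (A * C') + X (B * C') * w = X (A' * C) + X (B' * C) * w"
        using arg_cong[OF z, of "\<lambda>t. t * X C'"] arg_cong[OF z', of "\<lambda>t. t * X C"]
        by (simp add: algebra_simps)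
      then have e: "A * C' = A' * C" "B * C' = B' * C" unfolding lin_eq_iff by auto
      have "lin_deriv (A * C') (B * C') = lin_deriv (A' * C) (B' * C)" unfolding e ..
      \<comment> \<open>This is the product rule on the two equal numerators over the common
        denominator C C'.\<close>
      then have "lin_deriv A B * X C' + z * X C * X (pderiv C')
          = lin_deriv A' B' * X C + z * X C' * X (pderiv C)"
        unfolding lin_deriv_smult z z' .
      then have e1: "lin_deriv A B * X C' + z * X C * X (pderiv C')
          - (lin_deriv A' B' * X C + z * X C' * X (pderiv C)) = 0" by (simp only: diff_self)
      have e2: "(d * X C - (lin_deriv A B - z * X (pderiv C))) * X C' = 0" by (simp only: dC diff_self mult_zero_left)
      have "d * X C' * X C - (lin_deriv A' B' - z * X (pderiv C')) * X C
          = (d * X C - (lin_deriv A B - z * X (pderiv C))) * X C'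
          + (lin_deriv A B * X C' + z * X C * X (pderiv C')
          - (lin_deriv A' B' * X C + z * X C' * X (pderiv C)))" by (simp add: algebra_simps)
      then have "d * X C' * X C = (lin_deriv A' B' - z * X (pderiv C')) * X C"
        unfolding e1 e2 by simp
      then show "d * X C' = lin_deriv A' B' - z * X (pderiv C')" using C by simp
    qed
    fix d' assume d': "\<forall>A B C. C \<noteq> 0 \<longrightarrow> z * X C = X A + X B * w \<longrightarrow>
        d' * X C = lin_deriv A B - z * X (pderiv C)"
    then have "d' * X C = d * X C" using dC C z by simp
    then show "d' = d" using C by simp
  qed
  then show ?thesis using dC by simp
qed

lemma ddx_lin: "ddx (X A + X B * w) = lin_deriv A B"
  using ddx_eq[of 1 "X A + X B * w" A B] by simp

lemma ddx_X: "ddx (X p) = X (pderiv p)"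
  using ddx_lin[of p 0] by (simp add: lin_deriv_def)

lemma ddx_x: "ddx x = 1"
  using ddx_X[of "[:0, 1:]"] by (simp add: pderiv_pCons)

text \<open>The Leibniz rule on K[x, w]: the two sides differ by a combination of the equation
  defining dw/dx and the equation of the curve, with the cofactors displayed below.\<close>

lemma lin_deriv_lin_mult:
  "lin_deriv (A * A' + g * B * B') (A * B' + B * A' - h * B * B')
    = (X A + X B * w) * lin_deriv A' B' + (X A' + X B' * w) * lin_deriv A B"
proof -
  define e where "e = (X (pderiv g) - X (pderiv h) * w) / (2 * w + X h)"
  have e: "e * (2 * w + X h) = X (pderiv g) - X (pderiv h) * w"
    using different_nonzero by (simp add: e_def)
  have w: "w * w = X g - X h * w" using curve_X by (simp add: power2_eq_square)
  have "X (pderiv (A * A' + g * B * B')) + X (pderiv (A * B' + B * A' - h * B * B')) * w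
      + X (A * B' + B * A' - h * B * B') * e
    - ((X A + X B * w) * (X (pderiv A') + X (pderiv B') * w + X B' * e)
      + (X A' + X B' * w) * (X (pderiv A) + X (pderiv B) * w + X B * e))
    = X B * X B' * (X (pderiv g) - X (pderiv h) * w - e * (2 * w + X h))
      + (X B * X (pderiv B') + X B' * X (pderiv B)) * (X g - X h * w - w * w)"
    by (simp add: pderiv_add pderiv_diff pderiv_mult algebra_simps)
  also have "\<dots> = 0" unfolding e w by simp
  finally show ?thesis by (simp add: lin_deriv_def e_def)
qed

lemma is_derivation_ddx: "is_derivation \<iota> ddx"
  unfolding is_derivation_def
proof (intro conjI allI)
  fix u v
  obtain A B C where C: "C \<noteq> 0" and "u = (X A + X B * w) / X C" by (rule representation)
  then have u: "u * X C = X A + X B * w" by simp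
  obtain A' B' C' where C': "C' \<noteq> 0" and "v = (X A' + X B' * w) / X C'" by (rule representation)
  then have v: "v * X C' = X A' + X B' * w" by simp
  note du = ddx_eq[OF C u] and dv = ddx_eq[OF C' v]
  have CC: "C * C' \<noteq> 0" using C C' by simp
  have "(u + v) * X (C * C') = u * X C * X C' + v * X C' * X C" by (simp add: algebra_simps)
  also have "\<dots> = X (A * C' + A' * C) + X (B * C' + B' * C) * w"
    unfolding u v by (simp add: algebra_simps)
  finally have "ddx (u + v) * X (C * C')
      = lin_deriv (A * C' + A' * C) (B * C' + B' * C) - (u + v) * X (pderiv (C * C'))"
    by (rule ddx_eq[OF CC])
  also have "lin_deriv (A * C' + A' * C) (B * C' + B' * C)
      = lin_deriv (A * C') (B * C') + lin_deriv (A' * C) (B' * C)"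
    unfolding lin_deriv_def pderiv_add X_add by (simp only: distrib_right distrib_left ac_simps)
  also have "\<dots> - (u + v) * X (pderiv (C * C')) = (ddx u * X C) * X C' + (ddx v * X C') * X C"
    unfolding lin_deriv_smult u[symmetric] v[symmetric] du dv
    by (simp add: pderiv_mult algebra_simps)
  also have "\<dots> = (ddx u + ddx v) * X (C * C')" by (simp add: algebra_simps)
  finally show "ddx (u + v) = ddx u + ddx v" using CC by simp
  have "(u * v) * X (C * C') = (u * X C) * (v * X C')" by (simp add: algebra_simps)
  also have "\<dots> = X (A * A' + g * B * B') + X (A * B' + B * A' - h * B * B') * w"
    unfolding u v by (rule lin_mult)
  finally have "ddx (u * v) * X (C * C')
      = lin_deriv (A * A' + g * B * B') (A * B' + B * A' - h * B * B') - (u * v) * X (pderiv (C * C'))"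
    by (rule ddx_eq[OF CC])
  also have "\<dots> = u * X C * (ddx v * X C') + v * X C' * (ddx u * X C)"
    unfolding lin_deriv_lin_mult u[symmetric] v[symmetric] du dv
    by (simp add: pderiv_mult algebra_simps)
  also have "\<dots> = (u * ddx v + v * ddx u) * X (C * C')" by (simp add: algebra_simps)
  finally show "ddx (u * v) = u * ddx v + v * ddx u" using CC by simp
next
  fix c show "ddx (\<iota> c) = 0" using ddx_X[of "[:c:]"] by simp
qed

text \<open>The set where the identity holds is a subfield containing K, x and w. For
  \<open>w\<close>, both sides solve the linear equation obtained by differentiating the curve
  equation, whose coefficient 2w + h is nonzero.\<close>

lemma derivation_eq:
  assumes "is_derivation \<iota> \<delta>"
  shows "\<delta> z = \<delta> x * ddx z"
proof -
  note \<delta> = is_derivation_simps[OF assms] and D = is_derivation_simps[OF is_derivation_ddx]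
  define L where "L = {z. \<delta> z = \<delta> x * ddx z}"
  have "is_subfield L"
    unfolding is_subfield_def
  proof (intro conjI ballI)
    show "1 \<in> L" by (simp add: L_def \<delta> D)
  next
    fix u v assume "u \<in> L" "v \<in> L"
    then show "u - v \<in> L" "u * v \<in> L" by (simp_all add: L_def \<delta>(2,7) D(2,7) algebra_simps)
  next
    fix u assume "u \<in> L"
    then show "inverse u \<in> L" by (cases "u = 0") (simp_all add: L_def \<delta>(4,8) D(4,8))
  qed
  moreover have "range \<iota> \<subseteq> L" by (auto simp: L_def \<delta> D)
  moreover have xL: "x \<in> L" by (simp add: L_def ddx_x)
  moreover have "w \<in> L"
  proof -
    have \<delta>X: "\<delta> (X p) = \<delta> x * X (pderiv p)" for p
      by (induction p) (simp_all add: X_pCons pderiv_pCons \<delta>(1-4) algebra_simps)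
    have "w * w + X h * w = X g" using curve_X by (simp add: power2_eq_square)
    then have "\<delta> (w * w + X h * w) = \<delta> (X g)" "ddx (w * w + X h * w) = ddx (X g)" by simp_all
    then have "(2 * w + X h) * \<delta> w = \<delta> x * X (pderiv g) - \<delta> x * X (pderiv h) * w"
      "(2 * w + X h) * ddx w = X (pderiv g) - X (pderiv h) * w"
      unfolding \<delta>(1,2) D(1,2) \<delta>X ddx_X by (simp_all add: algebra_simps)
    then have "(2 * w + X h) * \<delta> w = (2 * w + X h) * (\<delta> x * ddx w)"
      by (simp add: mult.left_commute[of _ "\<delta> x"] right_diff_distrib mult.assoc)
    then show ?thesis using different_nonzero by (simp add: L_def)
  qed
  ultimately have "L = UNIV" by (rule generates)
  then show ?thesis by (auto simp: L_def)
qed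

text \<open>The chain rule. A derivation that is 1 at \<open>s\<close> must be 1/(ds/dx) at x, and
  its value at x determines it.\<close>

lemma deriv_wrt_eq:
  assumes "ddx s \<noteq> 0"
  shows "deriv_wrt \<iota> s z = ddx z / ddx s"
proof -
  have "deriv_wrt \<iota> s = (\<lambda>z. ddx z / ddx s)"
    unfolding deriv_wrt_def
  proof (rule the_equality)
    note D = is_derivation_simps[OF is_derivation_ddx]
    show "is_derivation \<iota> (\<lambda>z. ddx z / ddx s) \<and> ddx s / ddx s = 1"
      using assms by (simp add: is_derivation_def D add_divide_distrib)
  next
    fix \<delta> assume \<delta>: "is_derivation \<iota> \<delta> \<and> \<delta> s = 1"
    then have eq: "\<delta> z = \<delta> x * ddx z" for z by (intro derivation_eq) simp
    have "\<delta> x * ddx s = 1" using eq[of s] \<delta> by simp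
    then have "\<delta> x = 1 / ddx s" using assms by (simp add: field_simps)
    then have "\<delta> z = ddx z / ddx s" for z using eq[of z] by simp
    then show "\<delta> = (\<lambda>z. ddx z / ddx s)" by (rule ext)
  qed
  then show ?thesis by simp
qed

section \<open>Rational points\<close>

definition eval_lin :: "'k \<Rightarrow> 'k \<Rightarrow> 'k poly \<Rightarrow> 'k poly \<Rightarrow> 'k" where
  "eval_lin \<alpha> \<beta> A B = poly A \<alpha> + poly B \<alpha> * \<beta>"

definition on_curve :: "'k \<Rightarrow> 'k \<Rightarrow> bool" where
  "on_curve \<alpha> \<beta> \<longleftrightarrow> \<beta> ^ 2 + poly h \<alpha> * \<beta> = poly g \<alpha>"

lemma eval_lin_mult:
  assumes "on_curve \<alpha> \<beta>"
  shows "eval_lin \<alpha> \<beta> (A * A' + g * B * B') (A * B' + B * A' - h * B * B')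
    = eval_lin \<alpha> \<beta> A B * eval_lin \<alpha> \<beta> A' B'"
proof -
  have g: "poly g \<alpha> = \<beta> ^ 2 + poly h \<alpha> * \<beta>" using assms by (simp add: on_curve_def)
  show ?thesis by (simp add: eval_lin_def g algebra_simps power2_eq_square)
qed

text \<open>The curve is smooth, so the maximal ideal of the local ring at a point is generated by
  \<open>x - \<alpha>\<close> or by \<open>w - \<beta>\<close>.\<close>

lemma local_parameter:
  assumes on: "on_curve \<alpha> \<beta>"
  shows "\<exists>\<pi>. (\<pi> = x - \<iota> \<alpha> \<or> \<pi> = w - \<iota> \<beta>) \<and> (2 * \<beta> + poly h \<alpha> \<noteq> 0 \<longrightarrow> \<pi> = x - \<iota> \<alpha>) \<and>
    (\<forall>A B. eval_lin \<alpha> \<beta> A B = 0 \<longrightarrow> (\<exists>A' B' C E. eval_lin \<alpha> \<beta> C E \<noteq> 0 \<and>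
      (X A + X B * w) * (X C + X E * w) = \<pi> * (X A' + X B' * w)))"
proof -
  define t where "t = [:- \<alpha>, 1:]"
  have Xt: "X t = x - \<iota> \<alpha>" by (simp add: t_def X_pCons iota.hom_uminus iota.hom_one)
  have "poly (g - h * [:\<beta>:] - [:\<beta>:] ^ 2) \<alpha> = 0"
    using on by (simp add: on_curve_def algebra_simps)
  then have "t dvd g - h * [:\<beta>:] - [:\<beta>:] ^ 2" unfolding t_def poly_eq_0_iff_dvd .
  then obtain q where q: "g - h * [:\<beta>:] - [:\<beta>:] ^ 2 = t * q" ..
  \<comment> \<open>This links the two candidates for the local parameter: w - \<beta> times its
    companion w + \<beta> + h is a multiple of x - \<alpha>.\<close>
  have factor: "(w - \<iota> \<beta>) * (w + \<iota> \<beta> + X h) = X t * X q"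
  proof -
    have "(w - \<iota> \<beta>) * (w + \<iota> \<beta> + X h) = w ^ 2 + X h * w - X h * \<iota> \<beta> - \<iota> \<beta> ^ 2"
      by (simp add: algebra_simps power2_eq_square)
    also have "\<dots> = X (g - h * [:\<beta>:] - [:\<beta>:] ^ 2)" by (simp only: curve_X X_diff X_mult X_power X_const) (simp add: algebra_simps)
    finally show ?thesis by (simp only: q X_mult)
  qed
  have split: "\<exists>A1 B1. X A + X B * w = X t * (X A1 + X B1 * w) + \<iota> (poly B \<alpha>) * (w - \<iota> \<beta>)"
    if "eval_lin \<alpha> \<beta> A B = 0" for A B
  proof -
    have "t dvd A - [:poly A \<alpha>:]" "t dvd B - [:poly B \<alpha>:]"
      unfolding t_def poly_eq_0_iff_dvd[symmetric] by simp_all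
    then obtain A1 B1 where AB: "A - [:poly A \<alpha>:] = t * A1" "B - [:poly B \<alpha>:] = t * B1"
      by (auto simp: dvd_def)
    have "X A = X t * X A1 + \<iota> (poly A \<alpha>)" "X B = X t * X B1 + \<iota> (poly B \<alpha>)"
      using arg_cong[OF AB(1), of X] arg_cong[OF AB(2), of X] by (simp_all add: algebra_simps)
    moreover have "poly A \<alpha> = - (poly B \<alpha> * \<beta>)" using that by (simp add: eval_lin_def eq_neg_iff_add_eq_0)
    ultimately have "X A + X B * w = X t * (X A1 + X B1 * w) + \<iota> (poly B \<alpha>) * (w - \<iota> \<beta>)"
      by (simp add: iota.hom_uminus iota.hom_mult algebra_simps)
    then show ?thesis by blast
  qed
  show ?thesis
  proof (cases "2 * \<beta> + poly h \<alpha> = 0")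
    \<comment> \<open>The companion has value 2 \<beta> + h(\<alpha>) at the point, so it does not
      vanish there; multiplying by it turns w - \<beta> into a multiple of x - \<alpha>.\<close>
    case False
    have "\<exists>A' B' C E. eval_lin \<alpha> \<beta> C E \<noteq> 0 \<and>
      (X A + X B * w) * (X C + X E * w) = (x - \<iota> \<alpha>) * (X A' + X B' * w)"
      if AB: "eval_lin \<alpha> \<beta> A B = 0" for A B
    proof -
      obtain A1 B1 where 1: "X A + X B * w = X t * (X A1 + X B1 * w) + \<iota> (poly B \<alpha>) * (w - \<iota> \<beta>)"
        using split[OF AB] by blast
      have C: "X ([:\<beta>:] + h) + X 1 * w = w + \<iota> \<beta> + X h" by (simp add: algebra_simps)
      have "(X A + X B * w) * (X ([:\<beta>:] + h) + X 1 * w)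
          = X t * ((X A1 + X B1 * w) * (X ([:\<beta>:] + h) + X 1 * w))
            + \<iota> (poly B \<alpha>) * ((w - \<iota> \<beta>) * (w + \<iota> \<beta> + X h))"
        unfolding 1 C by (simp add: algebra_simps)
      also have "\<dots> = X t * (X (A1 * ([:\<beta>:] + h) + g * B1 * 1 + [:poly B \<alpha>:] * q)
          + X (A1 * 1 + B1 * ([:\<beta>:] + h) - h * B1 * 1) * w)"
        unfolding lin_mult factor by (simp add: algebra_simps iota.hom_zero)
      finally have "(X A + X B * w) * (X ([:\<beta>:] + h) + X 1 * w)
        = (x - \<iota> \<alpha>) * (X (A1 * ([:\<beta>:] + h) + g * B1 * 1 + [:poly B \<alpha>:] * q)
          + X (A1 * 1 + B1 * ([:\<beta>:] + h) - h * B1 * 1) * w)" unfolding Xt .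
      moreover have "eval_lin \<alpha> \<beta> ([:\<beta>:] + h) 1 \<noteq> 0"
        using False by (simp add: eval_lin_def algebra_simps)
      ultimately show ?thesis by blast
    qed
    then show ?thesis by (intro exI[of _ "x - \<iota> \<alpha>"]) simp
  next
    case True
    \<comment> \<open>If x - \<alpha> divided \<open>q\<close>, the fraction (w - \<beta>)/(x -
      \<alpha>) would have polynomial trace and norm, against \<open>normal\<close>. Hence q does
      not vanish at the point, and multiplying by it turns x - \<alpha> into a multiple of w -
      \<beta>.\<close>
    have q_nz: "poly q \<alpha> \<noteq> 0"
    proof
      assume "poly q \<alpha> = 0"
      then have "t dvd q" by (simp add: t_def poly_eq_0_iff_dvd)
      then have "t ^ 2 dvd - (t * q)" by (simp add: power2_eq_square)
      also have "- (t * q) = [:- \<beta>:] ^ 2 - h * [:- \<beta>:] * 1 - g * 1 ^ 2"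
        unfolding q[symmetric] by (simp add: power2_eq_square)
      finally have "t ^ 2 dvd [:- \<beta>:] ^ 2 - h * [:- \<beta>:] * 1 - g * 1 ^ 2" .
      moreover have "poly (2 * [:- \<beta>:] - h * 1) \<alpha> = 0"
        using True by (simp add: algebra_simps neg_eq_iff_add_eq_0)
      then have "t dvd 2 * [:- \<beta>:] - h * 1" unfolding t_def poly_eq_0_iff_dvd .
      ultimately have "t dvd 1" using normal[of t "[:- \<beta>:]" 1] by (simp add: t_def)
      then show False unfolding t_def poly_eq_0_iff_dvd[symmetric] by simp
    qed
    have "\<exists>A' B' C E. eval_lin \<alpha> \<beta> C E \<noteq> 0 \<and>
      (X A + X B * w) * (X C + X E * w) = (w - \<iota> \<beta>) * (X A' + X B' * w)"
      if AB: "eval_lin \<alpha> \<beta> A B = 0" for A B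
    proof -
      obtain A1 B1 where 1: "X A + X B * w = X t * (X A1 + X B1 * w) + \<iota> (poly B \<alpha>) * (w - \<iota> \<beta>)"
        using split[OF AB] by blast
      have C: "X ([:\<beta>:] + h) + X 1 * w = w + \<iota> \<beta> + X h" by (simp add: algebra_simps)
      have "(X A + X B * w) * (X q + X 0 * w)
          = (X t * X q) * (X A1 + X B1 * w) + \<iota> (poly B \<alpha>) * (w - \<iota> \<beta>) * X q"
        unfolding 1 by (simp add: algebra_simps)
      also have "\<dots> = (w - \<iota> \<beta>) * ((X A1 + X B1 * w) * (X ([:\<beta>:] + h) + X 1 * w)
          + \<iota> (poly B \<alpha>) * X q)"
        unfolding factor[symmetric] C by (simp add: algebra_simps)
      also have "\<dots> = (w - \<iota> \<beta>) * (X (A1 * ([:\<beta>:] + h) + g * B1 * 1 + [:poly B \<alpha>:] * q)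
          + X (A1 * 1 + B1 * ([:\<beta>:] + h) - h * B1 * 1) * w)"
        unfolding lin_mult by (simp add: algebra_simps iota.hom_zero)
      finally have "(X A + X B * w) * (X q + X 0 * w) = \<dots>" .
      moreover have "eval_lin \<alpha> \<beta> q 0 \<noteq> 0" using q_nz by (simp add: eval_lin_def)
      ultimately show ?thesis by blast
    qed
    then show ?thesis using True by (intro exI[of _ "w - \<iota> \<beta>"]) simp
  qed
qed

section \<open>Values of functions at a fixed place\<close>

context
  fixes P
  assumes pl: "is_place \<iota> P"
begin

interpretation discrete_valuation P "valn P" by (rule place_valuation(1)[OF pl])
interpretation valuation_subring \<iota> "val_ring_of P" by (rule place_valuation(3)[OF pl])

lemma P_iff: "z \<in> P \<longleftrightarrow> z = 0 \<or> 0 < valn P z"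
  by (subst P_eq) simp

lemma P_in: "z \<in> P \<Longrightarrow> z \<in> val_ring_of P"
  unfolding val_ring by (auto simp: P_iff)

lemma P_add: "a \<in> P \<Longrightarrow> b \<in> P \<Longrightarrow> a + b \<in> P"
  and P_minus: "a \<in> P \<Longrightarrow> - a \<in> P"
  and P_mult: "a \<in> P \<Longrightarrow> b \<in> val_ring_of P \<Longrightarrow> a * b \<in> P"
  using M_add M_minus M_mult unfolding place_valuation(4)[OF pl, symmetric] by blast+

lemma value_in_ring: "z - \<iota> c \<in> P \<Longrightarrow> z \<in> val_ring_of P"
  using add_in[OF P_in const_in[of c], of "z - \<iota> c"] by simp

text \<open>The difference of two values is a constant in \<open>P\<close>, while nonzero constants
  have valuation 0.\<close>

lemma value_unique: assumes "z - \<iota> c \<in> P" "z - \<iota> c' \<in> P" shows "c = c'"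
proof (rule ccontr)
  assume "c \<noteq> c'"
  have "\<iota> (c - c') = (z - \<iota> c') + - (z - \<iota> c)" by (simp add: iota.hom_minus)
  then have "\<iota> (c - c') \<in> P" using P_add[OF assms(2) P_minus[OF assms(1)]] by simp
  then show False using place_valuation(2)[OF pl, of "c - c'"] \<open>c \<noteq> c'\<close> P_iff by auto
qed

lemma value_at_eq: "z - \<iota> c \<in> P \<Longrightarrow> value_at \<iota> z P = c"
  unfolding value_at_def using value_unique by (intro the_equality) auto

lemma value_add: "z - \<iota> c \<in> P \<Longrightarrow> z' - \<iota> c' \<in> P \<Longrightarrow> (z + z') - \<iota> (c + c') \<in> P"
  using P_add[of "z - \<iota> c" "z' - \<iota> c'"] by (simp add: iota.hom_add algebra_simps)

lemma value_mult:
  assumes "z - \<iota> c \<in> P" "z' - \<iota> c' \<in> P" shows "z * z' - \<iota> (c * c') \<in> P"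
proof -
  have "(z - \<iota> c) * z' + (z' - \<iota> c') * \<iota> c \<in> P"
    using assms value_in_ring const_in by (intro P_add P_mult) auto
  then show ?thesis by (simp add: iota.hom_mult algebra_simps)
qed

lemma value_const: "\<iota> c - \<iota> c \<in> P"
  by (simp add: P_iff)

lemma value_nonzero:
  assumes "z - \<iota> c \<in> P" "c \<noteq> 0"
  shows "z \<noteq> 0" "valn P z = 0"
proof -
  have "z \<notin> P"
  proof
    assume "z \<in> P"
    then have "z - \<iota> 0 \<in> P" by (simp add: iota.hom_zero)
    then show False using value_unique assms by blast
  qed
  then show "z \<noteq> 0" "valn P z = 0" using value_in_ring[OF assms(1)] unfolding val_ring by (auto simp: P_iff)
qed

lemma value_inverse:
  assumes "z - \<iota> c \<in> P" "c \<noteq> 0"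
  shows "inverse z - \<iota> (inverse c) \<in> P"
proof -
  have "inverse z \<in> val_ring_of P" using value_nonzero[OF assms] v_inverse[of z] by (simp add: val_ring)
  then have "(- (z - \<iota> c)) * (inverse z * \<iota> (inverse c)) \<in> P"
    using assms const_in mult_in by (intro P_mult P_minus) auto
  also have "(- (z - \<iota> c)) * (inverse z * \<iota> (inverse c)) = inverse z - \<iota> (inverse c)"
  proof -
    have "\<iota> c * \<iota> (inverse c) = 1" using assms(2) by (simp add: iota.hom_inverse)
    then show ?thesis using value_nonzero(1)[OF assms] by (simp add: algebra_simps)
  qed
  finally show ?thesis .
qed

lemma value_divide:
  assumes "z - \<iota> c \<in> P" "z' - \<iota> c' \<in> P" "c' \<noteq> 0"
  shows "z / z' - \<iota> (c / c') \<in> P"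
  using value_mult[OF assms(1) value_inverse[OF assms(2,3)]] by (simp only: divide_inverse)

lemma value_prod:
  assumes "\<And>a. a \<in> T \<Longrightarrow> f a - \<iota> (c a) \<in> P"
  shows "prod f T - \<iota> (prod c T) \<in> P"
  using assms
proof (induction T rule: infinite_finite_induct)
  case (insert a T)
  then show ?case using value_mult by simp
qed (use value_const[of 1] in \<open>simp_all add: iota.hom_one\<close>)

section \<open>The local ring at a rational point\<close>

context
  fixes \<alpha> \<beta>
  assumes x: "x - \<iota> \<alpha> \<in> P" and w: "w - \<iota> \<beta> \<in> P"
begin

lemma value_X: "X p - \<iota> (poly p \<alpha>) \<in> P"
proof (induction p)
  case (pCons a p)
  show ?case using value_add[OF value_const value_mult[OF x pCons.IH], of a] by (simp add: X_pCons)
qed (use value_const[of 0] in simp)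

lemma value_lin: "(X A + X B * w) - \<iota> (eval_lin \<alpha> \<beta> A B) \<in> P"
  unfolding eval_lin_def by (intro value_add value_mult value_X w)

lemma on_curve_value: "on_curve \<alpha> \<beta>"
proof -
  have "w ^ 2 + X h * w - \<iota> (\<beta> * \<beta> + poly h \<alpha> * \<beta>) \<in> P"
    unfolding power2_eq_square by (intro value_add value_mult value_X w)
  moreover have "w ^ 2 + X h * w = X g" by (simp add: curve_X)
  ultimately show ?thesis using value_unique[OF value_X, of g]
    by (simp add: on_curve_def power2_eq_square)
qed

text \<open>Splitting off \<pi> lowers the valuation of A + B w until a factor not vanishing at the
  point remains; denominators are treated alike. Every valuation is then a multiple of that of
  \<pi>, and since the value 1 is attained, \<pi> has valuation 1.\<close>

lemma local_decomposition:
  shows "\<exists>\<pi>. (2 * \<beta> + poly h \<alpha> \<noteq> 0 \<longrightarrow> \<pi> = x - \<iota> \<alpha>) \<and> (\<exists>A B. \<pi> = X A + X B * w) \<and>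
    \<pi> \<noteq> 0 \<and> valn P \<pi> = 1 \<and>
    (\<forall>z. z \<noteq> 0 \<longrightarrow> (\<exists>A B C E. eval_lin \<alpha> \<beta> A B \<noteq> 0 \<and> eval_lin \<alpha> \<beta> C E \<noteq> 0 \<and>
      z * (X C + X E * w) = \<pi> powi valn P z * (X A + X B * w)))"
proof -
  note on = on_curve_value
  obtain \<pi> where \<pi>: "\<pi> = x - \<iota> \<alpha> \<or> \<pi> = w - \<iota> \<beta>" "2 * \<beta> + poly h \<alpha> \<noteq> 0 \<longrightarrow> \<pi> = x - \<iota> \<alpha>"
    and "\<forall>A B. eval_lin \<alpha> \<beta> A B = 0 \<longrightarrow> (\<exists>A' B' C E. eval_lin \<alpha> \<beta> C E \<noteq> 0 \<and>
      (X A + X B * w) * (X C + X E * w) = \<pi> * (X A' + X B' * w))"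
    using local_parameter[OF on] by (elim exE conjE)
  then have step: "\<exists>A' B' C E. eval_lin \<alpha> \<beta> C E \<noteq> 0 \<and>
      (X A + X B * w) * (X C + X E * w) = \<pi> * (X A' + X B' * w)"
    if "eval_lin \<alpha> \<beta> A B = 0" for A B using that by simp
  have "\<pi> = X [:- \<alpha>, 1:] + X 0 * w \<or> \<pi> = X [:- \<beta>:] + X 1 * w"
    using \<pi>(1) by (auto simp: X_pCons iota.hom_uminus iota.hom_one)
  then have \<pi>_lin: "\<exists>A B. \<pi> = X A + X B * w" by blast
  have \<pi>0: "\<pi> \<noteq> 0"
    using \<open>\<pi> = X [:- \<alpha>, 1:] + X 0 * w \<or> \<pi> = X [:- \<beta>:] + X 1 * w\<close> lin_eq_0_iff[of "[:- \<alpha>, 1:]" 0]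
      lin_eq_0_iff[of "[:- \<beta>:]" 1] by auto
  have "\<pi> \<in> P" using \<pi>(1) x w by auto
  then have \<pi>_pos: "valn P \<pi> > 0" using \<pi>0 by (simp add: P_iff)
  define unit where "unit u \<longleftrightarrow> (\<exists>A B. u = X A + X B * w \<and> eval_lin \<alpha> \<beta> A B \<noteq> 0)" for u
  have unit_val: "u \<noteq> 0" "valn P u = 0" if "unit u" for u
    using that value_nonzero[OF value_lin] unfolding unit_def by auto
  have unit_mult: "unit (u * v)" if uv: "unit u" "unit v" for u v
  proof -
    obtain A B A' B' where AB: "u = X A + X B * w" "v = X A' + X B' * w"
      "eval_lin \<alpha> \<beta> A B \<noteq> 0" "eval_lin \<alpha> \<beta> A' B' \<noteq> 0" using uv unfolding unit_def by auto
    have "u * v = X (A * A' + g * B * B') + X (A * B' + B * A' - h * B * B') * w"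
      unfolding AB(1,2) by (rule lin_mult)
    moreover have "eval_lin \<alpha> \<beta> (A * A' + g * B * B') (A * B' + B * A' - h * B * B') \<noteq> 0"
      unfolding eval_lin_mult[OF on] using AB by simp
    ultimately show ?thesis unfolding unit_def by blast
  qed
  have decomp: "\<exists>m c a. unit c \<and> unit a \<and> (X A + X B * w) * c = \<pi> ^ m * a"
    if "X A + X B * w \<noteq> 0" for A B
    using that
  proof (induction "nat (valn P (X A + X B * w))" arbitrary: A B rule: less_induct)
    case less
    show ?case
    proof (cases "eval_lin \<alpha> \<beta> A B = 0")
      case False
      have "unit 1" unfolding unit_def by (rule exI[of _ 1], rule exI[of _ 0]) (simp add: eval_lin_def)
      moreover have "unit (X A + X B * w)" using False unfolding unit_def by blast
      ultimately show ?thesis by (intro exI[of _ 0] exI[of _ 1] exI[of _ "X A + X B * w"]) simp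
    next
      case True
      obtain A' B' c where c: "unit c" and eq: "(X A + X B * w) * c = \<pi> * (X A' + X B' * w)"
        using step[OF True] unfolding unit_def by metis
      have nz: "X A' + X B' * w \<noteq> 0" using eq unit_val[OF c] less.prems \<pi>0 by auto
      then have "valn P (X A + X B * w) = valn P \<pi> + valn P (X A' + X B' * w)"
        using arg_cong[OF eq, of "valn P"] less.prems \<pi>0 unit_val[OF c] by (simp add: v_mult)
      moreover have "0 \<le> valn P (X A' + X B' * w)"
        using value_in_ring[OF value_lin, of A' B'] nz by (simp add: val_ring)
      ultimately have "nat (valn P (X A' + X B' * w)) < nat (valn P (X A + X B * w))" using \<pi>_pos by simp
      then obtain m c' a where ca: "unit c'" "unit a" "(X A' + X B' * w) * c' = \<pi> ^ m * a"
        using less.hyps nz by blast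
      have "(X A + X B * w) * (c * c') = \<pi> * ((X A' + X B' * w) * c')"
        unfolding mult.assoc[symmetric] eq ..
      also have "\<dots> = \<pi> ^ Suc m * a" unfolding ca by simp
      finally show ?thesis using unit_mult[OF c ca(1)] ca(2) by blast
    qed
  qed
  have decomp': "\<exists>m c a. unit c \<and> unit a \<and> z * c = \<pi> powi m * a" if "z \<noteq> 0" for z
  proof -
    obtain A B C where C: "C \<noteq> 0" and z: "z = (X A + X B * w) / X C" by (rule representation)
    have "X A + X B * w \<noteq> 0" using z that by auto
    then obtain m c a where 1: "unit c" "unit a" "(X A + X B * w) * c = \<pi> ^ m * a" using decomp by blast
    have "X C + X 0 * w \<noteq> 0" using C by simp
    then obtain m' c' a' where 2: "unit c'" "unit a'" "(X C + X 0 * w) * c' = \<pi> ^ m' * a'"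
      using decomp by blast
    have u: "X A + X B * w = \<pi> ^ m * a / c" using 1 unit_val[OF 1(1)] by (simp add: field_simps)
    have v: "X C = \<pi> ^ m' * a' / c'" using 2 unit_val[OF 2(1)] by (simp add: field_simps)
    have "z * (c * a') = \<pi> powi (int m - int m') * (a * c')"
      unfolding z u v using \<pi>0 unit_val[OF 1(1)] unit_val[OF 2(1)] unit_val[OF 2(2)]
      by (simp add: power_int_diff field_simps)
    then show ?thesis using unit_mult[OF 1(1) 2(2)] unit_mult[OF 1(2) 2(1)] by blast
  qed
  have valn: "valn P z = m * valn P \<pi>" if "z \<noteq> 0" "unit c" "unit a" "z * c = \<pi> powi m * a" for z m c a
    using arg_cong[OF that(4), of "valn P"] that(1) \<pi>0 unit_val[OF that(2)] unit_val[OF that(3)]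
    by (simp add: v_mult v_powi)
  obtain s where s: "s \<noteq> 0" "valn P s = 1" using v_surj by auto
  obtain m c a where "unit c" "unit a" "s * c = \<pi> powi m * a" using decomp'[OF s(1)] by blast
  then have "m * valn P \<pi> = 1" using valn[of s c a m] s by simp
  then have \<pi>1: "valn P \<pi> = 1" using \<pi>_pos by (auto simp: zmult_eq_1_iff)
  have "\<exists>A B C E. eval_lin \<alpha> \<beta> A B \<noteq> 0 \<and> eval_lin \<alpha> \<beta> C E \<noteq> 0 \<and>
      z * (X C + X E * w) = \<pi> powi valn P z * (X A + X B * w)" if "z \<noteq> 0" for z
  proof -
    obtain m c a where d: "unit c" "unit a" "z * c = \<pi> powi m * a"
      using decomp'[OF \<open>z \<noteq> 0\<close>] by blast
    then have "m = valn P z" using valn[OF that d] \<pi>1 by simp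
    then show ?thesis using d unfolding unit_def by blast
  qed
  then show ?thesis using \<pi>(2) \<pi>_lin \<pi>0 \<pi>1 by (intro exI[of _ \<pi>]) simp
qed

text \<open>The right-hand side depends on \<alpha> and \<beta> alone: it is the localisation of
  K[x, w] at the point. Hence a place is determined by its point.\<close>

lemma val_ring_local:
  "z \<in> val_ring_of P \<longleftrightarrow>
    (\<exists>A B C E. eval_lin \<alpha> \<beta> C E \<noteq> 0 \<and> z * (X C + X E * w) = X A + X B * w)"
proof
  assume z: "z \<in> val_ring_of P"
  show "\<exists>A B C E. eval_lin \<alpha> \<beta> C E \<noteq> 0 \<and> z * (X C + X E * w) = X A + X B * w"
  proof (cases "z = 0")
    case True
    then show ?thesis
      by (intro exI[of _ 0] exI[of _ 0] exI[of _ 1] exI[of _ 0]) (simp add: eval_lin_def)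
  next
    case False
    obtain \<pi> where \<pi>: "\<exists>A B. \<pi> = X A + X B * w"
      and dec: "\<forall>z. z \<noteq> 0 \<longrightarrow> (\<exists>A B C E. eval_lin \<alpha> \<beta> A B \<noteq> 0 \<and> eval_lin \<alpha> \<beta> C E \<noteq> 0 \<and>
      z * (X C + X E * w) = \<pi> powi valn P z * (X A + X B * w))"
      using local_decomposition by blast
    obtain A B C E where CE: "eval_lin \<alpha> \<beta> C E \<noteq> 0"
      and eq: "z * (X C + X E * w) = \<pi> powi valn P z * (X A + X B * w)"
      using dec[rule_format, OF False] by (elim exE conjE)
    have lin_mult_ex: "\<exists>A B. u * v = X A + X B * w"
      if "\<exists>A B. u = X A + X B * w" "\<exists>A B. v = X A + X B * w" for u v
      using that lin_mult by metis
    have pow: "\<exists>A' B'. \<pi> ^ n * (X A + X B * w) = X A' + X B' * w" for n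
    proof (induction n)
      case (Suc n)
      then show ?case using lin_mult_ex[OF \<pi> Suc] by (simp add: mult.assoc)
    qed auto
    have "0 \<le> valn P z" using z False by (simp add: val_ring)
    then have "\<pi> powi valn P z = \<pi> ^ nat (valn P z)" by (simp add: power_int_def)
    then show ?thesis using pow eq CE by metis
  qed
next
  assume "\<exists>A B C E. eval_lin \<alpha> \<beta> C E \<noteq> 0 \<and> z * (X C + X E * w) = X A + X B * w"
  then obtain A B C E where CE: "eval_lin \<alpha> \<beta> C E \<noteq> 0" and z: "z * (X C + X E * w) = X A + X B * w"
    by blast
  have "z = (X A + X B * w) / (X C + X E * w)"
    using z value_nonzero(1)[OF value_lin CE] by (simp add: field_simps)
  then show "z \<in> val_ring_of P"
    using value_in_ring[OF value_divide[OF value_lin value_lin CE]] by simp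
qed

lemma prime_x:
  assumes "2 * \<beta> + poly h \<alpha> \<noteq> 0"
  shows "x - \<iota> \<alpha> \<noteq> 0" "valn P (x - \<iota> \<alpha>) = 1"
proof -
  obtain \<pi> where "\<pi> = x - \<iota> \<alpha>" "\<pi> \<noteq> 0" "valn P \<pi> = 1"
    using local_decomposition assms by blast
  then show "x - \<iota> \<alpha> \<noteq> 0" "valn P (x - \<iota> \<alpha>) = 1" by simp_all
qed

text \<open>At an unramified point 2w + h is a unit, so dw/dx is regular, and the quotient rule
  keeps d/dx inside the local ring.\<close>

lemma ddx_in_ring:
  assumes unram: "2 * \<beta> + poly h \<alpha> \<noteq> 0" and z: "z \<in> val_ring_of P"
  shows "ddx z \<in> val_ring_of P"
proof -
  note D = is_derivation_simps[OF is_derivation_ddx]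
  have e: "(X (pderiv g) - X (pderiv h) * w) / (2 * w + X h) \<in> val_ring_of P"
  proof -
    have "(X (pderiv g) + X (- pderiv h) * w) / (X h + X 2 * w)
        - \<iota> (eval_lin \<alpha> \<beta> (pderiv g) (- pderiv h) / eval_lin \<alpha> \<beta> h 2) \<in> P"
      by (rule value_divide[OF value_lin value_lin]) (use unram in \<open>simp add: eval_lin_def add.commute\<close>)
    from value_in_ring[OF this] show ?thesis by (simp add: add.commute)
  qed
  have lin: "ddx (X A + X B * w) \<in> val_ring_of P" for A B
    unfolding ddx_lin lin_deriv_def
    by (intro add_in mult_in e value_in_ring[OF value_X] value_in_ring[OF w])
  obtain A B C E where CE: "eval_lin \<alpha> \<beta> C E \<noteq> 0" and eq: "z * (X C + X E * w) = X A + X B * w"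
    using z unfolding val_ring_local by blast
  define c where "c = X C + X E * w"
  have c: "c \<noteq> 0" "inverse c \<in> val_ring_of P"
    unfolding c_def using value_nonzero(1)[OF value_lin CE] value_in_ring[OF value_inverse[OF value_lin CE]] by auto
  have "z * ddx c + c * ddx z = ddx (X A + X B * w)" using D(2)[of z c] eq by (simp add: c_def)
  then have "ddx z = (ddx (X A + X B * w) - z * ddx c) * inverse c" using c by (simp add: field_simps)
  then show ?thesis using c z lin unfolding c_def by (auto intro!: mult_in diff_in)
qed

end

text \<open>Write the chosen prime element as s = (x - \<alpha>) u with \<open>u\<close> of value
  \<open>c\<close>. Then ds/dx = u + (x - \<alpha>) du/dx also has value \<open>c\<close>, so
  \<open>c\<close> cancels in s times the coefficient of ds, and the result does not depend on the
  choice of \<open>s\<close>.\<close>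

lemma residue_simple_pole:
  assumes rational: "rational_place \<iota> P" and x: "x - \<iota> \<alpha> \<in> P" and w: "w - \<iota> \<beta> \<in> P"
    and unram: "2 * \<beta> + poly h \<alpha> \<noteq> 0" and T: "finite T" "\<alpha> \<in> T"
  shows "residue_at \<iota> P (differential (1 / (\<Prod>a\<in>T. x - \<iota> a)) x) = 1 / (\<Prod>a\<in>T - {\<alpha>}. \<alpha> - a)"
proof -
  note D = is_derivation_simps[OF is_derivation_ddx]
  define s where "s = (SOME s. prime_element_at P s)"
  have "prime_element_at P s" unfolding s_def by (rule someI_ex[OF prime_element_exists])
  then have s: "s \<noteq> 0" "valn P s = 1" by (simp_all add: prime_element_iff)
  define t where "t = x - \<iota> \<alpha>"
  have t: "t \<noteq> 0" "valn P t = 1" unfolding t_def by (rule prime_x[OF x w unram])+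
  define u where "u = s / t"
  have su: "s = t * u" using t by (simp add: u_def)
  have u: "u \<noteq> 0" "valn P u = 0" using s t by (simp_all add: u_def v_divide)
  then have uR: "u \<in> val_ring_of P" by (simp add: val_ring)
  then obtain c where c: "u - \<iota> c \<in> P" using rational by (auto simp: rational_place_def)
  have c0: "c \<noteq> 0"
  proof
    assume "c = 0"
    then have "u \<in> P" using c by (simp add: iota.hom_zero)
    then show False using u by (simp add: P_iff)
  qed
  have Dt: "ddx t = 1" by (simp add: t_def D ddx_x)
  have Ds: "ddx s = u + t * ddx u" by (simp add: su D Dt)
  have tP: "t - \<iota> 0 \<in> P" using x by (simp add: t_def iota.hom_zero)
  have "t * ddx u \<in> P" using P_mult[OF x ddx_in_ring[OF x w unram uR]] by (simp add: t_def)
  then have "t * ddx u - \<iota> 0 \<in> P" by (simp add: iota.hom_zero)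
  then have vDs: "ddx s - \<iota> c \<in> P" unfolding Ds using value_add[OF c] by fastforce
  have Ds0: "ddx s \<noteq> 0" by (rule value_nonzero(1)[OF vDs c0])
  define t' where "t' = (\<Prod>a\<in>T - {\<alpha>}. x - \<iota> a)"
  define p where "p = (\<Prod>a\<in>T - {\<alpha>}. \<alpha> - a)"
  have prod: "(\<Prod>a\<in>T. x - \<iota> a) = t * t'" unfolding t_def t'_def by (rule prod.remove[OF T])
  have vt': "t' - \<iota> p \<in> P"
    unfolding t'_def p_def
  proof (rule value_prod)
    show "x - \<iota> a - \<iota> (\<alpha> - a) \<in> P" for a using x by (simp add: iota.hom_minus algebra_simps)
  qed
  have p0: "p \<noteq> 0" using T by (simp add: p_def)
  have t'0: "t' \<noteq> 0" by (rule value_nonzero(1)[OF vt' p0])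
  define z where "z = differential (1 / (\<Prod>a\<in>T. x - \<iota> a)) x (deriv_wrt \<iota> s)"
  have "z = 1 / (t * t') * (1 / ddx s)"
    unfolding z_def differential_def prod deriv_wrt_eq[OF Ds0] ddx_x ..
  then have "z * s = u / (t' * ddx s)" using t by (simp add: su)
  moreover have "u / (t' * ddx s) - \<iota> (c / (p * c)) \<in> P"
    using c0 p0 by (intro value_divide value_mult c vt' vDs) simp
  ultimately have zs: "z * s - \<iota> (1 / p) \<in> P" using c0 by simp
  have "z * s - \<iota> (fls_residue (laurent_expansion_at \<iota> P s z)) \<in> P"
    by (rule fls_residue_laurent_expansion[OF discrete_valuation_axioms hom _ _ s value_in_ring[OF zs]])
      (use place_valuation(2)[OF pl] rational in \<open>auto simp: rational_place_def\<close>)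
  then have "fls_residue (laurent_expansion_at \<iota> P s z) = 1 / p" using value_unique zs by blast
  then show ?thesis by (simp add: residue_at_def Let_def z_def s_def p_def)
qed

end

lemma place_determined:
  assumes P: "is_place \<iota> P" "x - \<iota> \<alpha> \<in> P" "w - \<iota> \<beta> \<in> P"
    and P': "is_place \<iota> P'" "x - \<iota> \<alpha> \<in> P'" "w - \<iota> \<beta> \<in> P'"
  shows "P = P'"
proof -
  have "val_ring_of P = val_ring_of P'"
    using val_ring_local[OF P] val_ring_local[OF P'] by blast
  then show ?thesis using place_valuation(4)[OF P(1)] place_valuation(4)[OF P'(1)] by simp
qed

lemma rational_place_value_w:
  assumes P: "P \<in> rational_places_over \<iota> x \<alpha>"
  obtains \<beta> where "w - \<iota> \<beta> \<in> P"
proof -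
  have pl: "is_place \<iota> P" and x: "x - \<iota> \<alpha> \<in> P"
    using P by (auto simp: rational_places_over_def rational_place_def)
  have "w \<in> val_ring_of P"
    by (rule w_in[OF place_valuation(3)[OF pl] value_in_ring[OF pl x]])
  then show thesis using P that by (auto simp: rational_places_over_def rational_place_def)
qed

text \<open>Distinct places over \<alpha> have distinct values of \<open>w\<close>, since a place is
  determined by its point. Subtracting the two curve equations and cancelling \<beta>1 - \<beta>2
  gives the sum of the values.\<close>

theorem split_places:
  assumes "splits_completely \<iota> x \<alpha>"
  obtains P1 P2 \<beta>1 \<beta>2 where "rational_places_over \<iota> x \<alpha> = {P1, P2}" "P1 \<noteq> P2"
    "w - \<iota> \<beta>1 \<in> P1" "w - \<iota> \<beta>2 \<in> P2" "\<beta>1 \<noteq> \<beta>2" "\<beta>1 + \<beta>2 = - poly h \<alpha>"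
proof -
  obtain P1 P2 where P12: "rational_places_over \<iota> x \<alpha> = {P1, P2}" "P1 \<noteq> P2"
    using assms by (auto simp: splits_completely_def card_2_iff)
  have P1: "P1 \<in> rational_places_over \<iota> x \<alpha>" and P2: "P2 \<in> rational_places_over \<iota> x \<alpha>"
    using P12 by auto
  obtain \<beta>1 where \<beta>1: "w - \<iota> \<beta>1 \<in> P1" by (rule rational_place_value_w[OF P1])
  obtain \<beta>2 where \<beta>2: "w - \<iota> \<beta>2 \<in> P2" by (rule rational_place_value_w[OF P2])
  have pl: "is_place \<iota> P1" "x - \<iota> \<alpha> \<in> P1" "is_place \<iota> P2" "x - \<iota> \<alpha> \<in> P2"
    using P1 P2 by (auto simp: rational_places_over_def rational_place_def)
  have ne: "\<beta>1 \<noteq> \<beta>2" using place_determined[OF pl(1,2) \<beta>1 pl(3,4)] \<beta>2 P12 by auto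
  have "on_curve \<alpha> \<beta>1" "on_curve \<alpha> \<beta>2"
    using on_curve_value[OF pl(1,2) \<beta>1] on_curve_value[OF pl(3,4) \<beta>2] by auto
  then have "(\<beta>1 - \<beta>2) * (\<beta>1 + \<beta>2 + poly h \<alpha>) = 0"
    by (simp add: on_curve_def algebra_simps power2_eq_square)
  then have "\<beta>1 + \<beta>2 = - poly h \<alpha>" using ne by (simp add: eq_neg_iff_add_eq_0)
  then show thesis using that P12 \<beta>1 \<beta>2 ne by blast
qed

end

section \<open>Linear algebra of evaluation vectors\<close>

text \<open>Passes from coefficients indexed by list positions to linear combinations indexed by
  vectors.\<close>

lemma basis_of_independent_list:
  fixes vs :: "'a::field vec list" and n :: nat
  assumes carr: "set vs \<subseteq> carrier_vec n"
    and C: "C = {vec n (\<lambda>i. \<Sum>j<length vs. c j * (vs ! j) $ i) | c. True}"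
    and indep: "\<And>c. (\<forall>i<n. (\<Sum>j<length vs. c j * (vs ! j) $ i) = 0) \<Longrightarrow> \<forall>j<length vs. c j = 0"
  shows "distinct vs" "subspace class_ring C (module_vec TYPE('a) n)"
    "vectorspace.basis class_ring (module_vec TYPE('a) n \<lparr>carrier := C\<rparr>) (set vs)"
    "vectorspace.dim class_ring (module_vec TYPE('a) n \<lparr>carrier := C\<rparr>) = length vs"
proof -
  interpret vec_space "TYPE('a)" n .
  show dist: "distinct vs"
    unfolding distinct_conv_nth
  proof (intro allI impI notI)
    fix i j assume ij: "i < length vs" "j < length vs" "i \<noteq> j" "vs ! i = vs ! j"
    \<comment> \<open>A repeated vector would give the nontrivial relation with coefficients 1 at
      \<open>i\<close> and -1 at \<open>j\<close>.\<close>
    define c where "c l = (if l = i then 1 else 0) - (if l = j then 1 else (0 :: 'a))" for l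
    have "(\<Sum>l<length vs. c l * (vs ! l) $ e) = (vs ! i) $ e - (vs ! j) $ e" for e
      using ij(1,2) by (simp add: c_def left_diff_distrib sum_subtractf if_distrib[of "\<lambda>x. x * _"] cong: if_cong)
    then have "\<forall>e<n. (\<Sum>l<length vs. c l * (vs ! l) $ e) = 0" using ij by simp
    then have "c i = 0" using indep ij by blast
    then show False using ij by (simp add: c_def)
  qed
  have bij: "bij_betw (\<lambda>j. vs ! j) {..<length vs} (set vs)"
    by (rule bij_betw_nth[OF dist]) auto
  have lc: "lincomb a (set vs) = vec n (\<lambda>i. \<Sum>j<length vs. a (vs ! j) * (vs ! j) $ i)" for a
  proof
    have dim: "dim_vec (lincomb a (set vs)) = n" using carr by (simp add: lincomb_dim)
    then show "dim_vec (lincomb a (set vs)) = dim_vec (vec n (\<lambda>i. \<Sum>j<length vs. a (vs ! j) * (vs ! j) $ i))"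
      by simp
    fix i assume "i < dim_vec (vec n (\<lambda>i. \<Sum>j<length vs. a (vs ! j) * (vs ! j) $ i))"
    then have i: "i < n" by simp
    have "lincomb a (set vs) $ i = (\<Sum>x\<in>set vs. a x * x $ i)" by (rule lincomb_index[OF i carr])
    also have "\<dots> = (\<Sum>j<length vs. a (vs ! j) * (vs ! j) $ i)"
      by (rule sum.reindex_bij_betw[OF bij, symmetric])
    finally show "lincomb a (set vs) $ i = vec n (\<lambda>i. \<Sum>j<length vs. a (vs ! j) * (vs ! j) $ i) $ i"
      using i by simp
  qed
  have span: "span (set vs) = C"
  proof (intro equalityI subsetI)
    fix z assume "z \<in> span (set vs)"
    then obtain a where "z = lincomb a (set vs)"
      using finite_span[OF finite_set carr] by auto
    then show "z \<in> C" unfolding C lc by (intro CollectI exI[of _ "\<lambda>j. a (vs ! j)"]) simp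
  next
    fix z assume "z \<in> C"
    then obtain c where z: "z = vec n (\<lambda>i. \<Sum>j<length vs. c j * (vs ! j) $ i)" unfolding C by auto
    define a where "a = (\<lambda>x. c (inv_into {..<length vs} (\<lambda>j. vs ! j) x))"
    have "a (vs ! j) = c j" if "j < length vs" for j
      using bij_betw_inv_into_left[OF bij] that by (simp add: a_def)
    then have "z = lincomb a (set vs)" unfolding z lc by (intro eq_vecI) simp_all
    then show "z \<in> span (set vs)" using finite_span[OF finite_set carr] by auto
  qed
  have "submodule class_ring (span (set vs)) V" by (rule span_is_submodule[OF carr])
  then have subm: "submodule class_ring C V" unfolding span .
  then show sub: "subspace class_ring C V"
    unfolding subspace_def using vec_vs by blast
  have li: "lin_indpt (set vs)"
  proof (rule finite_lin_indpt2[OF finite_set carr])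
    fix a :: "'a vec \<Rightarrow> 'a" assume "lincomb a (set vs) = 0\<^sub>v n"
    then have "vec n (\<lambda>i. \<Sum>j<length vs. a (vs ! j) * (vs ! j) $ i) = 0\<^sub>v n" unfolding lc .
    then have eq: "vec n (\<lambda>i. \<Sum>j<length vs. a (vs ! j) * (vs ! j) $ i) $ i = 0\<^sub>v n $ i" for i
      by (rule arg_cong)
    have "(\<Sum>j<length vs. a (vs ! j) * (vs ! j) $ i) = 0" if "i < n" for i using eq[of i] that by simp
    then have "\<forall>i<n. (\<Sum>j<length vs. a (vs ! j) * (vs ! j) $ i) = 0" by blast
    then have "\<forall>j<length vs. a (vs ! j) = 0" by (rule indep)
    then show "\<forall>v\<in>set vs. a v = 0" using in_set_conv_nth[of _ vs] by metis
  qed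
  interpret W: vectorspace class_ring "V\<lparr>carrier := C\<rparr>" by (rule subspace_is_vs[OF sub])
  have inC: "set vs \<subseteq> C" using span_mem[OF carr] span by auto
  show basis: "W.basis (set vs)"
    unfolding W.basis_def span_li_not_depend[OF inC subm] span
    using li inC by simp
  show "W.dim = length vs"
    using W.dim_basis[OF finite_set basis] distinct_card[OF dist] by simp
qed

text \<open>Stated through coefficients so that \<open>deg_less p 0\<close> means p = 0. This is the
  bound on \<open>B\<close> in the dual when the second family of rows is empty, and a bound on
  \<open>degree\<close> could not express it.\<close>

definition deg_less :: "'a::zero poly \<Rightarrow> nat \<Rightarrow> bool" where
  "deg_less p m \<longleftrightarrow> (\<forall>j\<ge>m. coeff p j = 0)"

lemma deg_less_iff: "deg_less p m \<longleftrightarrow> p = 0 \<or> degree p < m"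
proof
  assume d: "deg_less p m"
  show "p = 0 \<or> degree p < m"
  proof (rule ccontr)
    assume n: "\<not> (p = 0 \<or> degree p < m)"
    then have "lead_coeff p = 0" using d unfolding deg_less_def by auto
    then show False using n by simp
  qed
qed (auto simp: deg_less_def coeff_eq_0)

lemma deg_less_mult:
  fixes p q :: "'a::idom poly"
  assumes "deg_less p m" "deg_less q l"
  shows "deg_less (p * q) (m + l - 1)"
  using assms unfolding deg_less_iff by (cases "p = 0 \<or> q = 0") (auto simp: degree_mult_eq)

lemma deg_less_add: "deg_less p m \<Longrightarrow> deg_less q m \<Longrightarrow> deg_less (p + q) m"
  and deg_less_diff: "deg_less p' m \<Longrightarrow> deg_less q' m \<Longrightarrow> deg_less (p' - q') m"
  and deg_less_mono: "deg_less p m \<Longrightarrow> m \<le> l \<Longrightarrow> deg_less p l"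
  by (auto simp: deg_less_def)

lemma deg_less_monom: "i < m \<Longrightarrow> deg_less (monom c i) m"
  by (auto simp: deg_less_def)

lemma deg_less_roots:
  fixes p :: "'a::idom poly"
  assumes "deg_less p m" "finite T" "m \<le> card T" "\<And>a. a \<in> T \<Longrightarrow> poly p a = 0"
  shows "p = 0"
proof (rule ccontr)
  assume p: "p \<noteq> 0"
  then have "card T \<le> card {a. poly p a = 0}"
    using assms(4) poly_roots_finite[OF p] by (intro card_mono) auto
  also have "\<dots> \<le> degree p" by (rule card_poly_roots_bound[OF p])
  finally show False using assms p by (auto simp: deg_less_iff)
qed

definition lower_poly :: "(nat \<Rightarrow> 'a::comm_ring_1) \<Rightarrow> nat \<Rightarrow> 'a poly" where
  "lower_poly c m = (\<Sum>j<m. monom (c j) j)"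

lemma coeff_lower_poly: "coeff (lower_poly c m) j = (if j < m then c j else 0)"
  by (simp add: lower_poly_def coeff_sum)

lemma deg_less_lower_poly: "deg_less (lower_poly c m) m"
  by (simp add: deg_less_def coeff_lower_poly)

lemma poly_lower_poly: "poly (lower_poly c m) a = (\<Sum>j<m. c j * a ^ j)"
  by (simp add: lower_poly_def poly_sum poly_monom)

lemma lower_poly_coeff: "deg_less p m \<Longrightarrow> lower_poly (coeff p) m = p"
  by (rule poly_eqI) (auto simp: coeff_lower_poly deg_less_def)

lemma sum_lessThan_add: "(\<Sum>j<p + r. f j) = (\<Sum>j<p. f j) + (\<Sum>j<r. f (p + j))"
  for f :: "nat \<Rightarrow> 'a::comm_monoid_add"
  by (induction r) (simp_all add: add.assoc)

text \<open>A coefficient family of length p + r splits into the polynomials \<open>A\<close> and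
  \<open>B\<close>, so independence of the rows becomes injectivity of evaluating u A + v B at the
  points.\<close>

lemma basis_of_evaluations:
  fixes u v \<alpha> :: "nat \<Rightarrow> 'a::field" and n p r :: nat
  defines "vs \<equiv> map (\<lambda>j. vec n (\<lambda>i. u i * \<alpha> i ^ j)) [0..<p] @ map (\<lambda>j. vec n (\<lambda>i. v i * \<alpha> i ^ j)) [0..<r]"
  assumes C: "C = {vec n (\<lambda>i. u i * poly A (\<alpha> i) + v i * poly B (\<alpha> i)) | A B. deg_less A p \<and> deg_less B r}"
    and indep: "\<And>A B. deg_less A p \<Longrightarrow> deg_less B r \<Longrightarrow>
      \<forall>i<n. u i * poly A (\<alpha> i) + v i * poly B (\<alpha> i) = 0 \<Longrightarrow> A = 0 \<and> B = 0"
  shows "distinct vs" "subspace class_ring C (module_vec TYPE('a) n)"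
    "vectorspace.basis class_ring (module_vec TYPE('a) n \<lparr>carrier := C\<rparr>) (set vs)"
    "vectorspace.dim class_ring (module_vec TYPE('a) n \<lparr>carrier := C\<rparr>) = p + r"
proof -
  have len: "length vs = p + r" by (simp add: vs_def)
  have sum: "(\<Sum>j<length vs. c j * (vs ! j) $ i)
      = u i * poly (lower_poly c p) (\<alpha> i) + v i * poly (lower_poly (\<lambda>j. c (p + j)) r) (\<alpha> i)"
    if "i < n" for c i
  proof -
    have "(\<Sum>j<p. c j * (vs ! j) $ i) = u i * poly (lower_poly c p) (\<alpha> i)"
      unfolding poly_lower_poly sum_distrib_left
      using that by (intro sum.cong) (auto simp: vs_def nth_append)
    moreover have "(\<Sum>j<r. c (p + j) * (vs ! (p + j)) $ i) = v i * poly (lower_poly (\<lambda>j. c (p + j)) r) (\<alpha> i)"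
      unfolding poly_lower_poly sum_distrib_left
      using that by (intro sum.cong) (auto simp: vs_def nth_append)
    ultimately show ?thesis by (simp add: len sum_lessThan_add)
  qed
  have carr: "set vs \<subseteq> carrier_vec n" by (auto simp: vs_def)
  have C': "C = {vec n (\<lambda>i. \<Sum>j<length vs. c j * (vs ! j) $ i) | c. True}"
  proof (intro equalityI subsetI)
    fix z assume "z \<in> C"
    then obtain A B where AB: "deg_less A p" "deg_less B r"
      and z: "z = vec n (\<lambda>i. u i * poly A (\<alpha> i) + v i * poly B (\<alpha> i))" unfolding C by auto
    define c where "c j = (if j < p then coeff A j else coeff B (j - p))" for j
    have "lower_poly c p = A" "lower_poly (\<lambda>j. c (p + j)) r = B"
      using lower_poly_coeff[OF AB(1)] lower_poly_coeff[OF AB(2)] by (simp_all add: lower_poly_def c_def)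
    then have "z = vec n (\<lambda>i. \<Sum>j<length vs. c j * (vs ! j) $ i)"
      unfolding z by (intro eq_vecI) (simp_all add: sum)
    then show "z \<in> {vec n (\<lambda>i. \<Sum>j<length vs. c j * (vs ! j) $ i) | c. True}" by blast
  next
    fix z assume "z \<in> {vec n (\<lambda>i. \<Sum>j<length vs. c j * (vs ! j) $ i) | c. True}"
    then obtain c where z: "z = vec n (\<lambda>i. \<Sum>j<length vs. c j * (vs ! j) $ i)" by auto
    have "z = vec n (\<lambda>i. u i * poly (lower_poly c p) (\<alpha> i) + v i * poly (lower_poly (\<lambda>j. c (p + j)) r) (\<alpha> i))"
      unfolding z by (intro eq_vecI) (simp_all add: sum)
    then show "z \<in> C" unfolding C using deg_less_lower_poly by blast
  qed
  have ind: "\<forall>j<length vs. c j = 0" if c: "\<forall>i<n. (\<Sum>j<length vs. c j * (vs ! j) $ i) = 0" for c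
  proof -
    have "lower_poly c p = 0 \<and> lower_poly (\<lambda>j. c (p + j)) r = 0"
      by (rule indep[OF deg_less_lower_poly deg_less_lower_poly]) (use c sum in simp)
    then have "coeff (lower_poly c p) j = 0" "coeff (lower_poly (\<lambda>j. c (p + j)) r) j = 0" for j by simp_all
    then have *: "j < p \<Longrightarrow> c j = 0" "j < r \<Longrightarrow> c (p + j) = 0" for j
      unfolding coeff_lower_poly by metis+
    show ?thesis
    proof (intro allI impI)
      fix j assume j: "j < length vs"
      show "c j = 0"
        using *(1)[of j] *(2)[of "j - p"] j len by (cases "j < p") auto
    qed
  qed
  note result = basis_of_independent_list[OF carr C' ind]
  show "distinct vs" "subspace class_ring C (module_vec TYPE('a) n)"
    "vectorspace.basis class_ring (module_vec TYPE('a) n \<lparr>carrier := C\<rparr>) (set vs)"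
    "vectorspace.dim class_ring (module_vec TYPE('a) n \<lparr>carrier := C\<rparr>) = p + r"
    using result len by simp_all
qed

section \<open>Lagrange interpolation\<close>

text \<open>For \<open>a\<close> in \<open>T\<close> this is t'(a) with t the product of the x - b;
  its inverse is the residue of dx/t at \<open>a\<close>.\<close>

definition node_weight :: "'a::field set \<Rightarrow> 'a \<Rightarrow> 'a" where
  "node_weight T a = (\<Prod>b\<in>T - {a}. a - b)"

lemma node_weight_nonzero: "finite T \<Longrightarrow> node_weight T a \<noteq> 0"
  by (auto simp: node_weight_def)

definition interpolation :: "'a::field set \<Rightarrow> ('a \<Rightarrow> 'a) \<Rightarrow> 'a poly" where
  "interpolation T f = (\<Sum>a\<in>T. Polynomial.smult (f a / node_weight T a) (\<Prod>b\<in>T - {a}. [:- b, 1:]))"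

lemma degree_prod_linear: "finite S \<Longrightarrow> degree (\<Prod>b\<in>S. [:- b, 1 :: 'a::field:]) = card S"
  by (subst degree_prod_eq_sum_degree) auto

lemma coeff_prod_linear: "finite S \<Longrightarrow> coeff (\<Prod>b\<in>S. [:- b, 1 :: 'a::field:]) (card S) = 1"
  using lead_coeff_prod[of "\<lambda>b. [:- b, 1 :: 'a:]" S] degree_prod_linear[of S] by simp

lemma
  fixes T :: "'a::field set"
  assumes T: "finite T"
  shows deg_less_interpolation: "deg_less (interpolation T f) (card T)"
    and poly_interpolation: "a \<in> T \<Longrightarrow> poly (interpolation T f) a = f a"
    and coeff_interpolation: "coeff (interpolation T f) (card T - 1) = (\<Sum>a\<in>T. f a / node_weight T a)"
proof -
  show "deg_less (interpolation T f) (card T)"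
    unfolding deg_less_def
  proof (intro allI impI)
    fix j assume j: "card T \<le> j"
    have "coeff (\<Prod>b\<in>T - {a}. [:- b, 1:]) j = 0" if a: "a \<in> T" for a
    proof (rule coeff_eq_0)
      have "card (T - {a}) < card T" using a T by (intro psubset_card_mono) auto
      then show "degree (\<Prod>b\<in>T - {a}. [:- b, 1:]) < j" using j T by (simp add: degree_prod_linear)
    qed
    then show "coeff (interpolation T f) j = 0" by (simp add: interpolation_def coeff_sum)
  qed
  show "poly (interpolation T f) a = f a" if a: "a \<in> T" for a
  proof -
    have "poly (interpolation T f) a = (\<Sum>c\<in>T. f c / node_weight T c * (\<Prod>b\<in>T - {c}. a - b))"
      by (simp add: interpolation_def poly_sum poly_prod)
    also have "\<dots> = (\<Sum>c\<in>T. if c = a then f a else 0)"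
    proof (rule sum.cong[OF refl])
      fix c assume "c \<in> T"
      show "f c / node_weight T c * (\<Prod>b\<in>T - {c}. a - b) = (if c = a then f a else 0)"
      proof (cases "c = a")
        case True
        then show ?thesis using node_weight_nonzero[OF T, of a] by (simp add: node_weight_def)
      next
        case False
        then have "(\<Prod>b\<in>T - {c}. a - b) = 0" using T a by (auto simp: prod_zero_iff)
        then show ?thesis using False by simp
      qed
    qed
    finally show ?thesis using T a by simp
  qed
  show "coeff (interpolation T f) (card T - 1) = (\<Sum>a\<in>T. f a / node_weight T a)"
    unfolding interpolation_def coeff_sum
  proof (rule sum.cong[OF refl])
    fix a assume a: "a \<in> T"
    have "card T - 1 = card (T - {a})" using a T by simp
    then show "coeff (Polynomial.smult (f a / node_weight T a) (\<Prod>b\<in>T - {a}. [:- b, 1:])) (card T - 1)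
        = f a / node_weight T a" using coeff_prod_linear[of "T - {a}"] T by simp
  qed
qed

text \<open>A polynomial of degree below \<open>card T\<close> is its own interpolation polynomial,
  and the Lagrange products are monic of degree card T - 1 before division by the weights.\<close>

lemma sum_over_nodes:
  fixes p :: "'a::field poly"
  assumes T: "finite T" and p: "deg_less p (card T)"
  shows "(\<Sum>a\<in>T. poly p a / node_weight T a) = coeff p (card T - 1)"
proof -
  have "interpolation T (poly p) - p = 0"
    using deg_less_diff[OF deg_less_interpolation[OF T] p] T
    by (rule deg_less_roots) (simp_all add: poly_interpolation[OF T])
  then show ?thesis using coeff_interpolation[OF T, of "poly p"] by simp
qed

text \<open>By the residue theorem on the projective line, the power moments of \<open>p dx / t\<close> can be read
  off at infinity, that is, from the leading coefficients of \<open>p\<close>.\<close>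

lemma deg_less_if_moments:
  fixes p :: "'a::field poly"
  assumes T: "finite T" and p: "deg_less p (card T)"
    and moments: "\<And>i. i < d \<Longrightarrow> (\<Sum>a\<in>T. a ^ i * poly p a / node_weight T a) = 0" and d: "d \<le> card T"
  shows "deg_less p (card T - d)"
  using moments d
proof (induction d)
  case (Suc d)
  then have IH: "deg_less p (card T - d)" by simp
  \<comment> \<open>Multiplication by x^d moves the coefficient in question to position card T - 1,
    where the d-th moment reads it.\<close>
  have "deg_less (monom 1 d * p) (Suc d + (card T - d) - 1)"
    by (rule deg_less_mult[OF deg_less_monom IH]) simp
  then have "deg_less (monom 1 d * p) (card T)" using Suc.prems by simp
  then have "coeff (monom 1 d * p) (card T - 1) = 0"
    using sum_over_nodes[OF T, of "monom 1 d * p"] Suc.prems(1)[of d] by (simp add: poly_monom)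
  moreover have "\<not> card T - 1 < d" "card T - 1 - d = card T - Suc d" using Suc.prems(2) by simp_all
  ultimately have "coeff p (card T - Suc d) = 0" by (simp only: coeff_monom_mult if_False mult_1)
  moreover have "j \<ge> card T - d" if "j \<ge> card T - Suc d" "j \<noteq> card T - Suc d" for j using that by simp
  ultimately show ?case using IH unfolding deg_less_def by metis
qed (use p in simp)

lemma moment_zero:
  fixes p :: "'a::field poly"
  assumes T: "finite T" and p: "deg_less p (card T - 1)"
  shows "(\<Sum>a\<in>T. poly p a / node_weight T a) = 0"
  using sum_over_nodes[OF T deg_less_mono[OF p]] p by (simp add: deg_less_def)

section \<open>The dual code\<close>

text \<open>The pairing is block triangular: x^i tests only \<open>B\<close>, and x^i w tests only A
  - h B. Each test removes one top coefficient out of \<open>card T\<close>, so \<open>p0\<close>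
  tests leave \<open>r\<close> coefficients for \<open>B\<close>, and \<open>r0\<close> tests leave
  \<open>p\<close> for A - h B and thereby for \<open>A\<close>.\<close>

lemma dual_of_evaluation_code:
  fixes \<alpha> \<omega> :: "nat \<Rightarrow> 'a::field" and h :: "'a poly"
  assumes T: "finite T" and k: "3 \<le> k" "k < n" and h: "degree h \<le> 1" and c: "c \<noteq> 0"
    and bij: "bij_betw (\<lambda>i. (\<alpha> i, \<omega> i)) {..<n} (SIGMA a:T. {b1 a, b2 a})"
    and b: "\<And>a. a \<in> T \<Longrightarrow> b1 a \<noteq> b2 a" "\<And>a. a \<in> T \<Longrightarrow> b1 a + b2 a = - poly h a"
    and C: "C = {vec n (\<lambda>i. poly A (\<alpha> i) + poly B (\<alpha> i) * \<omega> i) | A B.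
      deg_less A (k div 2 + 1) \<and> deg_less B ((k - 1) div 2)}"
    and u: "\<And>i. i < n \<Longrightarrow> u i = c / (node_weight T (\<alpha> i) * (2 * \<omega> i + poly h (\<alpha> i)))"
    and v: "\<And>i. i < n \<Longrightarrow> v i = u i * \<omega> i"
  shows "is_parity_check_matrix n k C (mat_of_rows n
    (map (\<lambda>j. vec n (\<lambda>i. u i * \<alpha> i ^ j)) [0..<(n - k) div 2 + 1] @
     map (\<lambda>j. vec n (\<lambda>i. v i * \<alpha> i ^ j)) [0..<(n - k - 1) div 2]))"
proof -
  define m where "m = card T"
  have "card (SIGMA a:T. {b1 a, b2 a}) = (\<Sum>a\<in>T. 2)"
    using T b(1) by (subst card_SigmaI) auto
  then have n: "n = 2 * m" using bij_betw_same_card[OF bij] by (simp add: m_def)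
  define p0 where "p0 = k div 2 + 1"
  define r0 where "r0 = (k - 1) div 2"
  define p where "p = (n - k) div 2 + 1"
  define r where "r = (n - k - 1) div 2"
  \<comment> \<open>For k = 2a the counts p0, r0, p, r are a + 1, a - 1, m - a + 1, m - a - 1; for k
    = 2a + 1 they are a + 1, a, m - a, m - a - 1. The bound r + 1 \<le> p makes room for the factor
    \<open>h\<close>.\<close>
  have ar: "p0 + r = m" "r0 + p = m" "p0 + r0 = k" "p + r = n - k" "r + 1 \<le> p" "p0 \<le> m" "p \<le> m"
  proof -
    define a where "a = k div 2"
    have "p0 + r = m \<and> r0 + p = m \<and> p0 + r0 = k \<and> p + r = n - k \<and> r + 1 \<le> p \<and> p0 \<le> m \<and> p \<le> m"
    proof (cases "even k")
      case True
      then have ka: "k = 2 * a" by (simp add: a_def)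
      then have am: "1 < a" "a < m" using k n by auto
      have "r0 = a - 1" "p = m - a + 1" "r = m - a - 1"
        unfolding r0_def p_def r_def ka n using am by simp_all
      then show "p0 + r = m \<and> r0 + p = m \<and> p0 + r0 = k \<and> p + r = n - k \<and> r + 1 \<le> p \<and> p0 \<le> m \<and> p \<le> m"
      proof -
        obtain e where m: "m = Suc (a + e)" using less_imp_Suc_add[OF am(2)] by auto
        have "p0 = a + 1" by (simp add: p0_def ka)
        moreover have "p = e + 2" "r = e" using \<open>p = m - a + 1\<close> \<open>r = m - a - 1\<close> m by simp_all
        ultimately show ?thesis using \<open>r0 = a - 1\<close> am(1) unfolding ka n m by auto
      qed
    next
      case False
      then have ka: "k = 2 * a + 1" by (simp add: a_def)
      then have am: "1 \<le> a" "a < m" using k n by auto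
      have "n - k = 2 * (m - a - 1) + 1" using am ka n by simp
      then have "r0 = a" "p0 = a + 1" "p = m - a" "r = m - a - 1"
        unfolding r0_def p_def r_def p0_def using ka am by simp_all
      then show "p0 + r = m \<and> r0 + p = m \<and> p0 + r0 = k \<and> p + r = n - k \<and> r + 1 \<le> p \<and> p0 \<le> m \<and> p \<le> m"
      proof -
        obtain e where m: "m = Suc (a + e)" using less_imp_Suc_add[OF am(2)] by auto
        moreover from this have "p = e + 1" "r = e" using \<open>p = m - a\<close> \<open>r = m - a - 1\<close> by simp_all
        ultimately show ?thesis using \<open>r0 = a\<close> \<open>p0 = a + 1\<close> am(1) unfolding ka n by auto
      qed
    qed
    then show "p0 + r = m" "r0 + p = m" "p0 + r0 = k" "p + r = n - k" "r + 1 \<le> p" "p0 \<le> m" "p \<le> m"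
      by blast+
  qed
  have idx: "\<alpha> i \<in> T" "\<omega> i = b1 (\<alpha> i) \<or> \<omega> i = b2 (\<alpha> i)" if "i < n" for i
    using bij_betwE[OF bij] that by auto
  have ex1: "\<exists>i<n. \<alpha> i = a \<and> \<omega> i = b1 a" and ex2: "\<exists>i<n. \<alpha> i = a \<and> \<omega> i = b2 a" if "a \<in> T" for a
  proof -
    have "(a, b1 a) \<in> (\<lambda>i. (\<alpha> i, \<omega> i)) ` {..<n}" "(a, b2 a) \<in> (\<lambda>i. (\<alpha> i, \<omega> i)) ` {..<n}"
      using bij_betw_imp_surj_on[OF bij] that by auto
    then show "\<exists>i<n. \<alpha> i = a \<and> \<omega> i = b1 a" "\<exists>i<n. \<alpha> i = a \<and> \<omega> i = b2 a" by force+
  qed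
  have sum_split: "(\<Sum>i<n. F (\<alpha> i) (\<omega> i)) = (\<Sum>a\<in>T. F a (b1 a) + F a (b2 a))" for F :: "'a \<Rightarrow> 'a \<Rightarrow> 'a"
  proof -
    have "(\<Sum>i<n. F (\<alpha> i) (\<omega> i)) = (\<Sum>(a, b)\<in>(SIGMA a:T. {b1 a, b2 a}). F a b)"
      using sum.reindex_bij_betw[OF bij, of "\<lambda>(a, b). F a b"] by simp
    also have "\<dots> = (\<Sum>a\<in>T. \<Sum>b\<in>{b1 a, b2 a}. F a b)"
      by (rule sum.Sigma[symmetric]) (use T in auto)
    also have "\<dots> = (\<Sum>a\<in>T. F a (b1 a) + F a (b2 a))"
      using b(1) by (intro sum.cong) auto
    finally show ?thesis .
  qed
  have \<tau>: "node_weight T a \<noteq> 0" for a by (rule node_weight_nonzero[OF T])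
  have diff: "2 * b1 a + poly h a = b1 a - b2 a" "2 * b2 a + poly h a = b2 a - b1 a" if "a \<in> T" for a
  proof -
    have "poly h a = - (b1 a + b2 a)" using b(2)[OF that] by simp
    then show "2 * b1 a + poly h a = b1 a - b2 a" "2 * b2 a + poly h a = b2 a - b1 a" by simp_all
  qed
  have \<delta>: "2 * \<omega> i + poly h (\<alpha> i) \<noteq> 0" if "i < n" for i
    using idx[OF that] diff[OF idx(1)[OF that]] b(1)[OF idx(1)[OF that]] by (metis eq_iff_diff_eq_0)
  have u0: "u i \<noteq> 0" if "i < n" for i using u[OF that] \<delta>[OF that] \<tau> c by simp
  \<comment> \<open>The values of A + B w at the two points over a node determine both polynomials
    there, and \<open>m\<close> roots are too many for their degrees.\<close>
  have zero: "A = 0 \<and> B = 0"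
    if AB: "deg_less A m" "deg_less B m" "\<forall>i<n. poly A (\<alpha> i) + poly B (\<alpha> i) * \<omega> i = 0" for A B
  proof -
    have "poly B a = 0 \<and> poly A a = 0" if a: "a \<in> T" for a
    proof -
      have 1: "poly A a + poly B a * b1 a = 0" and 2: "poly A a + poly B a * b2 a = 0"
        using ex1[OF a] ex2[OF a] AB(3) by metis+
      have "poly B a * (b1 a - b2 a) = (poly A a + poly B a * b1 a) - (poly A a + poly B a * b2 a)"
        by (simp add: algebra_simps)
      then have "poly B a = 0" using 1 2 b(1)[OF a] by simp
      then show ?thesis using 1 by simp
    qed
    then show ?thesis using deg_less_roots[OF AB(1) T] deg_less_roots[OF AB(2) T] by (auto simp: m_def)
  qed
  have code: "is_code n k C"
  proof -
    have "C = {vec n (\<lambda>i. 1 * poly A (\<alpha> i) + \<omega> i * poly B (\<alpha> i)) | A B. deg_less A p0 \<and> deg_less B r0}"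
      unfolding C p0_def r0_def by (simp add: mult.commute)
    moreover have "A = 0 \<and> B = 0" if "deg_less A p0" "deg_less B r0"
        "\<forall>i<n. 1 * poly A (\<alpha> i) + \<omega> i * poly B (\<alpha> i) = 0" for A B
      using zero[of A B] that deg_less_mono[of A p0 m] deg_less_mono[of B r0 m] ar by (simp add: mult.commute)
    ultimately show ?thesis
      unfolding is_code_def using basis_of_evaluations(2,4)[of C n "\<lambda>_. 1" \<alpha> \<omega> p0 r0] ar(3) by simp
  qed
  define E where "E A B = vec n (\<lambda>i. u i * poly A (\<alpha> i) + v i * poly B (\<alpha> i))" for A B
  have pairing: "(\<Sum>i<n. E A' B' $ i * (poly A (\<alpha> i) + poly B (\<alpha> i) * \<omega> i))
      = c * (\<Sum>a\<in>T. poly (A * B' + B * (A' - h * B')) a / node_weight T a)" for A B A' B'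
  proof -
    define F where "F a w = c / (node_weight T a * (2 * w + poly h a)) * (poly A' a + w * poly B' a)
      * (poly A a + poly B a * w)" for a w
    have "(\<Sum>i<n. E A' B' $ i * (poly A (\<alpha> i) + poly B (\<alpha> i) * \<omega> i)) = (\<Sum>i<n. F (\<alpha> i) (\<omega> i))"
    proof (rule sum.cong[OF refl])
      fix i assume "i \<in> {..<n}"
      then have i: "i < n" by simp
      have "E A' B' $ i * (poly A (\<alpha> i) + poly B (\<alpha> i) * \<omega> i)
          = u i * (poly A' (\<alpha> i) + \<omega> i * poly B' (\<alpha> i)) * (poly A (\<alpha> i) + poly B (\<alpha> i) * \<omega> i)"
        using i by (simp add: E_def v algebra_simps)
      then show "E A' B' $ i * (poly A (\<alpha> i) + poly B (\<alpha> i) * \<omega> i) = F (\<alpha> i) (\<omega> i)"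
        unfolding F_def u[OF i, symmetric] .
    qed
    also have "\<dots> = (\<Sum>a\<in>T. c * (poly (A * B' + B * (A' - h * B')) a / node_weight T a))"
      unfolding sum_split
    proof (rule sum.cong[OF refl])
      fix a assume a: "a \<in> T"
      \<comment> \<open>The denominators 2w + h at the two points over \<open>a\<close> are d and
        -d, so their joint contribution is a difference quotient.\<close>
      define d where "d = b1 a - b2 a"
      have d0: "d \<noteq> 0" using b(1)[OF a] by (simp add: d_def)
      have ha: "poly h a = - (b1 a + b2 a)" using b(2)[OF a] by simp
      have F1: "F a (b1 a) = c / node_weight T a * ((poly A' a + b1 a * poly B' a) * (poly A a + poly B a * b1 a)) / d"
        unfolding F_def diff(1)[OF a] d_def by simp
      have F2: "F a (b2 a) = - (c / node_weight T a * ((poly A' a + b2 a * poly B' a) * (poly A a + poly B a * b2 a)) / d)"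
        unfolding F_def diff(2)[OF a] minus_diff_eq[of "b1 a" "b2 a", symmetric] d_def[symmetric] by simp
      have "(poly A' a + b1 a * poly B' a) * (poly A a + poly B a * b1 a)
          - (poly A' a + b2 a * poly B' a) * (poly A a + poly B a * b2 a)
          = d * poly (A * B' + B * (A' - h * B')) a"
        by (simp add: d_def ha algebra_simps)
      then have "F a (b1 a) + F a (b2 a) = c / node_weight T a * (d * poly (A * B' + B * (A' - h * B')) a) / d"
        unfolding F1 F2 by (simp only: diff_divide_distrib[symmetric] right_diff_distrib[symmetric] add_uminus_conv_diff)
      then show "F a (b1 a) + F a (b2 a) = c * (poly (A * B' + B * (A' - h * B')) a / node_weight T a)"
        using d0 by simp
    qed
    finally show ?thesis by (simp add: sum_distrib_left)
  qed
  have scalar: "E A' B' \<bullet> vec n (\<lambda>i. poly A (\<alpha> i) + poly B (\<alpha> i) * \<omega> i)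
      = c * (\<Sum>a\<in>T. poly (A * B' + B * (A' - h * B')) a / node_weight T a)" for A B A' B'
    unfolding pairing[symmetric] scalar_prod_def by (simp add: lessThan_atLeast0)
  have h2: "deg_less h 2" using h by (auto simp: deg_less_iff)
  have dual: "dual_code n C = {E A B | A B. deg_less A p \<and> deg_less B r}"
  proof (intro equalityI subsetI)
    fix z assume "z \<in> dual_code n C"
    then have z: "z \<in> carrier_vec n" and orth: "\<And>y. y \<in> C \<Longrightarrow> z \<bullet> y = 0"
      unfolding dual_code_def by auto
    define i1 where "i1 a = (SOME i. i < n \<and> \<alpha> i = a \<and> \<omega> i = b1 a)" for a
    define i2 where "i2 a = (SOME i. i < n \<and> \<alpha> i = a \<and> \<omega> i = b2 a)" for a
    have i1: "i1 a < n \<and> \<alpha> (i1 a) = a \<and> \<omega> (i1 a) = b1 a" and i2: "i2 a < n \<and> \<alpha> (i2 a) = a \<and> \<omega> (i2 a) = b2 a"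
      if "a \<in> T" for a
      unfolding i1_def i2_def using someI_ex[OF ex1[OF that]] someI_ex[OF ex2[OF that]] by blast+
    define y1 where "y1 a = z $ i1 a / u (i1 a)" for a
    define y2 where "y2 a = z $ i2 a / u (i2 a)" for a
    \<comment> \<open>Solves A + B b1 = y1 and A + B b2 = y2 at every node, so each vector of length
      \<open>n\<close> has the form \<open>E A B\<close> with both degrees below
      \<open>m\<close>.\<close>
    define B where "B = interpolation T (\<lambda>a. (y1 a - y2 a) / (b1 a - b2 a))"
    define A where "A = interpolation T (\<lambda>a. y1 a - (y1 a - y2 a) / (b1 a - b2 a) * b1 a)"
    have Am: "deg_less A m" and Bm: "deg_less B m"
      unfolding A_def B_def m_def by (rule deg_less_interpolation[OF T])+
    have AB: "poly A a + poly B a * b1 a = y1 a" "poly A a + poly B a * b2 a = y2 a" if a: "a \<in> T" for a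
    proof -
      define d where "d = b1 a - b2 a"
      have d: "d \<noteq> 0" "b2 a = b1 a - d" using b(1)[OF a] by (simp_all add: d_def)
      have pB: "poly B a = (y1 a - y2 a) / d" and pA: "poly A a = y1 a - (y1 a - y2 a) / d * b1 a"
        unfolding A_def B_def poly_interpolation[OF T a] d_def by simp_all
      show "poly A a + poly B a * b1 a = y1 a" unfolding pA pB by simp
      show "poly A a + poly B a * b2 a = y2 a" unfolding pA pB d(2) using d(1) by (simp add: field_simps)
    qed
    have zE: "z = E A B"
    proof (rule eq_vecI)
      fix i assume "i < dim_vec (E A B)"
      then have i: "i < n" by (simp add: E_def)
      have inj: "inj_on (\<lambda>i. (\<alpha> i, \<omega> i)) {..<n}" using bij by (simp add: bij_betw_def)
      define a where "a = \<alpha> i"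
      have a: "a \<in> T" using idx(1)[OF i] by (simp add: a_def)
      have "i = i1 a \<or> i = i2 a"
        using idx(2)[OF i] i1[OF a] i2[OF a] i inj_onD[OF inj, of i "i1 a"] inj_onD[OF inj, of i "i2 a"]
        by (auto simp: a_def)
      then have "poly A a + poly B a * \<omega> i = z $ i / u i"
        using AB[OF a] i1[OF a] i2[OF a] unfolding y1_def y2_def by metis
      then show "z $ i = E A B $ i"
        using u0[OF i] i v[OF i] by (simp add: E_def a_def field_simps)
    qed (use z in \<open>simp add: E_def\<close>)
    have orthAB: "(\<Sum>a\<in>T. poly (A0 * B + B0 * (A - h * B)) a / node_weight T a) = 0"
      if "deg_less A0 p0" "deg_less B0 r0" for A0 B0
    proof -
      have "vec n (\<lambda>i. poly A0 (\<alpha> i) + poly B0 (\<alpha> i) * \<omega> i) \<in> C"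
        using that unfolding C p0_def r0_def by blast
      then show ?thesis using orth scalar[of A B A0 B0] c unfolding zE by simp
    qed
    have 0: "deg_less 0 l" for l :: nat by (simp add: deg_less_def)
    \<comment> \<open>\<open>B\<close> is bounded before \<open>A\<close>: this bound ensures that h
      B, and so A - h B, has degree below \<open>m\<close>, as the moment argument requires.\<close>
    have "deg_less B (m - p0)"
      unfolding m_def
    proof (rule deg_less_if_moments[OF T])
      fix i assume "i < p0"
      then show "(\<Sum>a\<in>T. a ^ i * poly B a / node_weight T a) = 0"
        using orthAB[OF deg_less_monom[of i p0 1] 0] by (simp add: poly_monom)
    qed (use Bm ar in \<open>simp_all add: m_def\<close>)
    then have Br: "deg_less B r" unfolding ar(1)[symmetric] by simp
    have hB: "deg_less (h * B) p"
      using deg_less_mono[OF deg_less_mult[OF h2 Br], of p] ar by simp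
    then have "deg_less (A - h * B) m" using Am deg_less_mono[of "h * B" p m] ar by (intro deg_less_diff) auto
    then have "deg_less (A - h * B) (m - r0)"
      unfolding m_def
    proof (rule deg_less_if_moments[OF T])
      fix i assume "i < r0"
      then show "(\<Sum>a\<in>T. a ^ i * poly (A - h * B) a / node_weight T a) = 0"
        using orthAB[OF 0 deg_less_monom[of i r0 1]] by (simp add: poly_monom)
    qed (use ar in \<open>simp add: m_def\<close>)
    then have "deg_less (A - h * B) p" unfolding ar(2)[symmetric] by simp
    then have "deg_less ((A - h * B) + h * B) p" using hB by (intro deg_less_add)
    then have "deg_less A p" by simp
    then show "z \<in> {E A B | A B. deg_less A p \<and> deg_less B r}" using zE Br by blast
  next
    fix z assume "z \<in> {E A B | A B. deg_less A p \<and> deg_less B r}"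
    then obtain A B where z: "z = E A B" and AB: "deg_less A p" "deg_less B r" by blast
    have hB: "deg_less (A - h * B) p"
      using deg_less_mono[OF deg_less_mult[OF h2 AB(2)], of p] ar AB by (intro deg_less_diff) auto
    have "z \<bullet> y = 0" if "y \<in> C" for y
    proof -
      obtain A0 B0 where y: "y = vec n (\<lambda>i. poly A0 (\<alpha> i) + poly B0 (\<alpha> i) * \<omega> i)"
        and AB0: "deg_less A0 p0" "deg_less B0 r0"
        using \<open>y \<in> C\<close> unfolding C p0_def r0_def by blast
      \<comment> \<open>The bounds are complementary: both products have degree below m - 1, so the
        coefficient at m - 1 computed by the pairing is zero.\<close>
      have "deg_less (A0 * B + B0 * (A - h * B)) (m - 1)"
        using deg_less_mult[OF AB0(1) AB(2)] deg_less_mult[OF AB0(2) hB] ar by (intro deg_less_add) auto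
      then have "(\<Sum>a\<in>T. poly (A0 * B + B0 * (A - h * B)) a / node_weight T a) = 0"
        unfolding m_def by (rule moment_zero[OF T])
      then show ?thesis unfolding z y scalar by simp
    qed
    then show "z \<in> dual_code n C" unfolding dual_code_def z by (simp add: E_def)
  qed
  have indep: "A = 0 \<and> B = 0" if AB: "deg_less A p" "deg_less B r"
      "\<forall>i<n. u i * poly A (\<alpha> i) + v i * poly B (\<alpha> i) = 0" for A B
  proof (rule zero)
    show "deg_less A m" by (rule deg_less_mono[OF AB(1) ar(7)])
    show "deg_less B m" by (rule deg_less_mono[OF AB(2)]) (use ar in simp)
    show "\<forall>i<n. poly A (\<alpha> i) + poly B (\<alpha> i) * \<omega> i = 0"
    proof (intro allI impI)
      fix i assume i: "i < n"
      have "u i * poly A (\<alpha> i) + v i * poly B (\<alpha> i) = 0" using AB(3) i by blast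
      then have "u i * (poly A (\<alpha> i) + poly B (\<alpha> i) * \<omega> i) = 0"
        unfolding v[OF i] by (simp add: algebra_simps)
      then show "poly A (\<alpha> i) + poly B (\<alpha> i) * \<omega> i = 0" using u0[OF i] by simp
    qed
  qed
  define vs where "vs = map (\<lambda>j. vec n (\<lambda>i. u i * \<alpha> i ^ j)) [0..<p] @ map (\<lambda>j. vec n (\<lambda>i. v i * \<alpha> i ^ j)) [0..<r]"
  have vs_carr: "set vs \<subseteq> carrier_vec n" by (auto simp: vs_def)
  have len: "length vs = n - k" using ar by (simp add: vs_def)
  have rows: "rows (mat_of_rows n vs) = vs" by (rule rows_mat_of_rows[OF vs_carr])
  note basis = basis_of_evaluations[OF dual[unfolded E_def] indep, folded vs_def]
  have "is_parity_check_matrix n k C (mat_of_rows n vs)"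
    unfolding is_parity_check_matrix_def rows
    by (intro conjI code basis(1,3)) (use mat_of_rows_carrier(1)[of n vs] len in simp)
  then show ?thesis unfolding vs_def p_def r_def .
qed

section \<open>The evaluation points and the code of a Weierstrass curve\<close>

context weierstrass
begin

lemma points:
  assumes T: "\<And>a. a \<in> T \<Longrightarrow> splits_completely \<iota> x a"
    and P: "bij_betw P {..<n} (\<Union>a\<in>T. rational_places_over \<iota> x a)"
    and \<alpha>: "\<And>i. i < n \<Longrightarrow> \<alpha> i = value_at \<iota> x (P i)"
    and \<omega>: "\<And>i. i < n \<Longrightarrow> \<omega> i = value_at \<iota> w (P i)"
    and i: "i < n"
  shows "rational_place \<iota> (P i)" "is_place \<iota> (P i)" "x - \<iota> (\<alpha> i) \<in> P i" "w - \<iota> (\<omega> i) \<in> P i"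
    "\<alpha> i \<in> T" "2 * \<omega> i + poly h (\<alpha> i) \<noteq> 0"
proof -
  obtain a where a: "a \<in> T" "P i \<in> rational_places_over \<iota> x a"
    using bij_betwE[OF P] i by blast
  then show rat: "rational_place \<iota> (P i)" and xa: "is_place \<iota> (P i)"
    by (auto simp: rational_places_over_def rational_place_def)
  have "x - \<iota> a \<in> P i" using a by (simp add: rational_places_over_def)
  moreover from this have \<alpha>a: "\<alpha> i = a" using value_at_eq[OF xa] \<alpha>[OF i] by simp
  ultimately show "x - \<iota> (\<alpha> i) \<in> P i" by simp
  show "\<alpha> i \<in> T" using a \<alpha>a by simp
  obtain P1 P2 \<beta>1 \<beta>2 where split: "rational_places_over \<iota> x a = {P1, P2}"
    "w - \<iota> \<beta>1 \<in> P1" "w - \<iota> \<beta>2 \<in> P2" "\<beta>1 \<noteq> \<beta>2" "\<beta>1 + \<beta>2 = - poly h a"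
    by (rule split_places[OF T[OF a(1)]])
  then obtain \<beta> where \<beta>: "w - \<iota> \<beta> \<in> P i" "\<beta> = \<beta>1 \<or> \<beta> = \<beta>2" using a(2) by blast
  then have \<omega>\<beta>: "\<omega> i = \<beta>" using value_at_eq[OF xa] \<omega>[OF i] by simp
  then show "w - \<iota> (\<omega> i) \<in> P i" using \<beta> by simp
  have "poly h a = - (\<beta>1 + \<beta>2)" using split(5) by simp
  then have "2 * \<beta> + poly h a = \<beta>1 - \<beta>2 \<or> 2 * \<beta> + poly h a = \<beta>2 - \<beta>1"
    using \<beta>(2) by auto
  then show "2 * \<omega> i + poly h (\<alpha> i) \<noteq> 0" using split(4) unfolding \<alpha>a \<omega>\<beta> by auto
qed

text \<open>The factor \<open>c\<close> adapts to the characteristic: 2w + h is 2y for the first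
  type and h in characteristic two. Scaling all rows by a nonzero constant preserves the row
  space.\<close>

theorem parity_check:
  assumes k: "3 \<le> k" "k < n"
    and O_pole: "poles \<iota> x = {P\<^sub>O}"
    and fin: "finite T" and T: "\<And>a. a \<in> T \<Longrightarrow> splits_completely \<iota> x a"
    and P: "bij_betw P {..<n} (\<Union>a\<in>T. rational_places_over \<iota> x a)"
    and \<alpha>: "\<And>i. i < n \<Longrightarrow> \<alpha> i = value_at \<iota> x (P i)"
    and \<omega>: "\<And>i. i < n \<Longrightarrow> \<omega> i = value_at \<iota> w (P i)"
    and \<gamma>: "\<And>i. i < n \<Longrightarrow> \<gamma> i = residue_at \<iota> (P i) (differential (1 / (\<Prod>a\<in>T. x - \<iota> a)) x)"
    and c: "c \<noteq> 0"
    and u: "\<And>i. i < n \<Longrightarrow> u i = c * \<gamma> i / (2 * \<omega> i + poly h (\<alpha> i))"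
    and v: "\<And>i. i < n \<Longrightarrow> v i = u i * \<omega> i"
  shows "is_parity_check_matrix n k (ag_code \<iota> n P (Poly_Mapping.single P\<^sub>O (int k)))
    (mat_of_rows n
      (map (\<lambda>j. vec n (\<lambda>i. u i * \<alpha> i ^ j)) [0..<(n - k) div 2 + 1] @
       map (\<lambda>j. vec n (\<lambda>i. v i * \<alpha> i ^ j)) [0..<(n - k - 1) div 2]))"
proof -
  have pts: "rational_place \<iota> (P i)" "is_place \<iota> (P i)" "x - \<iota> (\<alpha> i) \<in> P i" "w - \<iota> (\<omega> i) \<in> P i"
    "\<alpha> i \<in> T" "2 * \<omega> i + poly h (\<alpha> i) \<noteq> 0" if "i < n" for i
    by (rule points[OF T P \<alpha> \<omega> that]; assumption)+
  have "\<forall>a. \<exists>\<beta>1 \<beta>2 P1 P2. a \<in> T \<longrightarrow> rational_places_over \<iota> x a = {P1, P2} \<and>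
    w - \<iota> \<beta>1 \<in> P1 \<and> w - \<iota> \<beta>2 \<in> P2 \<and> \<beta>1 \<noteq> \<beta>2 \<and> \<beta>1 + \<beta>2 = - poly h a"
    using split_places[OF T] by metis
  then obtain b1 b2 Q1 Q2 where b: "\<forall>a. a \<in> T \<longrightarrow> rational_places_over \<iota> x a = {Q1 a, Q2 a} \<and>
    w - \<iota> (b1 a) \<in> Q1 a \<and> w - \<iota> (b2 a) \<in> Q2 a \<and> b1 a \<noteq> b2 a \<and> b1 a + b2 a = - poly h a"
    by metis
  \<comment> \<open>Injectivity holds because a place is determined by its values of x and w,
    surjectivity because both places over each node occur among the \<open>P i\<close>.\<close>
  have bij: "bij_betw (\<lambda>i. (\<alpha> i, \<omega> i)) {..<n} (SIGMA a:T. {b1 a, b2 a})"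
    unfolding bij_betw_def
  proof (intro conjI equalityI subsetI)
    show "inj_on (\<lambda>i. (\<alpha> i, \<omega> i)) {..<n}"
    proof (rule inj_onI)
      fix i j assume ij: "i \<in> {..<n}" "j \<in> {..<n}" "(\<alpha> i, \<omega> i) = (\<alpha> j, \<omega> j)"
      then have i: "i < n" and j: "j < n" and eq: "\<alpha> j = \<alpha> i" "\<omega> j = \<omega> i" by auto
      have "P i = P j"
        using place_determined[OF pts(2-4)[OF i] pts(2-4)[OF j, unfolded eq]] .
      then show "i = j" using P ij by (auto simp: bij_betw_def inj_on_def)
    qed
  next
    fix z assume "z \<in> (\<lambda>i. (\<alpha> i, \<omega> i)) ` {..<n}"
    then obtain i where i: "i < n" "z = (\<alpha> i, \<omega> i)" by auto
    have a: "\<alpha> i \<in> T" by (rule pts(5)[OF i(1)])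
    have "P i \<in> rational_places_over \<iota> x (\<alpha> i)"
      using pts(1,3)[OF i(1)] by (simp add: rational_places_over_def)
    then have "P i = Q1 (\<alpha> i) \<or> P i = Q2 (\<alpha> i)" using b a by auto
    then have "\<omega> i = b1 (\<alpha> i) \<or> \<omega> i = b2 (\<alpha> i)"
      using value_unique[OF pts(2,4)[OF i(1)]] b a by metis
    then show "z \<in> (SIGMA a:T. {b1 a, b2 a})" using a i by auto
  next
    fix z assume "z \<in> (SIGMA a:T. {b1 a, b2 a})"
    then obtain a \<beta> where z: "z = (a, \<beta>)" "a \<in> T" "\<beta> = b1 a \<or> \<beta> = b2 a" by auto
    then obtain Q where Q: "Q \<in> rational_places_over \<iota> x a" "w - \<iota> \<beta> \<in> Q" using b by blast
    then have "Q \<in> P ` {..<n}" using bij_betw_imp_surj_on[OF P] z(2) by blast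
    then obtain i where i: "i < n" "Q = P i" by auto
    have "x - \<iota> a \<in> P i" using Q i by (simp add: rational_places_over_def)
    then have "a = \<alpha> i" using value_unique[OF pts(2,3)[OF i(1)]] by simp
    moreover have "\<beta> = \<omega> i" using value_unique[OF pts(2,4)[OF i(1)]] Q(2) i(2) by simp
    ultimately show "z \<in> (\<lambda>i. (\<alpha> i, \<omega> i)) ` {..<n}" using z i by auto
  qed
  \<comment> \<open>The number of admissible exponents in \<open>B\<close> is floor((k - 3)/2) + 1 =
    (k - 1) div 2.\<close>
  have deg: "(A = 0 \<or> 2 * degree A \<le> k) \<longleftrightarrow> deg_less A (k div 2 + 1)"
    "(B = 0 \<or> 2 * degree B + 3 \<le> k) \<longleftrightarrow> deg_less B ((k - 1) div 2)" for A B :: "'k poly"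
    unfolding deg_less_iff using k(1) by auto
  have val: "vec n (\<lambda>i. value_at \<iota> (X A + X B * w) (P i))
      = vec n (\<lambda>i. poly A (\<alpha> i) + poly B (\<alpha> i) * \<omega> i)" for A B
  proof (rule eq_vecI)
    fix i assume "i < dim_vec (vec n (\<lambda>i. poly A (\<alpha> i) + poly B (\<alpha> i) * \<omega> i))"
    then have i: "i < n" by simp
    show "vec n (\<lambda>i. value_at \<iota> (X A + X B * w) (P i)) $ i
        = vec n (\<lambda>i. poly A (\<alpha> i) + poly B (\<alpha> i) * \<omega> i) $ i"
      using value_at_eq[OF pts(2)[OF i] value_lin[OF pts(2-4)[OF i]]] i by (simp add: eval_lin_def)
  qed simp
  have "ag_code \<iota> n P (Poly_Mapping.single P\<^sub>O (int k))
      = {vec n (\<lambda>i. value_at \<iota> (X A + X B * w) (P i)) | A B.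
          (A = 0 \<or> 2 * degree A \<le> k) \<and> (B = 0 \<or> 2 * degree B + 3 \<le> k)}"
    unfolding ag_code_def riemann_roch_space_O[OF O_pole] by blast
  then have C: "ag_code \<iota> n P (Poly_Mapping.single P\<^sub>O (int k))
      = {vec n (\<lambda>i. poly A (\<alpha> i) + poly B (\<alpha> i) * \<omega> i) | A B.
          deg_less A (k div 2 + 1) \<and> deg_less B ((k - 1) div 2)}"
    unfolding val deg .
  have u': "u i = c / (node_weight T (\<alpha> i) * (2 * \<omega> i + poly h (\<alpha> i)))" if i: "i < n" for i
  proof -
    have "\<gamma> i = 1 / node_weight T (\<alpha> i)"
      unfolding \<gamma>[OF i] node_weight_def
      by (rule residue_simple_pole[OF pts(2)[OF i] pts(1)[OF i] pts(3)[OF i] pts(4)[OF i] pts(6)[OF i] fin pts(5)[OF i]])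
    then show ?thesis using u[OF i] by simp
  qed
  show ?thesis
    by (rule dual_of_evaluation_code[OF fin k deg_h c bij _ _ C u' v]) (use b in auto)
qed

end

section \<open>The three types\<close>

text \<open>Translation by 1 permutes the field, so the sums of all x and of all x + 1 agree; their
  difference is the field order times 1.\<close>

lemma card_finite_field_eq_0: "of_nat (card (UNIV :: 'k::finite_field set)) = (0 :: 'k)"
proof -
  have "bij_betw (\<lambda>x :: 'k. x + 1) UNIV UNIV"
    by (rule bij_betw_byWitness[of _ "\<lambda>x. x - 1"]) auto
  then have "(\<Sum>x :: 'k\<in>UNIV. x + 1) = (\<Sum>x\<in>UNIV. x)"
    by (rule sum.reindex_bij_betw)
  then show ?thesis by (simp add: sum.distrib)
qed

text \<open>If 2 = 0, an odd order q would give q = 1 in the field, although q = 0 there. If q is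
  even, c^q = c at c = -1 gives -1 = 1.\<close>

lemma two_eq_0_iff: "(2 :: 'k::finite_field) = 0 \<longleftrightarrow> even (card (UNIV :: 'k set))"
proof
  assume 2: "(2 :: 'k) = 0"
  show "even (card (UNIV :: 'k set))"
  proof (rule ccontr)
    assume "odd (card (UNIV :: 'k set))"
    then obtain j where "card (UNIV :: 'k set) = 2 * j + 1" by (auto elim: oddE)
    then have "(of_nat (2 * j + 1) :: 'k) = 0" using card_finite_field_eq_0 by metis
    then show False using 2 by simp
  qed
next
  assume "even (card (UNIV :: 'k set))"
  then have "(-1 :: 'k) ^ card (UNIV :: 'k set) = 1" by simp
  then have "(-1 :: 'k) = 1" by (simp only: finite_field_power_card_eq_same)
  then show "(2 :: 'k) = 0" by (metis add.right_inverse one_add_one)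
qed

text \<open>Squaring the coprimality relation and multiplying by \<open>y\<close> writes
  \<open>y\<close> as a multiple of A y plus a multiple of the square of \<open>C\<close>.\<close>

lemma square_dvd_cancel:
  fixes A C :: "'a::comm_ring_1"
  assumes bezout: "s * A + t * C = 1" and dvd: "C ^ 2 dvd A * y"
  shows "C ^ 2 dvd y"
proof -
  have "(s * A + t * C) ^ 2 * y = y" unfolding bezout by simp
  then have "y = (s ^ 2 * A + 2 * s * t * C) * (A * y) + C ^ 2 * (t ^ 2 * y)"
    by (simp add: algebra_simps power2_eq_square)
  then show ?thesis using dvd by (metis dvd_add dvd_mult dvd_triv_left)
qed

text \<open>In lowest terms A'/C', both A' and A' - C' E are coprime to C', so the square of C'
  divides \<open>q\<close>. Its degree is at most 1, which makes C' constant.\<close>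

lemma integral_dvd:
  fixes A C E :: "'k::field poly"
  assumes C: "C \<noteq> 0" and q: "degree q \<le> 1" "q \<noteq> 0" and dvd: "C ^ 2 dvd q * (A ^ 2 - A * (C * E))"
  shows "C dvd A"
proof -
  obtain d A' C' s t where d: "d \<noteq> 0" "A = d * A'" "C = d * C'" "s * A' + t * C' = 1"
    by (rule poly_bezout[OF C])
  have "d ^ 2 * C' ^ 2 dvd d ^ 2 * (q * (A' * (A' - C' * E)))"
    using dvd unfolding d(2,3) by (simp add: algebra_simps power2_eq_square)
  then have "C' ^ 2 dvd q * (A' * (A' - C' * E))" using d(1) by simp
  then have "C' ^ 2 dvd A' * ((A' - C' * E) * q)" by (simp add: ac_simps)
  then have "C' ^ 2 dvd (A' - C' * E) * q" by (rule square_dvd_cancel[OF d(4)])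
  moreover have "s * (A' - C' * E) + (t + s * E) * C' = 1" using d(4) by (simp add: algebra_simps)
  ultimately have "C' ^ 2 dvd q" using square_dvd_cancel by blast
  then have "2 * degree C' \<le> degree q"
    using dvd_imp_degree_le[of "C' ^ 2" q] q(2) C d by (simp add: degree_power_eq)
  then have "degree C' = 0" using q(1) by simp
  then have "is_unit C'" using C d by (simp add: is_unit_iff_degree)
  then show ?thesis unfolding d(2,3) by (meson dvd_refl dvd_trans mult_dvd_mono unit_imp_dvd)
qed

text \<open>As 2 is invertible, the trace condition gives \<open>C dvd A\<close>. The norm condition
  becomes divisibility of f B^2 by the square of \<open>C\<close>, and squarefreeness of
  \<open>f\<close> yields \<open>C dvd B\<close>.\<close>

lemma weierstrass_type1:
  assumes "elliptic_type1 \<iota> x y f"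
  shows "weierstrass \<iota> x y 0 f"
proof -
  have gen: "function_field_gen \<iota> x y" and odd: "odd (card (UNIV :: 'a set))" and deg: "degree f = 3"
    and sf: "squarefree f" and eq: "y ^ 2 = poly (map_poly \<iota> f) x"
    using assms by (auto simp: elliptic_type1_def)
  have two: "(2 :: 'a) \<noteq> 0" using odd two_eq_0_iff by blast
  show ?thesis
  proof (rule weierstrass.intro)
    show "field_hom \<iota>" using gen by (simp add: function_field_gen_def)
    show "C dvd A \<and> C dvd B" if C: "C \<noteq> 0" "C dvd 2 * A - 0 * B" "C ^ 2 dvd A ^ 2 - 0 * A * B - f * B ^ 2" for A B C
    proof -
      have "2 * A = Polynomial.smult 2 A" by (simp add: numeral_poly)
      then have CA: "C dvd A" using C(2) two by (simp add: dvd_smult_iff)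
      obtain A' where A': "A = C * A'" using CA ..
      have "C ^ 2 dvd A ^ 2" using A' by (simp add: power_mult_distrib)
      then have fB: "C ^ 2 dvd f * B ^ 2" using C(3) by (simp add: dvd_diff_right_iff)
      obtain d B' C' s t where d: "d \<noteq> 0" "B = d * B'" "C = d * C'" "s * B' + t * C' = 1"
        by (rule poly_bezout[OF C(1)])
      have "d ^ 2 * C' ^ 2 dvd d ^ 2 * (f * B' ^ 2)"
        using fB unfolding d(2,3) by (simp add: algebra_simps power_mult_distrib)
      then have "C' ^ 2 dvd f * B' ^ 2" using d(1) by simp
      then have "C' ^ 2 dvd B' * (B' * f)" by (simp add: power2_eq_square ac_simps)
      then have "C' ^ 2 dvd f" using square_dvd_cancel[OF d(4)] by blast
      then have "is_unit C'" using sf by (simp add: squarefree_def)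
      then have "C dvd B" unfolding d(2,3) by (meson dvd_refl dvd_trans mult_dvd_mono unit_imp_dvd)
      then show ?thesis using CA by simp
    qed
  qed (use gen eq deg two in \<open>auto simp: function_field_gen_def\<close>)
qed

text \<open>In characteristic two the trace of A + B w is -B, so \<open>C dvd B\<close>; what is
  left of the norm condition is \<open>integral_dvd\<close> with q = 1.\<close>

lemma weierstrass_type2:
  assumes "elliptic_type2 \<iota> x y f"
  shows "weierstrass \<iota> x y 1 f"
proof -
  have gen: "function_field_gen \<iota> x y" and even: "even (card (UNIV :: 'a set))" and deg: "degree f = 3"
    and eq: "y ^ 2 + y = poly (map_poly \<iota> f) x"
    using assms by (auto simp: elliptic_type2_def)
  have hom: "field_hom \<iota>" using gen by (simp add: function_field_gen_def)
  interpret field_hom \<iota> by (rule hom)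
  have two: "(2 :: 'a) = 0" using even two_eq_0_iff by blast
  have two_poly: "2 * A = 0" for A :: "'a poly" by (simp add: numeral_poly two)
  show ?thesis
  proof (rule weierstrass.intro)
    show "C dvd A \<and> C dvd B" if C: "C \<noteq> 0" "C dvd 2 * A - 1 * B" "C ^ 2 dvd A ^ 2 - 1 * A * B - f * B ^ 2" for A B C
    proof -
      have CB: "C dvd B" using C(2) by (simp add: two_poly)
      then obtain B' where B': "B = C * B'" ..
      have "C ^ 2 dvd (A ^ 2 - 1 * A * B - f * B ^ 2) + C ^ 2 * (f * B' ^ 2)"
        by (rule dvd_add[OF C(3)]) simp
      also have "\<dots> = 1 * (A ^ 2 - A * (C * B'))" by (simp add: B' algebra_simps power_mult_distrib)
      finally have "C dvd A" by (rule integral_dvd[OF C(1), rotated 2]) simp_all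
      then show ?thesis using CB by simp
    qed
  qed (use gen eq deg hom in \<open>auto simp: function_field_gen_def map_poly_1 hom_one\<close>)
qed

text \<open>The trace condition now says only that \<open>C\<close> divides h B, so \<open>C\<close>
  might share the linear factor h. The norm condition has to exclude this, where the summand h of g,
  coming from 1/(ax + b), is decisive.\<close>

lemma weierstrass_type3:
  assumes "elliptic_type3 \<iota> x y a b"
  shows "weierstrass \<iota> x ((\<iota> a * x + \<iota> b) * y) [:b, a:] ([:b, a:] ^ 2 * [:0, 1:] + [:b, a:])"
    and "\<iota> a * x + \<iota> b \<noteq> 0"
proof -
  define h where "h = [:b, a:]"
  define z where "z = \<iota> a * x + \<iota> b"
  have gen: "function_field_gen \<iota> x y" and even: "even (card (UNIV :: 'a set))" and a: "a \<noteq> 0"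
    and eq: "y ^ 2 + y = x + 1 / z"
    using assms by (auto simp: elliptic_type3_def z_def)
  have hom: "field_hom \<iota>" using gen by (simp add: function_field_gen_def)
  interpret field_hom \<iota> by (rule hom)
  have two: "(2 :: 'a) = 0" using even two_eq_0_iff by blast
  have two_poly: "2 * A = 0" for A :: "'a poly" by (simp add: numeral_poly two)
  have h0: "h \<noteq> 0" "degree h = 1" using a by (simp_all add: h_def)
  have hz: "poly (map_poly \<iota> h) x = z" by (simp add: h_def z_def map_poly_pCons hom_zero mult.commute)
  show z0: "\<iota> a * x + \<iota> b \<noteq> 0"
    using gen hz h0 unfolding function_field_gen_def z_def by metis
  have hom2: "\<iota> 2 = 2" using hom_add[of 1 1] by (simp add: hom_one)
  have gz: "poly (map_poly \<iota> (h ^ 2 * [:0, 1:] + h)) x = z ^ 2 * x + z"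
    by (simp add: h_def z_def map_poly_pCons hom_zero hom_add hom_mult hom2 power2_eq_square algebra_simps)
  have z0': "z \<noteq> 0" using z0 by (simp add: z_def)
  have "weierstrass \<iota> x (z * y) h (h ^ 2 * [:0, 1:] + h)"
  proof (rule weierstrass.intro)
    show "p = 0" if "poly (map_poly \<iota> p) x = 0" for p
      using gen that by (auto simp: function_field_gen_def)
    show "L = UNIV" if L: "is_subfield L" "range \<iota> \<subseteq> L" "x \<in> L" "z * y \<in> L" for L
    proof -
      have mult: "u * v \<in> L" and diff: "u - v \<in> L" if "u \<in> L" "v \<in> L" for u v
        using L(1) that by (auto simp: is_subfield_def)
      have const: "\<iota> e \<in> L" for e using L(2) by auto
      have "\<iota> a * x - \<iota> (- b) \<in> L" by (intro diff mult const L)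
      then have "z \<in> L" by (simp add: z_def hom_uminus)
      then have "inverse z \<in> L" using L(1) by (simp add: is_subfield_def)
      then have "inverse z * (z * y) \<in> L" by (rule mult[OF _ L(4)])
      moreover have "inverse z * (z * y) = y" using z0' by simp
      ultimately have "y \<in> L" by (simp only:)
      then show "L = UNIV" using gen L by (auto simp: function_field_gen_def)
    qed
    have "z ^ 2 * (y ^ 2 + y) = z ^ 2 * x + z" unfolding eq using z0' by (simp add: field_simps power2_eq_square)
    then show "(z * y) ^ 2 + poly (map_poly \<iota> h) x * (z * y) = poly (map_poly \<iota> (h ^ 2 * [:0, 1:] + h)) x"
      unfolding hz gz by (simp add: algebra_simps power2_eq_square)
    show "degree (h ^ 2 * [:0, 1:] + h) = 3"
      using a by (simp add: h_def power2_eq_square)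
    show "C dvd A \<and> C dvd B" if C: "C \<noteq> 0" "C dvd 2 * A - h * B"
      "C ^ 2 dvd A ^ 2 - h * A * B - (h ^ 2 * [:0, 1:] + h) * B ^ 2" for A B C
    proof -
      have "C dvd h * B" using C(2) by (simp add: two_poly)
      then obtain E where E: "h * B = C * E" ..
      have hB2: "h ^ 2 * B ^ 2 = C ^ 2 * E ^ 2" using E by (metis power_mult_distrib)
      have "C ^ 2 dvd (A ^ 2 - h * A * B - (h ^ 2 * [:0, 1:] + h) * B ^ 2) + C ^ 2 * (E ^ 2 * [:0, 1:])"
        by (rule dvd_add[OF C(3) dvd_triv_left])
      also have "\<dots> = A ^ 2 - A * (h * B) - h * B ^ 2 + (C ^ 2 * E ^ 2 - h ^ 2 * B ^ 2) * [:0, 1:]"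
        by (simp only: algebra_simps)
      also have "\<dots> = A ^ 2 - A * (C * E) - h * B ^ 2" unfolding hB2 E by simp
      finally have C2: "C ^ 2 dvd A ^ 2 - A * (C * E) - h * B ^ 2" .
      \<comment> \<open>One more factor h turns h B^2 into h^2 B^2 = C^2 E^2, which drops out modulo
        C^2.\<close>
      then have "C ^ 2 dvd h * (A ^ 2 - A * (C * E) - h * B ^ 2) + C ^ 2 * E ^ 2"
        by (intro dvd_add[OF dvd_mult dvd_triv_left])
      also have "\<dots> = h * (A ^ 2 - A * (C * E))"
        unfolding hB2[symmetric] by (simp add: algebra_simps power2_eq_square)
      finally have CA: "C dvd A" using integral_dvd[OF C(1) _ h0(1)] h0(2) by simp
      then obtain A' where A': "A = C * A'" ..
      have "C ^ 2 dvd C ^ 2 * (A' ^ 2 - A' * E) - (A ^ 2 - A * (C * E) - h * B ^ 2)"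
        by (intro dvd_diff C2) simp
      also have "\<dots> = h * B ^ 2" by (simp add: A' algebra_simps power2_eq_square)
      finally obtain K where K: "h * B ^ 2 = C ^ 2 * K" ..
      \<comment> \<open>From h B^2 = C^2 K and h B = C E follows h K = E^2. As h is linear, its root
        is a root of \<open>E\<close>; so h divides \<open>E\<close> and cancels in h B = C
        E.\<close>
      have "C ^ 2 * (h * K) = h * (h * B ^ 2)" unfolding K by simp
      also have "\<dots> = C ^ 2 * E ^ 2" unfolding hB2[symmetric] by (simp add: power2_eq_square)
      finally have hK: "h * K = E ^ 2" using C(1) by simp
      define r where "r = - b / a"
      have hr: "h = Polynomial.smult a [:- r, 1:]" using a by (simp add: h_def r_def)
      have "poly (E ^ 2) r = 0" unfolding hK[symmetric] by (simp add: hr)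
      then have "[:- r, 1:] dvd E" by (simp add: poly_eq_0_iff_dvd[symmetric])
      then have "h dvd E" unfolding hr using a by (rule smult_dvd)
      then obtain E' where "E = h * E'" ..
      then have "h * B = h * (C * E')" using E by simp
      then have "B = C * E'" using h0(1) by (metis mult_cancel_left)
      then show ?thesis using CA by simp
    qed
  qed (use hom h0 in simp_all)
  then show "weierstrass \<iota> x ((\<iota> a * x + \<iota> b) * y) [:b, a:] ([:b, a:] ^ 2 * [:0, 1:] + [:b, a:])"
    unfolding h_def z_def .
qed

section \<open>The parity-check matrices\<close>

lemma upto_int_conv: "[0..int m - 1] = map int [0..<m]"
proof (induction m)
  case (Suc m)
  have "[0..int (Suc m) - 1] = [0..int m - 1] @ [int m]" using upto_rec2[of 0 "int m"] by simp
  then show ?case using Suc by simp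
qed simp

lemma map_vec_upto:
  assumes "b = int m - 1" "\<And>i j. i < n \<Longrightarrow> f j i = u i * \<alpha> i ^ j"
  shows "map (\<lambda>j. vec n (f (nat j))) [0..b] = map (\<lambda>j. vec n (\<lambda>i. u i * \<alpha> i ^ j)) [0..<m]"
  unfolding assms(1) upto_int_conv using assms(2) by (auto intro!: eq_vecI)

text \<open>Rewrites the last exponents as row counts minus one, with floor((n - k - 3)/2) + 1 = (n
  - k - 1) div 2. For n - k \<le> 2 the second bound is -1 and the range is empty.\<close>

lemma upper_bounds:
  assumes "3 \<le> k" "k < n"
  shows "(int n - int k) div 2 = int ((n - k) div 2 + 1) - 1"
    and "(int n - int k - 3) div 2 = int ((n - k - 1) div 2) - 1"
proof -
  define d where "d = n - k"
  have d: "int n - int k = int d" "1 \<le> d" using assms by (simp_all add: d_def)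
  show "(int n - int k) div 2 = int ((n - k) div 2 + 1) - 1"
    unfolding d d_def[symmetric] by simp
  show "(int n - int k - 3) div 2 = int ((n - k - 1) div 2) - 1"
    unfolding d d_def[symmetric] using d(2) by presburger
qed

theorem mainTheorem3:
  fixes \<iota> :: "'k::finite_field \<Rightarrow> 'f::field"
    and x y t :: 'f
    and P\<^sub>O :: "'f set"
    and T :: "'k set"
    and n k :: nat
    and P :: "nat \<Rightarrow> 'f set"
    and \<alpha> \<beta> \<gamma> :: "nat \<Rightarrow> 'k"
    and \<omega> :: "'f differential"
  assumes k: "3 \<le> k" "k < n"
    and O_pole: "poles \<iota> x = {P\<^sub>O}"
    and T: "T \<noteq> {}" "\<And>a. a \<in> T \<Longrightarrow> splits_completely \<iota> x a"
    and P: "bij_betw P {..<n} (\<Union>a\<in>T. rational_places_over \<iota> x a)"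
    and \<alpha>: "\<And>i. i < n \<Longrightarrow> \<alpha> i = value_at \<iota> x (P i)"
    and \<beta>: "\<And>i. i < n \<Longrightarrow> \<beta> i = value_at \<iota> y (P i)"
    and t: "t = (\<Prod>a\<in>T. x - \<iota> a)"
    and \<omega>: "\<omega> = differential (1 / t) x"
    and \<gamma>: "\<And>i. i < n \<Longrightarrow> \<gamma> i = residue_at \<iota> (P i) \<omega>"
  shows
    "(\<forall>f. elliptic_type1 \<iota> x y f \<longrightarrow>
        is_parity_check_matrix n k (ag_code \<iota> n P (Poly_Mapping.single P\<^sub>O (int k)))
          (parity_matrix1 n k \<alpha> \<beta> \<gamma>)) \<and>
     (\<forall>f. elliptic_type2 \<iota> x y f \<longrightarrow>
        is_parity_check_matrix n k (ag_code \<iota> n P (Poly_Mapping.single P\<^sub>O (int k)))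
          (parity_matrix2 n k \<alpha> \<beta> \<gamma>)) \<and>
     (\<forall>a b. elliptic_type3 \<iota> x y a b \<longrightarrow>
        is_parity_check_matrix n k (ag_code \<iota> n P (Poly_Mapping.single P\<^sub>O (int k)))
          (parity_matrix3 a b n k \<alpha> \<beta> \<gamma>))"
proof (intro conjI allI impI)
  have fin: "finite T" by simp
  note \<gamma>' = \<gamma>[unfolded \<omega> t]
  note bounds = upper_bounds[OF k]
  show "is_parity_check_matrix n k (ag_code \<iota> n P (Poly_Mapping.single P\<^sub>O (int k))) (parity_matrix1 n k \<alpha> \<beta> \<gamma>)"
    if type: "elliptic_type1 \<iota> x y f" for f
  proof -
    interpret weierstrass \<iota> x y 0 f by (rule weierstrass_type1[OF type])
    have two: "(2 :: 'k) \<noteq> 0" using type two_eq_0_iff unfolding elliptic_type1_def by blast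
    have "2 * \<beta> i + poly 0 (\<alpha> i) \<noteq> 0" if "i < n" for i
      by (rule points[OF T(2) P \<alpha> \<beta> that]; assumption)
    then have \<beta>0: "\<beta> i \<noteq> 0" if "i < n" for i using that by auto
    have rows1: "map (\<lambda>j. vec n (\<lambda>i. \<gamma> i * \<alpha> i ^ nat j / \<beta> i)) [0..(int n - int k) div 2]
        = map (\<lambda>j. vec n (\<lambda>i. \<gamma> i / \<beta> i * \<alpha> i ^ j)) [0..<(n - k) div 2 + 1]"
      by (rule map_vec_upto[OF bounds(1), where f = "\<lambda>j i. \<gamma> i * \<alpha> i ^ j / \<beta> i"]) simp
    have rows2: "map (\<lambda>j. vec n (\<lambda>i. \<gamma> i * \<alpha> i ^ nat j)) [0..(int n - int k - 3) div 2]
        = map (\<lambda>j. vec n (\<lambda>i. \<gamma> i * \<alpha> i ^ j)) [0..<(n - k - 1) div 2]"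
      by (rule map_vec_upto[OF bounds(2), where f = "\<lambda>j i. \<gamma> i * \<alpha> i ^ j"]) simp
    \<comment> \<open>Here c = 2: the denominator 2w + h is 2 \<beta>, so u = \<gamma>/\<beta> and v
      = \<gamma>.\<close>
    show ?thesis
      unfolding parity_matrix1_def rows1 rows2
      by (rule parity_check[OF k O_pole fin T(2) P \<alpha> \<beta> \<gamma>' two]) (use \<beta>0 two in \<open>simp_all\<close>)
  qed
  show "is_parity_check_matrix n k (ag_code \<iota> n P (Poly_Mapping.single P\<^sub>O (int k))) (parity_matrix2 n k \<alpha> \<beta> \<gamma>)"
    if type: "elliptic_type2 \<iota> x y f" for f
  proof -
    interpret weierstrass \<iota> x y 1 f by (rule weierstrass_type2[OF type])
    have two: "(2 :: 'k) = 0" using type two_eq_0_iff unfolding elliptic_type2_def by blast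
    have rows1: "map (\<lambda>j. vec n (\<lambda>i. \<gamma> i * \<alpha> i ^ nat j)) [0..(int n - int k) div 2]
        = map (\<lambda>j. vec n (\<lambda>i. \<gamma> i * \<alpha> i ^ j)) [0..<(n - k) div 2 + 1]"
      by (rule map_vec_upto[OF bounds(1), where f = "\<lambda>j i. \<gamma> i * \<alpha> i ^ j"]) simp
    have rows2: "map (\<lambda>j. vec n (\<lambda>i. \<gamma> i * \<alpha> i ^ nat j * \<beta> i)) [0..(int n - int k - 3) div 2]
        = map (\<lambda>j. vec n (\<lambda>i. \<gamma> i * \<beta> i * \<alpha> i ^ j)) [0..<(n - k - 1) div 2]"
      by (rule map_vec_upto[OF bounds(2), where f = "\<lambda>j i. \<gamma> i * \<alpha> i ^ j * \<beta> i"]) simp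
    \<comment> \<open>Here c = 1: the denominator 2w + h is 1 in characteristic two, so u = \<gamma>
      and v = \<gamma> \<beta>.\<close>
    show ?thesis
      unfolding parity_matrix2_def rows1 rows2
      by (rule parity_check[OF k O_pole fin T(2) P \<alpha> \<beta> \<gamma>' one_neq_zero]) (use two in \<open>simp_all\<close>)
  qed
  show "is_parity_check_matrix n k (ag_code \<iota> n P (Poly_Mapping.single P\<^sub>O (int k))) (parity_matrix3 a b n k \<alpha> \<beta> \<gamma>)"
    if type: "elliptic_type3 \<iota> x y a b" for a b
  proof -
    define w where "w = (\<iota> a * x + \<iota> b) * y"
    interpret weierstrass \<iota> x w "[:b, a:]" "[:b, a:] ^ 2 * [:0, 1:] + [:b, a:]"
      unfolding w_def by (rule weierstrass_type3(1)[OF type])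
    have two: "(2 :: 'k) = 0" using type two_eq_0_iff unfolding elliptic_type3_def by blast
    define \<eta> where "\<eta> i = value_at \<iota> w (P i)" for i
    have pts: "is_place \<iota> (P i)" "x - \<iota> (\<alpha> i) \<in> P i" "w - \<iota> (\<eta> i) \<in> P i"
      "2 * \<eta> i + poly [:b, a:] (\<alpha> i) \<noteq> 0" if "i < n" for i
      by (rule points[OF T(2) P \<alpha> \<eta>_def that]; assumption)+
    have h0: "a * \<alpha> i + b \<noteq> 0" if "i < n" for i using pts(4)[OF that] two by (simp add: algebra_simps)
    \<comment> \<open>The points are known through w, so the value of y is recovered from y = w/(ax
      + b). The denominator has a nonzero value, which in characteristic two is that of 2w +
      h.\<close>
    have \<eta>: "\<eta> i = (a * \<alpha> i + b) * \<beta> i" if i: "i < n" for i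
    proof -
      have "X [:b, a:] - \<iota> (poly [:b, a:] (\<alpha> i)) \<in> P i" by (rule value_X[OF pts(1-3)[OF i]])
      then have "w / X [:b, a:] - \<iota> (\<eta> i / (a * \<alpha> i + b)) \<in> P i"
        using value_divide[OF pts(1)[OF i] pts(3)[OF i], of "X [:b, a:]" "a * \<alpha> i + b"] h0[OF i]
        by (simp add: algebra_simps)
      moreover have "w / X [:b, a:] = y"
        using weierstrass_type3(2)[OF type] by (simp add: w_def X_pCons iota.hom_zero mult.commute add.commute)
      ultimately have "\<beta> i = \<eta> i / (a * \<alpha> i + b)" using value_at_eq[OF pts(1)[OF i]] \<beta>[OF i] by simp
      then show ?thesis using h0[OF i] by simp
    qed
    have rows1: "map (\<lambda>j. vec n (\<lambda>i. \<gamma> i * \<alpha> i ^ nat j / (a * \<alpha> i + b))) [0..(int n - int k) div 2]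
        = map (\<lambda>j. vec n (\<lambda>i. \<gamma> i / (a * \<alpha> i + b) * \<alpha> i ^ j)) [0..<(n - k) div 2 + 1]"
      by (rule map_vec_upto[OF bounds(1), where f = "\<lambda>j i. \<gamma> i * \<alpha> i ^ j / (a * \<alpha> i + b)"]) simp
    have rows2: "map (\<lambda>j. vec n (\<lambda>i. \<gamma> i * \<beta> i * \<alpha> i ^ nat j)) [0..(int n - int k - 3) div 2]
        = map (\<lambda>j. vec n (\<lambda>i. \<gamma> i * \<beta> i * \<alpha> i ^ j)) [0..<(n - k - 1) div 2]"
      by (rule map_vec_upto[OF bounds(2), where f = "\<lambda>j i. \<gamma> i * \<beta> i * \<alpha> i ^ j"]) simp
    \<comment> \<open>Again c = 1: 2w + h has value a \<alpha> + b, so u = \<gamma>/(a \<alpha> +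
      b), and v = u \<eta> = \<gamma> \<beta>.\<close>
    show ?thesis
      unfolding parity_matrix3_def rows1 rows2
      by (rule parity_check[OF k O_pole fin T(2) P \<alpha> \<eta>_def \<gamma>' one_neq_zero]) (use two \<eta> h0 in \<open>simp_all\<close>)
  qed
qed

end
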